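(* For every integer $n\geq 1$, define $$\gamma^{(n)}=\int_{-\infty}^{\infty}x^{n}\exp\left(-x-e^{-x}\right)dx,\qquad \delta^{(n)}=-e\int_{-\infty}^{0}x^{n}\exp\left(-x-e^{-x}\right)dx.$$ Then: (i) at least one of $\gamma^{(n)}$ and $\delta^{(n)}/e$ is transcendental (i.e., lies in $\mathbb{R}\setminus\overline{\mathbb{Q}}$); and (ii) at least one of $\gamma^{(n)}$ and $\delta^{(n)}$ is transcendental.
   Context: $\overline{\mathbb{Q}}$ denotes the field of algebraic numbers. $\gamma^{(n)}$ is the $n$th raw moment of the Gumbel$(0,1)$ distribution (cdf $\exp(-e^{-x})$), and $\delta^{(n)}=-\mathrm{E}[X^n\mid X\leq 0]$ for $X\sim$ Gumbel$(0,1)$; for $n=1$ these are the Euler–Mascheroni constant $\gamma$ and the Euler–Gompertz constant $\delta$. *)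

theory Defs
  imports "HOL-Analysis.Analysis" "HOL-Computational_Algebra.Polynomial"
begin

text \<open>
  The function \<open>x \<mapsto> exp (- x - exp (- x))\<close> is the density of the Gumbel(0,1) distribution,
  whose distribution function is \<open>x \<mapsto> exp (- exp (- x))\<close>. Hence \<open>gumbel_moment n\<close> is the n-th
  raw moment; and since \<open>X \<le> 0\<close> has probability \<open>exp (-1)\<close>, \<open>gumbel_delta n\<close> is minus the
  conditional expectation of \<open>X ^ n\<close> given \<open>X \<le> 0\<close>. Both integrands are absolutely integrable.
\<close>

definition gumbel_moment :: "nat \<Rightarrow> real" where
  "gumbel_moment n = (LBINT x. x ^ n * exp (- x - exp (- x)))"

definition gumbel_delta :: "nat \<Rightarrow> real" where
  "gumbel_delta n = - exp 1 * (LBINT x:{..0}. x ^ n * exp (- x - exp (- x)))"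

end

theory Submission
  imports
    Defs
    "Jordan_Normal_Form.Determinant"
    "HOL-Computational_Algebra.Polynomial_FPS"
    "HOL-Computational_Algebra.Field_as_Ring"
    "HOL-Probability.Distributions"
begin

hide_const (open) Matrix.mat Matrix.vec Module.smult

text \<open>
  Expanding \<open>exp (- exp (- x))\<close> gives \<open>gumbel_moment n + gumbel_delta n / exp 1 = n! y\<^sub>n(1)\<close> with
  \<open>y\<^sub>n(z) = \<Sum>j\<ge>1. (-1)\<^sup>j\<^sup>-\<^sup>1 z\<^sup>j / (j! j\<^sup>n)\<close>, so it suffices that \<open>y\<^sub>n(1) \<noteq> \<alpha> + \<beta> / e\<close> for algebraic
  \<open>\<alpha>, \<beta>\<close>. Such a relation would confine all monomials \<open>e\<^sup>-\<^sup>a y\<^sub>n(1)\<^sup>b\<close> with \<open>a, b \<le> E\<close> to a rational vector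
  space whose dimension is less than their number for large \<open>E\<close>. This contradicts a special case of the
  Siegel-Shidlovskii theorem. Put \<open>\<theta> = z d/dz\<close>. Since \<open>\<theta> e\<^sup>-\<^sup>z = - z e\<^sup>-\<^sup>z\<close>, \<open>\<theta> y\<^sub>1 = 1 - e\<^sup>-\<^sup>z\<close> and
  \<open>\<theta> y\<^sub>k\<^sub>+\<^sub>1 = y\<^sub>k\<close>, the monomials in \<open>e\<^sup>-\<^sup>z, y\<^sub>1, \<dots>, y\<^sub>n\<close>, ordered by weight, satisfy a triangular system
  \<open>\<theta> f\<^sub>i = c\<^sub>i z f\<^sub>i + \<Sum>j<i. n\<^sub>i\<^sub>j f\<^sub>j\<close> with constants \<open>c\<^sub>i, n\<^sub>i\<^sub>j\<close>. For these systems Shidlovskii's lemma is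
  elementary: a rational vector annihilating all derivatives of a linear lin_form can be chosen constant, so it
  eliminates one of the functions.
\<close>

section \<open>Determinants of function matrices\<close>

text \<open>The dimension count absorbs the algebraic coefficients, so everything else runs over Q
  and no number field is needed: it suffices that functions independent over Q in a triangular
  system take independent values at 1. The arithmetic behind this: Siegel's lemma yields a linear
  form with integer coefficients vanishing at 0 to almost maximal order; its theta-derivatives,
  scaled to integers, are tiny at z = 1; N - 1 of them together with a supposed relation would give
  a nonzero integer determinant of absolute value below 1. Two features keep the argument
  elementary. Written with theta, the system is singular only at 0 and infinity, so a determinant
  that already vanishes to high order at 0 has few zeros left at 1. And independence is demanded
  over Q only; independence over Q(z) is a by-product of \<open>zero_estimate\<close>, because
  eliminating one function by a constant relation leaves a triangular system. Integrality is the
  remaining cost: the denominators j^n in y_n require lcm(1..k)^n, whence the exponential bound on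
  lcm(1..k).\<close>

definition fdet :: "nat \<Rightarrow> (nat \<Rightarrow> nat \<Rightarrow> 'a::comm_ring_1) \<Rightarrow> 'a" where
  "fdet N A = Determinant.det (Matrix.mat N N (\<lambda>(i, j). A i j))"

lemma fdet_leibniz: "fdet N A = (\<Sum>p | p permutes {0..<N}. signof p * (\<Prod>i = 0..<N. A i (p i)))"
proof -
  have *: "Matrix.mat N N (\<lambda>(i, j). A i j) \<in> carrier_mat N N" by simp
  show ?thesis unfolding fdet_def det_def'[OF *]
  proof (intro sum.cong refl arg_cong2[of _ _ _ _ "(*)"] prod.cong)
    fix p i assume "p \<in> {p. p permutes {0..<N}}" "i \<in> {0..<N}"
    then have "p i < N" using permutes_in_image[of p "{0..<N}" i] by auto
    then show "Matrix.mat N N (\<lambda>(i, j). A i j) $$ (i, p i) = A i (p i)"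
      using \<open>i \<in> _\<close> by simp
  qed
qed

lemma fdet_of_int: "fdet N (\<lambda>i j. of_int (A i j) :: 'a::comm_ring_1) = of_int (fdet N A)"
  by (auto simp: fdet_leibniz sign_def intro!: sum.cong prod.cong)

lemma fdet_transpose: "fdet N (\<lambda>i j. A j i) = fdet N A"
proof -
  have "Matrix.mat N N (\<lambda>(i, j). A j i) = transpose_mat (Matrix.mat N N (\<lambda>(i, j). A i j))"
    by (intro eq_matI) auto
  then show ?thesis unfolding fdet_def by (simp add: Determinant.det_transpose[of _ N])
qed

text \<open>The witness is a row of the adjugate. It turns N linear forms into the determinant times
  a single unknown.\<close>

lemma fdet_adjugate:
  assumes "j < N"
  shows "\<exists>w. \<forall>i<N. (\<Sum>k<N. w k * A k i) = (if i = j then fdet N A else 0)"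
proof -
  let ?A = "Matrix.mat N N (\<lambda>(i, j). A i j)"
  have A: "?A \<in> carrier_mat N N" by simp
  have B: "adj_mat ?A \<in> carrier_mat N N" by (rule adj_mat[OF A])
  have "(\<Sum>k<N. adj_mat ?A $$ (j, k) * A k i) = (if i = j then fdet N A else 0)" if "i < N" for i
  proof -
    have "(adj_mat ?A * ?A) $$ (j, i) = (Determinant.det ?A \<cdot>\<^sub>m 1\<^sub>m N) $$ (j, i)"
      by (simp only: adj_mat(3)[OF A])
    moreover have "(adj_mat ?A * ?A) $$ (j, i) = (\<Sum>k<N. adj_mat ?A $$ (j, k) * A k i)"
      using assms that B by (auto simp: scalar_prod_def atLeast0LessThan intro!: sum.cong)
    ultimately show ?thesis using assms that by (auto simp: fdet_def)
  qed
  then show ?thesis by (intro exI[of _ "\<lambda>k. adj_mat ?A $$ (j, k)"]) auto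
qed

text \<open>In the final determinant this puts the small values of the forms into column 0, at the
  price of a factor \<open>x k\<close>, there the value of the constant function 1.\<close>

lemma fdet_cramer:
  assumes "k < N"
  shows "fdet N (\<lambda>i j. if j = k then \<Sum>l<N. A i l * x l else A i j) = x k * fdet N A"
proof -
  let ?A = "Matrix.mat N N (\<lambda>(i, j). A i j)" and ?x = "Matrix.vec N x"
  have A: "?A \<in> carrier_mat N N" and x: "?x \<in> carrier_vec N" by simp_all
  have eq: "replace_col ?A (?A *\<^sub>v ?x) k
      = Matrix.mat N N (\<lambda>(i, j). if j = k then \<Sum>l<N. A i l * x l else A i j)"
    by (intro eq_matI) (auto simp: replace_col_def scalar_prod_def atLeast0LessThan intro!: sum.cong)
  show ?thesis using cramer_lemma_mat[OF A x assms] assms unfolding eq fdet_def by simp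
qed

lemma fdet_kernel:
  fixes A :: "nat \<Rightarrow> nat \<Rightarrow> 'a::idom"
  assumes "fdet N A = 0"
  shows "\<exists>u. (\<exists>j<N. u j \<noteq> 0) \<and> (\<forall>i<N. (\<Sum>j<N. A i j * u j) = 0)"
proof -
  let ?A = "Matrix.mat N N (\<lambda>(i, j). A i j)"
  have A: "?A \<in> carrier_mat N N" by simp
  obtain v where v: "v \<in> carrier_vec N" "v \<noteq> 0\<^sub>v N" "?A *\<^sub>v v = 0\<^sub>v N"
    using assms det_0_iff_vec_prod_zero[OF A] unfolding fdet_def by auto
  have "(\<Sum>j<N. A i j * v $ j) = 0" if "i < N" for i
  proof -
    have "(?A *\<^sub>v v) $ i = (\<Sum>j<N. A i j * v $ j)"
      using that v(1) by (auto simp: scalar_prod_def atLeast0LessThan intro!: sum.cong)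
    then show ?thesis using v(3) that by simp
  qed
  moreover have "\<exists>j<N. v $ j \<noteq> 0" using v(1,2) by (metis carrier_vecD eq_vecI index_zero_vec)
  ultimately show ?thesis by (intro exI[of _ "\<lambda>j. v $ j"]) auto
qed

lemma fdet_left_kernel:
  fixes A :: "nat \<Rightarrow> nat \<Rightarrow> 'a::idom"
  assumes "fdet N A = 0"
  shows "\<exists>u. (\<exists>j<N. u j \<noteq> 0) \<and> (\<forall>i<N. (\<Sum>j<N. u j * A j i) = 0)"
  using fdet_kernel[of N "\<lambda>i j. A j i"] assms unfolding fdet_transpose[of N A] by (simp add: mult.commute)

lemma fdet_mult: "fdet N A * fdet N B = fdet N (\<lambda>i j. \<Sum>k<N. A i k * B k j)"
proof -
  let ?A = "Matrix.mat N N (\<lambda>(i, j). A i j)" and ?B = "Matrix.mat N N (\<lambda>(i, j). B i j)"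
  have *: "?A * ?B = Matrix.mat N N (\<lambda>(i, j). \<Sum>k<N. A i k * B k j)"
    by (intro eq_matI) (auto simp: scalar_prod_def atLeast0LessThan intro!: sum.cong)
  have "fdet N A * fdet N B = Determinant.det (?A * ?B)"
    unfolding fdet_def by (rule Determinant.det_mult[where n = N, symmetric]) simp_all
  then show ?thesis unfolding * fdet_def .
qed

lemma fdet_lower_triangular:
  fixes A :: "nat \<Rightarrow> nat \<Rightarrow> 'a::idom"
  assumes "\<And>i j. i < j \<Longrightarrow> j < N \<Longrightarrow> A i j = 0" "\<And>i. i < N \<Longrightarrow> A i i \<noteq> 0"
  shows "fdet N A \<noteq> 0"
proof -
  let ?A = "Matrix.mat N N (\<lambda>(i, j). A i j)"
  have "fdet N A = prod_list (diag_mat ?A)"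
    unfolding fdet_def by (intro Determinant.det_lower_triangular[where n = N]) (auto simp: assms(1))
  also have "\<dots> \<noteq> 0" using assms(2) by (auto simp: prod_list_zero_iff diag_mat_def)
  finally show ?thesis .
qed

lemma fdet_zero_row: "r < N \<Longrightarrow> (\<And>j. j < N \<Longrightarrow> A r j = 0) \<Longrightarrow> fdet N A = 0"
  unfolding fdet_leibniz
proof (intro sum.neutral ballI)
  fix p assume r: "r < N" "\<And>j. j < N \<Longrightarrow> A r j = 0" "p \<in> {p. p permutes {0..<N}}"
  then have "p r < N" using permutes_in_image[of p "{0..<N}" r] by auto
  then have "(\<Prod>i = 0..<N. A i (p i)) = 0" using r(1) by (intro prod_zero) (auto intro: r(2) bexI[of _ r])
  then show "signof p * (\<Prod>i = 0..<N. A i (p i)) = 0" by simp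
qed

lemma degree_fdet_le:
  assumes "\<And>i j. i < N \<Longrightarrow> j < N \<Longrightarrow> degree (A i j) \<le> k"
  shows "degree (fdet N A) \<le> k * N"
  unfolding fdet_def by (rule degree_det_le) (auto simp: assms)

text \<open>The rows are chosen one at a time: a row not orthogonal to some vector orthogonal to the
  previous ones.\<close>
lemma exists_nonsingular_rows:
  fixes v0 :: "nat \<Rightarrow> 'a::idom"
  assumes v0: "\<exists>j<N. v0 j \<noteq> 0"
    and S: "\<And>u. \<exists>j<N. u j \<noteq> 0 \<Longrightarrow> \<exists>s\<in>S. (\<Sum>j<N. s j * u j) \<noteq> 0"
  shows "\<exists>V. V 0 = v0 \<and> (\<forall>i. 0 < i \<longrightarrow> i < N \<longrightarrow> V i \<in> S) \<and> fdet N V \<noteq> 0"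
proof -
  let ?dot = "\<lambda>v u. \<Sum>j<N. v j * u j"
  have ex: "r \<le> N \<Longrightarrow> r > 0 \<Longrightarrow> \<exists>V U. V 0 = v0 \<and> (\<forall>i. 0 < i \<longrightarrow> i < r \<longrightarrow> V i \<in> S) \<and>
      (\<forall>i<r. \<forall>j<i. ?dot (V j) (U i) = 0) \<and> (\<forall>i<r. ?dot (V i) (U i) \<noteq> 0)" for r
  proof (induction r)
    case 0
    then show ?case by simp
  next
    case (Suc r)
    show ?case
    proof (cases "r = 0")
      case True
      obtain j where j: "j < N" "v0 j \<noteq> 0" using v0 by auto
      have "?dot v0 (\<lambda>k. if k = j then 1 else 0) = v0 j" using j(1) by (simp add: if_distrib sum.delta cong: if_cong)
      then show ?thesis using True j
        by (intro exI[of _ "\<lambda>_. v0"] exI[of _ "\<lambda>_ k. if k = j then 1 else 0"]) auto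
    next
      case False
      then obtain V U where V: "V 0 = v0" "\<And>i. 0 < i \<Longrightarrow> i < r \<Longrightarrow> V i \<in> S"
        "\<And>i j. i < r \<Longrightarrow> j < i \<Longrightarrow> ?dot (V j) (U i) = 0" "\<And>i. i < r \<Longrightarrow> ?dot (V i) (U i) \<noteq> 0"
        using Suc.IH Suc.prems by (auto simp only: Suc_leD neq0_conv) blast
      \<comment> \<open>Fewer than N rows, padded with zero rows, form a singular matrix; a kernel
        vector is orthogonal to all rows chosen so far.\<close>
      have "fdet N (\<lambda>i j. if i < r then V i j else 0) = 0"
        using Suc.prems by (intro fdet_zero_row[of r]) auto
      then obtain u where u: "\<exists>j<N. u j \<noteq> 0" "\<And>i. i < N \<Longrightarrow> (\<Sum>j<N. (if i < r then V i j else 0) * u j) = 0"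
        using fdet_kernel by blast
      have u': "?dot (V i) u = 0" if "i < r" for i
        using u(2)[of i] that Suc.prems by simp
      obtain s where s: "s \<in> S" "?dot s u \<noteq> 0" using S[OF u(1)] by blast
      show ?thesis
        using V s u' False
        by (intro exI[of _ "V(r := s)"] exI[of _ "U(r := u)"]) (auto simp: less_Suc_eq)
    qed
  qed
  have "N > 0" using v0 by auto
  with ex[of N] obtain V U where V: "V 0 = v0" "\<And>i. 0 < i \<Longrightarrow> i < N \<Longrightarrow> V i \<in> S"
    "\<And>i j. i < N \<Longrightarrow> j < i \<Longrightarrow> ?dot (V j) (U i) = 0" "\<And>i. i < N \<Longrightarrow> ?dot (V i) (U i) \<noteq> 0"
    by blast
  \<comment> \<open>The products of rows of \<open>V\<close> with rows of \<open>U\<close> form a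
    lower triangular matrix with nonzero diagonal.\<close>
  have "fdet N V * fdet N (\<lambda>i j. U j i) \<noteq> 0"
    unfolding fdet_mult by (rule fdet_lower_triangular) (use V in auto)
  then show ?thesis using V(1,2) by (intro exI[of _ V]) auto
qed

section \<open>Triangular systems and dependent derivatives\<close>

text \<open>theta is preferred to d/dz because it acts diagonally on coefficients: degrees do not
  grow, orders of vanishing at 0 do not drop, and the system has no denominator z.\<close>

definition poly_theta :: "rat poly \<Rightarrow> rat poly" where
  "poly_theta p = pCons 0 (pderiv p)"

definition fps_theta :: "'a::comm_ring_1 fps \<Rightarrow> 'a fps" where
  "fps_theta f = fps_X * fps_deriv f"

lemma coeff_poly_theta: "coeff (poly_theta p) k = of_nat k * coeff p k"
  by (cases k) (auto simp: poly_theta_def coeff_pderiv)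

lemma fps_theta_nth: "fps_nth (fps_theta f) k = of_nat k * fps_nth f k"
  by (cases k) (auto simp: fps_theta_def)

lemma pCons_diff: "pCons 0 (p - q :: rat poly) = pCons 0 p - pCons 0 q"
  by simp

lemma poly_theta_0 [simp]: "poly_theta 0 = 0" by (simp add: poly_theta_def)

lemma poly_theta_add: "poly_theta (p + q) = poly_theta p + poly_theta q"
  by (simp add: poly_eq_iff coeff_poly_theta algebra_simps)

lemma poly_theta_mult: "poly_theta (p * q) = poly_theta p * q + p * poly_theta q"
  by (simp add: poly_theta_def pderiv_mult)

lemma poly_theta_sum: "poly_theta (\<Sum>i\<in>A. p i) = (\<Sum>i\<in>A. poly_theta (p i))"
  by (induction A rule: infinite_finite_induct) (simp_all add: poly_theta_add)

lemma degree_poly_theta_le: "degree (poly_theta p) \<le> degree p"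
  by (rule degree_le) (simp add: coeff_poly_theta coeff_eq_0)

lemma fps_theta_add: "fps_theta (f + g) = fps_theta f + fps_theta g"
  by (simp add: fps_theta_def algebra_simps)

lemma fps_theta_mult: "fps_theta (f * g) = fps_theta f * g + f * fps_theta g"
  by (simp add: fps_theta_def algebra_simps)

lemma fps_theta_sum: "fps_theta (\<Sum>i\<in>A. f i) = (\<Sum>i\<in>A. fps_theta (f i))"
  by (induction A rule: infinite_finite_induct) (simp_all add: fps_theta_add, simp_all add: fps_theta_def)

lemma fps_theta_const_mult: "fps_theta (fps_const a * f) = fps_const a * fps_theta f"
  by (simp add: fps_theta_def algebra_simps)

lemma fps_of_poly_poly_theta: "fps_of_poly (poly_theta p) = fps_theta (fps_of_poly p)"
  by (simp add: fps_eq_iff fps_theta_nth coeff_poly_theta)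

text \<open>The substitution \<open>u = r s\<close> turns the equation into \<open>\<theta> r - c z r = \<kappa>\<close> for a rational function
  \<open>r\<close>; it has no pole since \<open>\<theta>\<close> raises (or, at 0, preserves) the order of a pole.\<close>
lemma rational_solution_const:
  fixes s u :: "rat poly"
  assumes "s \<noteq> 0"
    and eq: "s * poly_theta u - u * poly_theta s - smult c (pCons 0 (s * u)) = smult \<kappa> (s * s)"
  obtains r where "u = smult r s" "\<kappa> = 0" "c = 0 \<or> r = 0"
proof -
  define g where "g = gcd s u"
  have g0: "g \<noteq> 0" using assms(1) by (simp add: g_def)
  obtain s' u' where su: "s = s' * g" "u = u' * g" "coprime s' u'"
    using gcd_coprime_exists[of s u] g0 unfolding g_def by blast
  have s0: "s' \<noteq> 0" using su(1) assms(1) by auto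
  have "g * g * (s' * poly_theta u' - u' * poly_theta s' - smult c (pCons 0 (s' * u'))) = g * g * smult \<kappa> (s' * s')"
    using eq unfolding su poly_theta_mult
    by (simp add: algebra_simps flip: mult_pCons_left)
  then have eq': "s' * poly_theta u' - u' * poly_theta s' - smult c (pCons 0 (s' * u')) = smult \<kappa> (s' * s')"
    unfolding mult_cancel_left mult_eq_0_iff using g0 by blast
  have "u' * poly_theta s' = s' * (poly_theta u' - smult c (pCons 0 u') - smult \<kappa> s')"
    using eq' by (simp add: algebra_simps)
  then have "s' dvd u' * poly_theta s'" by (metis dvd_triv_left)
  then have "s' dvd poly_theta s'" using su(3) coprime_dvd_mult_right_iff by blast
  then obtain q where q: "poly_theta s' = s' * q" by auto
  have deg: "degree q = 0"
  proof (cases "q = 0")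
    case False
    then have "degree s' + degree q \<le> degree s'"
      using degree_poly_theta_le[of s'] unfolding q by (simp add: degree_mult_eq s0)
    then show ?thesis by simp
  qed simp
  then obtain k where k: "q = [:k:]" by (metis degree_eq_zeroE)
  \<comment> \<open>As \<open>poly_theta s'\<close> is k times \<open>s'\<close> with k constant,
    comparing coefficients shows that \<open>s'\<close> is a monomial of degree k: the only possible
    pole is at 0.\<close>
  have mon: "(of_nat i - k) * coeff s' i = 0" for i
  proof -
    have "of_nat i * coeff s' i = k * coeff s' i"
      using arg_cong[OF q, of "\<lambda>p. coeff p i"] by (simp add: k coeff_poly_theta)
    then show ?thesis by (simp add: algebra_simps)
  qed
  define d where "d = degree s'"
  have kd: "k = of_nat d" using mon[of d] s0 by (simp add: d_def)
  have "s' * (poly_theta u' - smult k u' - smult c (pCons 0 u')) = s' * smult \<kappa> s'"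
    using eq' by (simp add: q k algebra_simps)
  then have eq'': "poly_theta u' - smult k u' - smult c (pCons 0 u') = smult \<kappa> s'"
    unfolding mult_cancel_left using s0 by blast
  have d0: "d = 0"
  proof (rule ccontr)
    assume "d \<noteq> 0"
    then have "coeff s' 0 = 0" using mon[of 0] kd by simp
    moreover have "coeff u' 0 = 0"
      using arg_cong[OF eq'', of "\<lambda>p. coeff p 0"] \<open>d \<noteq> 0\<close> \<open>coeff s' 0 = 0\<close> by (simp add: coeff_poly_theta kd)
    ultimately have "[:0, 1:] dvd s'" "[:0, 1:] dvd u'"
      by (simp_all add: dvd_iff_poly_eq_0 poly_0_coeff_0)
    then have "is_unit ([:0, 1:] :: rat poly)" using su(3) by (meson coprime_common_divisor)
    then show False by (simp add: is_unit_iff_degree)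
  qed
  then obtain a where a: "s' = [:a:]" unfolding d_def by (metis degree_eq_zeroE)
  have a0: "a \<noteq> 0" using s0 a by simp
  have "k = 0" using kd d0 by simp
  have k0: "\<kappa> = 0"
    using arg_cong[OF eq'', of "\<lambda>p. coeff p 0"] a a0 \<open>k = 0\<close> by (simp add: coeff_poly_theta)
  \<comment> \<open>For c nonzero this recursion never stops after a nonzero coefficient; for c = 0
    only the constant coefficient survives.\<close>
  have rec: "of_nat (Suc i) * coeff u' (Suc i) = c * coeff u' i" for i
    using arg_cong[OF eq'', of "\<lambda>p. coeff p (Suc i)"] k0 \<open>k = 0\<close> by (simp add: coeff_poly_theta)
  have "degree u' = 0 \<and> (c = 0 \<or> u' = 0)"
  proof (cases "c = 0")
    case True
    have "coeff u' i = 0" if "i > 0" for i using rec[of "i - 1"] that True by (simp del: of_nat_Suc)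
    then show ?thesis using True by (metis gr0I leading_coeff_0_iff degree_0)
  next
    case False
    have "coeff u' (Suc (degree u')) = 0" by (simp add: coeff_eq_0)
    then have "u' = 0" using rec[of "degree u'"] False by simp
    then show ?thesis by simp
  qed
  then obtain b where b: "u' = [:b:]" "c = 0 \<or> b = 0" by (metis degree_eq_zeroE pCons_eq_0_iff)
  have "u = smult (b / a) s" using su b a a0 by simp
  then show ?thesis using that[of "b / a"] k0 b(2) by auto
qed

text \<open>With A the matrix of the system this is theta P + P A for a row vector P, the
  coefficients of theta applied to the form; see \<open>fps_theta_lin_form\<close>.\<close>

definition lf_deriv :: "nat \<Rightarrow> (nat \<Rightarrow> rat) \<Rightarrow> (nat \<Rightarrow> nat \<Rightarrow> rat) \<Rightarrow> (nat \<Rightarrow> rat poly) \<Rightarrow> nat \<Rightarrow> rat poly" where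
  "lf_deriv N c n P j = poly_theta (P j) + smult (c j) (pCons 0 (P j)) + (\<Sum>i\<in>{j<..<N}. smult (n i j) (P i))"

text \<open>The operator theta u - A u on column vectors, which would annihilate a solution of the
  system.\<close>

definition dual_deriv :: "(nat \<Rightarrow> rat) \<Rightarrow> (nat \<Rightarrow> nat \<Rightarrow> rat) \<Rightarrow> (nat \<Rightarrow> rat poly) \<Rightarrow> nat \<Rightarrow> rat poly" where
  "dual_deriv c n u i = poly_theta (u i) - smult (c i) (pCons 0 (u i)) - (\<Sum>j<i. smult (n i j) (u j))"

definition triangular_sys :: "nat \<Rightarrow> (nat \<Rightarrow> rat) \<Rightarrow> (nat \<Rightarrow> nat \<Rightarrow> rat) \<Rightarrow> (nat \<Rightarrow> rat fps) \<Rightarrow> bool" where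
  "triangular_sys N c n f \<longleftrightarrow> (\<forall>i<N. fps_theta (f i) =
     fps_const (c i) * (fps_X * f i) + (\<Sum>j<i. fps_const (n i j) * f j))"

definition lin_form :: "nat \<Rightarrow> (nat \<Rightarrow> rat poly) \<Rightarrow> (nat \<Rightarrow> rat fps) \<Rightarrow> rat fps" where
  "lin_form N P f = (\<Sum>j<N. fps_of_poly (P j) * f j)"

lemma sum_swap_triangle:
  fixes F :: "nat \<Rightarrow> nat \<Rightarrow> 'a::comm_monoid_add"
  shows "(\<Sum>j<N. \<Sum>i\<in>{j<..<N}. F i j) = (\<Sum>i<N. \<Sum>j<i. F i j)"
proof -
  have "(\<Sum>j<N. \<Sum>i\<in>{j<..<N}. F i j) = (\<Sum>j<N. \<Sum>i<N. if j < i then F i j else 0)"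
    by (intro sum.cong refl sum.mono_neutral_cong_left) auto
  also have "\<dots> = (\<Sum>i<N. \<Sum>j<N. if j < i then F i j else 0)" by (rule sum.swap)
  also have "\<dots> = (\<Sum>i<N. \<Sum>j<i. F i j)"
    by (intro sum.cong refl sum.mono_neutral_cong_right) auto
  finally show ?thesis .
qed

text \<open>Product rule: the contributions P A u of the two operators cancel.\<close>

lemma poly_theta_pairing:
  "poly_theta (\<Sum>j<N. P j * u j) = (\<Sum>j<N. lf_deriv N c n P j * u j) + (\<Sum>j<N. P j * dual_deriv c n u j)"
proof -
  have "(\<Sum>j<N. (\<Sum>i\<in>{j<..<N}. smult (n i j) (P i)) * u j) = (\<Sum>i<N. P i * (\<Sum>j<i. smult (n i j) (u j)))"
    using sum_swap_triangle[where F = "\<lambda>i j. smult (n i j) (P i * u j)" and N = N]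
    by (simp add: sum_distrib_left sum_distrib_right)
  then show ?thesis
    by (simp add: lf_deriv_def dual_deriv_def poly_theta_sum poly_theta_mult algebra_simps sum.distrib sum_subtractf)
qed

lemma fps_theta_lin_form:
  assumes "triangular_sys N c n f"
  shows "fps_theta (lin_form N P f) = lin_form N (lf_deriv N c n P) f"
proof -
  have "fps_theta (lin_form N P f) = (\<Sum>j<N. fps_of_poly (poly_theta (P j)) * f j + fps_of_poly (P j) * fps_theta (f j))"
    by (simp add: lin_form_def fps_theta_sum fps_theta_mult fps_of_poly_poly_theta)
  also have "\<dots> = (\<Sum>j<N. fps_of_poly (poly_theta (P j)) * f j +
      fps_of_poly (P j) * (fps_const (c j) * (fps_X * f j) + (\<Sum>i<j. fps_const (n j i) * f i)))"
    using assms by (intro sum.cong refl) (simp add: triangular_sys_def)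
  also have "\<dots> = (\<Sum>j<N. fps_of_poly (poly_theta (P j) + smult (c j) (pCons 0 (P j))) * f j) +
      (\<Sum>j<N. \<Sum>i<j. fps_const (n j i) * (fps_of_poly (P j) * f i))"
    by (simp add: sum.distrib algebra_simps fps_of_poly_add fps_of_poly_smult fps_of_poly_pCons sum_distrib_left)
  also have "(\<Sum>j<N. \<Sum>i<j. fps_const (n j i) * (fps_of_poly (P j) * f i)) =
     (\<Sum>j<N. (\<Sum>i\<in>{j<..<N}. fps_of_poly (smult (n i j) (P i))) * f j)"
    unfolding sum_swap_triangle[symmetric] by (simp add: sum_distrib_right fps_of_poly_smult mult.assoc)
  finally show ?thesis
    by (simp add: lin_form_def lf_deriv_def fps_of_poly_add fps_of_poly_sum algebra_simps sum.distrib)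
qed

lemma degree_lf_deriv_le:
  assumes "\<And>j. j < N \<Longrightarrow> degree (P j) \<le> m" "j < N"
  shows "degree (lf_deriv N c n P j) \<le> Suc m"
  unfolding lf_deriv_def
proof (intro degree_add_le degree_sum_le)
  show "degree (poly_theta (P j)) \<le> Suc m" using degree_poly_theta_le[of "P j"] assms(1)[OF assms(2)] by linarith
  show "degree (smult (c j) (pCons 0 (P j))) \<le> Suc m"
    using assms(1)[OF assms(2)] degree_pCons_le[of 0 "P j"] degree_smult_le[of "c j" "pCons 0 (P j)"] by linarith
  show "degree (smult (n i j) (P i)) \<le> Suc m" if "i \<in> {j<..<N}" for i
    using assms(1)[of i] that degree_smult_le[of "n i j" "P i"] by simp
qed simp

lemma degree_lf_deriv_pow_le:
  assumes "\<And>j. j < N \<Longrightarrow> degree (P j) \<le> m"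
  shows "j < N \<Longrightarrow> degree ((lf_deriv N c n ^^ k) P j) \<le> m + k"
proof (induction k arbitrary: j)
  case (Suc k)
  have "degree (lf_deriv N c n ((lf_deriv N c n ^^ k) P) j) \<le> Suc (m + k)"
    using Suc by (intro degree_lf_deriv_le) auto
  then show ?case by simp
qed (use assms in simp)

text \<open>If the iterated derivatives of \<open>P\<close> are dependent, the vectors orthogonal to all of them are
  stable under the dual connection \<open>dual_deriv\<close>. Since \<open>dual_deriv\<close> is triangular, one of those vectors
  whose first nonzero entry comes as late as possible is an eigenvector up to a scalar.\<close>
lemma constant_relation:
  fixes P :: "nat \<Rightarrow> rat poly"
  assumes det0: "fdet N (\<lambda>k. (lf_deriv N c n ^^ k) P) = 0"
    and P0: "\<exists>i<N. P i \<noteq> 0"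
  shows "\<exists>i0 r. i0 < N \<and> r i0 = 1 \<and> (\<forall>i<i0. r i = 0) \<and> (\<Sum>i<N. smult (r i) (P i)) = 0 \<and>
    (\<forall>i<N. r i = 0 \<or> c i = c i0) \<and> (\<forall>i<N. i0 < i \<longrightarrow> (\<Sum>j<i. n i j * r j) = 0)"
proof -
  let ?D = "\<lambda>k. (lf_deriv N c n ^^ k) P"
  obtain u1 where u1: "\<exists>j<N. u1 j \<noteq> 0" "\<And>k. k < N \<Longrightarrow> (\<Sum>j<N. ?D k j * u1 j) = 0"
    using fdet_kernel[OF det0] by blast
  obtain q where q: "\<exists>k<N. q k \<noteq> 0" "\<And>i. i < N \<Longrightarrow> (\<Sum>k<N. q k * ?D k i) = 0"
    using fdet_left_kernel[OF det0] by blast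
  \<comment> \<open>The last row occurring in the left relation, so row \<open>l\<close> depends on
    the earlier ones. Orthogonality to the first \<open>l\<close> rows thus implies orthogonality to
    row \<open>l\<close>, which makes it stable under \<open>dual_deriv\<close>.\<close>
  define l where "l = Max {k. k < N \<and> q k \<noteq> 0}"
  have fin: "finite {k. k < N \<and> q k \<noteq> 0}" by simp
  have "l \<in> {k. k < N \<and> q k \<noteq> 0}" unfolding l_def using q(1) by (intro Max_in fin) auto
  then have l: "l < N" "q l \<noteq> 0" by auto
  have lmax: "q k = 0" if "l < k" "k < N" for k
    using that Max_ge[OF fin, of k] unfolding l_def[symmetric] by fastforce
  have ql: "q l * ?D l i = - (\<Sum>k<l. q k * ?D k i)" if "i < N" for i
  proof -
    have "(\<Sum>k<N. q k * ?D k i) = (\<Sum>k<Suc l. q k * ?D k i)"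
      by (intro sum.mono_neutral_right) (use l lmax in auto)
    then show ?thesis using q(2)[OF that] by (simp add: eq_neg_iff_add_eq_0 add.commute)
  qed
  have l0: "l > 0"
  proof (rule ccontr)
    assume "\<not> l > 0"
    then have "P i = 0" if "i < N" for i using ql[OF that] l by simp
    then show False using P0 by auto
  qed
  define orth where "orth u \<longleftrightarrow> (\<forall>k<l. (\<Sum>j<N. ?D k j * u j) = 0)" for u
  have orth_l: "(\<Sum>j<N. ?D l j * u j) = 0" if "orth u" for u
  proof -
    have "q l * (\<Sum>j<N. ?D l j * u j) = (\<Sum>j<N. (q l * ?D l j) * u j)"
      by (simp add: sum_distrib_left mult.assoc)
    also have "\<dots> = - (\<Sum>j<N. \<Sum>k<l. q k * (?D k j * u j))"
      using ql by (simp add: sum_distrib_right mult.assoc sum_negf)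
    also have "\<dots> = - (\<Sum>k<l. q k * (\<Sum>j<N. ?D k j * u j))"
      by (subst sum.swap) (simp add: sum_distrib_left)
    also have "\<dots> = 0" using that by (simp add: orth_def)
    finally show ?thesis using l by simp
  qed
  have orth_Nab: "orth (dual_deriv c n u)" if "orth u" for u
    unfolding orth_def
  proof (intro allI impI)
    fix k assume "k < l"
    have "(\<Sum>j<N. ?D k j * u j) = 0" using that \<open>k < l\<close> by (simp add: orth_def)
    moreover have "(\<Sum>j<N. ?D (Suc k) j * u j) = 0"
      using that \<open>k < l\<close> orth_l[OF that] unfolding orth_def by (metis Suc_lessI)
    moreover have "?D (Suc k) = lf_deriv N c n (?D k)" by simp
    ultimately show "(\<Sum>j<N. ?D k j * dual_deriv c n u j) = 0"
      using poly_theta_pairing[where N = N and P = "?D k" and u = u and c = c and n = n] by (simp only: poly_theta_0 add_0_left)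
  qed
  define I where "I = {i. i < N \<and> (\<exists>u. orth u \<and> u i \<noteq> 0 \<and> (\<forall>j<i. u j = 0))}"
  have first: "\<exists>i\<in>I. u i \<noteq> 0 \<and> (\<forall>j<i. u j = 0)" if "orth u" and nz: "\<exists>j<N. u j \<noteq> 0" for u
  proof -
    define i where "i = (LEAST i. u i \<noteq> 0)"
    have "u i \<noteq> 0" unfolding i_def using that(2) LeastI[of "\<lambda>i. u i \<noteq> 0"] by blast
    moreover have less: "u j = 0" if "j < i" for j using not_less_Least[of j] that unfolding i_def by blast
    moreover have "i < N"
    proof -
      obtain j where "j < N" "u j \<noteq> 0" using nz by blast
      then have "i \<le> j" unfolding i_def by (intro Least_le)
      then show ?thesis using \<open>j < N\<close> by simp
    qed
    ultimately show ?thesis using that(1) unfolding I_def by blast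
  qed
  have finI: "finite I" by (simp add: I_def)
  have "orth u1" using u1(2) l(1) by (simp add: orth_def)
  then have "I \<noteq> {}" using first u1(1) by blast
  define i0 where "i0 = Max I"
  have "i0 \<in> I" unfolding i0_def using finI \<open>I \<noteq> {}\<close> by (rule Max_in)
  then obtain u where u: "i0 < N" "orth u" "u i0 \<noteq> 0" "\<And>j. j < i0 \<Longrightarrow> u j = 0"
    unfolding I_def by blast
  define s where "s = u i0"
  \<comment> \<open>Cross-multiplying cancels entry \<open>i0\<close>, and triangularity keeps the
    earlier entries zero. By maximality of \<open>i0\<close> the vector vanishes, so
    \<open>dual_deriv c n u\<close> is a rational function times \<open>u\<close>.\<close>
  define v where "v i = s * dual_deriv c n u i - dual_deriv c n u i0 * u i" for i
  have "orth v"
    unfolding orth_def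
  proof (intro allI impI)
    fix k assume "k < l"
    have "(\<Sum>j<N. ?D k j * v j) = s * (\<Sum>j<N. ?D k j * dual_deriv c n u j) - dual_deriv c n u i0 * (\<Sum>j<N. ?D k j * u j)"
      by (simp add: v_def algebra_simps sum_subtractf sum_distrib_left)
    then show "(\<Sum>j<N. ?D k j * v j) = 0"
      using u(2) orth_Nab[OF u(2)] \<open>k < l\<close> by (simp add: orth_def)
  qed
  have v_le: "v i = 0" if "i \<le> i0" for i
    using that u(4) by (cases "i = i0") (auto simp: v_def s_def dual_deriv_def)
  have v0: "v i = 0" if "i < N" for i
  proof (rule ccontr)
    assume "v i \<noteq> 0"
    then obtain i' where "i' \<in> I" "v i' \<noteq> 0" using first[OF \<open>orth v\<close>] \<open>i < N\<close> by blast
    moreover then have "i' \<le> i0" unfolding i0_def using finI by simp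
    ultimately show False using v_le by blast
  qed
  have s0: "s \<noteq> 0" using u by (simp add: s_def)
  have Nab0: "dual_deriv c n u i0 = poly_theta s - smult (c i0) (pCons 0 s)"
    using u(4) by (simp add: dual_deriv_def s_def)
  define r where "r i = coeff (u i) (degree s) / lead_coeff s" for i
  have rI: "u i = smult a s \<Longrightarrow> r i = a" for i a using s0 by (simp add: r_def)
  have main: "u i = smult (r i) s \<and> (r i = 0 \<or> c i = c i0) \<and> (i0 < i \<longrightarrow> (\<Sum>j<i. n i j * r j) = 0)"
    if "i < N" for i
    using that
  proof (induction i rule: less_induct)
    case (less i)
    consider "i < i0" | "i = i0" | "i0 < i" by linarith
    then show ?case
    proof cases
      case 1
      then show ?thesis using rI[of i 0] u(4) by simp
    next
      case 2
      then show ?thesis using rI[of i 1] by (simp add: s_def)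
    next
      case 3
      have IH: "u j = smult (r j) s" if "j < i" for j using less that by simp
      define \<kappa> where "\<kappa> = (\<Sum>j<i. n i j * r j)"
      have "(\<Sum>j<i. smult (n i j) (u j)) = smult \<kappa> s"
        by (simp add: IH \<kappa>_def smult_sum)
      then have "s * (poly_theta (u i) - smult (c i) (pCons 0 (u i)) - smult \<kappa> s) -
          (poly_theta s - smult (c i0) (pCons 0 s)) * u i = 0"
        using v0[OF less.prems] unfolding v_def Nab0 by (simp add: dual_deriv_def)
      \<comment> \<open>Rows \<open>i\<close> and \<open>i0\<close> of the eigenvector equation
        combined: r = \<open>u i\<close> / \<open>s\<close> satisfies theta r - (\<open>c i\<close>
        - \<open>c i0\<close>) z r = \<open>\<kappa>\<close>.\<close>
      then have "s * poly_theta (u i) - u i * poly_theta s - smult (c i - c i0) (pCons 0 (s * u i)) = smult \<kappa> (s * s)"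
        by (simp add: algebra_simps smult_diff_left pCons_diff del: diff_pCons)
      from rational_solution_const[OF s0 this]
      obtain a where "u i = smult a s" "\<kappa> = 0" "c i - c i0 = 0 \<or> a = 0" by blast
      then show ?thesis using rI[of i a] by (auto simp: \<kappa>_def)
    qed
  qed
  have "s * (\<Sum>i<N. smult (r i) (P i)) = (\<Sum>i<N. P i * u i)"
    using main by (simp add: sum_distrib_left mult.commute)
  also have "\<dots> = 0" using u(2) l0 unfolding orth_def by (metis funpow_0)
  finally have "(\<Sum>i<N. smult (r i) (P i)) = 0" using s0 by simp
  moreover have "r i0 = 1" using s0 by (simp add: r_def s_def)
  moreover have "r i = 0" if "i < i0" for i using u(4) that by (simp add: r_def)
  ultimately show ?thesis using u(1) main by blast
qed

section \<open>Zero estimate\<close>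

definition skip :: "nat \<Rightarrow> nat \<Rightarrow> nat" where
  "skip i0 i = (if i < i0 then i else Suc i)"

lemma skip_surj: "j < Suc N \<Longrightarrow> i0 < Suc N \<Longrightarrow> j \<noteq> i0 \<Longrightarrow> \<exists>i<N. j = skip i0 i"
  by (rule exI[of _ "if j < i0 then j else j - 1"]) (auto simp: skip_def)

lemma skip_less: "i < N \<Longrightarrow> i0 < Suc N \<Longrightarrow> skip i0 i < Suc N"
  by (auto simp: skip_def)

lemma sum_skip:
  fixes F :: "nat \<Rightarrow> 'a::comm_monoid_add"
  assumes "i0 < Suc N"
  shows "(\<Sum>j<Suc N. F j) = F i0 + (\<Sum>j<N. F (skip i0 j))"
proof -
  have inj: "inj_on (skip i0) {..<N}" by (auto simp: inj_on_def skip_def split: if_splits)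
  have img: "{..<Suc N} = insert i0 (skip i0 ` {..<N})"
  proof (rule equalityI; rule subsetI)
    fix j assume "j \<in> {..<Suc N}"
    then show "j \<in> insert i0 (skip i0 ` {..<N})"
      using skip_surj[of j N i0] assms by (cases "j = i0") auto
  qed (use assms in \<open>auto simp: skip_less\<close>)
  have "i0 \<notin> skip i0 ` {..<N}" by (auto simp: skip_def split: if_splits)
  then show ?thesis unfolding img by (simp add: sum.reindex[OF inj] o_def)
qed

lemma fps_const_sum: "fps_const (\<Sum>i\<in>A. a i) = (\<Sum>i\<in>A. fps_const (a i))"
  by (induction A rule: infinite_finite_induct) (simp_all flip: fps_const_add)

text \<open>Independence over Q in quantitative form. Elimination replaces the functions by
  Q-combinations of them, so the same \<open>v\<close> serves throughout the induction.\<close>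

definition order_bound :: "nat \<Rightarrow> (nat \<Rightarrow> rat fps) \<Rightarrow> nat \<Rightarrow> bool" where
  "order_bound N f v \<longleftrightarrow> (\<forall>a. (\<exists>i<N. a i \<noteq> 0) \<longrightarrow>
     (\<exists>k\<le>v. fps_nth (\<Sum>i<N. fps_const (a i) * f i) k \<noteq> 0))"

text \<open>A constant relation expresses \<open>P i0\<close> by the other \<open>P i\<close>, and
  the form becomes the sum of \<open>P i\<close> times (\<open>f i\<close> - \<open>r i\<close>
  \<open>f i0\<close>). The side conditions of \<open>constant_relation\<close> make the new
  functions triangular: equal \<open>c\<close> where \<open>r\<close> is nonzero settles the
  diagonal, and the vanishing sums remove \<open>f i0\<close>.\<close>

lemma eliminate_function:
  assumes sys: "triangular_sys (Suc N) c n f" and bd: "order_bound (Suc N) f v"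
    and det0: "fdet (Suc N) (\<lambda>k. (lf_deriv (Suc N) c n ^^ k) P) = 0"
    and P0: "\<exists>i<Suc N. P i \<noteq> 0"
  obtains c' n' g i0 where "triangular_sys N c' n' g" "order_bound N g v" "i0 < Suc N"
    "lin_form (Suc N) P f = lin_form N (\<lambda>i. P (skip i0 i)) g" "\<exists>i<N. P (skip i0 i) \<noteq> 0"
proof -
  obtain i0 r where r: "i0 < Suc N" "r i0 = 1" "\<And>i. i < i0 \<Longrightarrow> r i = 0"
    "(\<Sum>i<Suc N. smult (r i) (P i)) = 0"
    "\<And>i. i < Suc N \<Longrightarrow> r i = 0 \<or> c i = c i0"
    "\<And>i. i < Suc N \<Longrightarrow> i0 < i \<Longrightarrow> (\<Sum>j<i. n i j * r j) = 0"
    using constant_relation[OF det0 P0] by blast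
  let ?s = "skip i0"
  define g where "g i = f (?s i) - fps_const (r (?s i)) * f i0" for i
  define c' where "c' i = c (?s i)" for i
  \<comment> \<open>The correction stems from theta of \<open>f i0\<close>, which apart from its
    diagonal term involves only functions before \<open>i0\<close>; these are unchanged, as
    \<open>r\<close> vanishes there.\<close>
  define n' where "n' i j = n (?s i) (?s j) - r (?s i) * (if ?s j < i0 then n i0 (?s j) else 0)" for i j
  have f_skip: "f (?s i) = g i + fps_const (r (?s i)) * f i0" for i by (simp add: g_def)
  have sys': "fps_theta (f i) = fps_const (c i) * (fps_X * f i) + (\<Sum>j<i. fps_const (n i j) * f j)" if "i < Suc N" for i
    using sys that by (simp add: triangular_sys_def)
  have triangular: "triangular_sys N c' n' g"
    unfolding triangular_sys_def
  proof (intro allI impI)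
    fix i assume "i < N"
    then have I: "?s i < Suc N" using r(1) skip_less by blast
    show "fps_theta (g i) = fps_const (c' i) * (fps_X * g i) + (\<Sum>j<i. fps_const (n' i j) * g j)"
    proof (cases "i < i0")
      case True
      then have *: "?s j = j" "r j = 0" if "j \<le> i" for j using that r(3) by (auto simp: skip_def)
      then have "g j = f j" if "j \<le> i" for j using that by (simp add: g_def)
      then show ?thesis using * sys'[OF I] by (simp add: c'_def n'_def)
    next
      case False
      then have si: "?s i = Suc i" by (simp add: skip_def)
      have "(\<Sum>j<Suc i. fps_const (n (Suc i) j) * f j) =
          fps_const (n (Suc i) i0) * f i0 + (\<Sum>j<i. fps_const (n (Suc i) (?s j)) * f (?s j))"
        using False by (intro sum_skip) auto
      also have "(\<Sum>j<i. fps_const (n (Suc i) (?s j)) * f (?s j)) =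
          (\<Sum>j<i. fps_const (n (Suc i) (?s j)) * g j) + fps_const (\<Sum>j<i. n (Suc i) (?s j) * r (?s j)) * f i0"
        by (simp add: f_skip algebra_simps sum.distrib sum_distrib_left fps_const_sum flip: fps_const_mult)
      also have "fps_const (n (Suc i) i0) * f i0 + \<dots> = (\<Sum>j<i. fps_const (n (Suc i) (?s j)) * g j)
          + fps_const (n (Suc i) i0 * r i0 + (\<Sum>j<i. n (Suc i) (?s j) * r (?s j))) * f i0"
        using r(2) by (simp add: algebra_simps flip: fps_const_add)
      also have "n (Suc i) i0 * r i0 + (\<Sum>j<i. n (Suc i) (?s j) * r (?s j)) = (\<Sum>j<Suc i. n (Suc i) j * r j)"
        using False by (intro sum_skip[symmetric]) auto
      also have "\<dots> = 0" using r(6)[of "Suc i"] I si False by simp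
      finally have 1: "(\<Sum>j<Suc i. fps_const (n (Suc i) j) * f j) = (\<Sum>j<i. fps_const (n (Suc i) (?s j)) * g j)"
        by simp
      have "(\<Sum>j<i. fps_const (if ?s j < i0 then n i0 (?s j) else 0) * g j) = (\<Sum>j<i0. fps_const (n i0 j) * f j)"
      proof (rule sum.mono_neutral_cong_right)
        show "\<forall>j\<in>{..<i} - {..<i0}. fps_const (if ?s j < i0 then n i0 (?s j) else 0) * g j = 0"
          by (auto simp: skip_def)
        show "fps_const (if ?s j < i0 then n i0 (?s j) else 0) * g j = fps_const (n i0 j) * f j"
          if "j \<in> {..<i0}" for j
          using that r(3) by (simp add: skip_def g_def)
      qed (use False in auto)
      then have 2: "fps_theta (f i0) = fps_const (c i0) * (fps_X * f i0) +
          (\<Sum>j<i. fps_const (if ?s j < i0 then n i0 (?s j) else 0) * g j)"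
        using sys'[OF r(1)] by simp
      have 3: "fps_const (r (?s i)) * fps_const (c i0) = fps_const (r (?s i)) * fps_const (c (?s i))"
        using r(5)[OF I] by auto
      have "fps_theta (g i) = fps_theta (f (?s i)) - fps_const (r (?s i)) * fps_theta (f i0)"
        using fps_theta_add[of "g i" "fps_const (r (?s i)) * f i0"] by (simp add: fps_theta_const_mult flip: f_skip)
      also have "\<dots> = fps_const (c (?s i)) * (fps_X * f (?s i)) + (\<Sum>j<i. fps_const (n (?s i) (?s j)) * g j)
          - (fps_const (r (?s i)) * fps_const (c i0) * (fps_X * f i0) +
            fps_const (r (?s i)) * (\<Sum>j<i. fps_const (if ?s j < i0 then n i0 (?s j) else 0) * g j))"
        using sys'[OF I] 1 by (simp add: 2 si algebra_simps)
      also have "\<dots> = fps_const (c' i) * (fps_X * g i) + (\<Sum>j<i. fps_const (n' i j) * g j)"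
        unfolding 3 by (simp add: g_def c'_def n'_def algebra_simps sum_subtractf sum.distrib sum_distrib_left
            flip: fps_const_sub fps_const_mult)
      finally show ?thesis .
    qed
  qed
  have bd': "order_bound N g v"
    unfolding order_bound_def
  proof (intro allI impI)
    fix a assume a: "\<exists>i<N. a i \<noteq> (0::rat)"
    \<comment> \<open>Rewrites a combination of the \<open>g i\<close> in terms of the
      \<open>f j\<close>; entry \<open>i0\<close> collects the subtracted multiples of
      \<open>f i0\<close>.\<close>
    define b where "b j = (if j < i0 then a j else if j = i0 then - (\<Sum>i<N. a i * r (?s i)) else a (j - 1))" for j
    have b_skip: "b (?s i) = a i" for i by (auto simp: b_def skip_def)
    have "(\<Sum>i<Suc N. fps_const (b i) * f i) = fps_const (b i0) * f i0 + (\<Sum>i<N. fps_const (a i) * f (?s i))"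
      using sum_skip[OF r(1), of "\<lambda>i. fps_const (b i) * f i"] by (simp only: b_skip)
    also have "\<dots> = (\<Sum>i<N. fps_const (a i) * g i)"
      by (simp add: b_def g_def algebra_simps sum_subtractf sum_distrib_left fps_const_sum
            flip: fps_const_mult fps_const_neg)
    finally have eq: "(\<Sum>i<Suc N. fps_const (b i) * f i) = (\<Sum>i<N. fps_const (a i) * g i)" .
    obtain i where "i < N" "a i \<noteq> 0" using a by blast
    then have "\<exists>i<Suc N. b i \<noteq> 0" using b_skip skip_less[OF _ r(1)] by metis
    then show "\<exists>k\<le>v. fps_nth (\<Sum>i<N. fps_const (a i) * g i) k \<noteq> 0"
      using bd unfolding order_bound_def eq[symmetric] by blast
  qed
  have Pi0: "P i0 = - (\<Sum>i<N. smult (r (?s i)) (P (?s i)))"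
    using r(4) sum_skip[OF r(1), of "\<lambda>i. smult (r i) (P i)"] r(2) by (simp add: eq_neg_iff_add_eq_0)
  have "lin_form (Suc N) P f = fps_of_poly (P i0) * f i0 + (\<Sum>i<N. fps_of_poly (P (?s i)) * f (?s i))"
    unfolding lin_form_def by (rule sum_skip[OF r(1)])
  also have "\<dots> = lin_form N (\<lambda>i. P (?s i)) g"
    unfolding lin_form_def
    by (simp add: Pi0 f_skip fps_of_poly_uminus fps_of_poly_sum fps_of_poly_smult algebra_simps sum.distrib
          sum_distrib_left)
  finally have fm: "lin_form (Suc N) P f = lin_form N (\<lambda>i. P (?s i)) g" .
  have "\<exists>i<N. P (?s i) \<noteq> 0"
  proof (rule ccontr)
    assume *: "\<not> (\<exists>i<N. P (?s i) \<noteq> 0)"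
    then have "P i0 = 0" using Pi0 by simp
    moreover obtain i where "i < Suc N" "P i \<noteq> 0" using P0 by blast
    ultimately show False using * skip_surj[OF \<open>i < Suc N\<close> r(1)] by (cases "i = i0") auto
  qed
  then show ?thesis by (rule that[OF triangular bd' r(1) fm])
qed

lemma fps_theta_pow_nth: "fps_nth ((fps_theta ^^ k) f) i = of_nat i ^ k * fps_nth f i"
  by (induction k) (auto simp: fps_theta_nth)

lemma lin_form_lf_deriv_pow:
  assumes "triangular_sys N c n f"
  shows "lin_form N ((lf_deriv N c n ^^ k) P) f = (fps_theta ^^ k) (lin_form N P f)"
  by (induction k) (simp_all add: fps_theta_lin_form[OF assms, symmetric])

lemma order_bound_nth:
  assumes "order_bound N f v" "j < N"
  obtains k where "k \<le> v" "fps_nth (f j) k \<noteq> 0"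
proof -
  have eq: "(\<Sum>i<N. fps_const (if i = j then 1 else 0) * f i) = f j"
    using assms(2) by (simp add: if_distrib[of fps_const] if_distrib[of "\<lambda>x. x * _"] sum.delta cong: if_cong)
  have "\<exists>k\<le>v. fps_nth (\<Sum>i<N. fps_const (if i = j then 1 else 0) * f i) k \<noteq> 0"
    by (rule assms(1)[unfolded order_bound_def, rule_format]) (use assms(2) in auto)
  then show ?thesis using that unfolding eq by blast
qed

text \<open>By the adjugate, the determinant times \<open>f 0\<close> is a polynomial combination of
  the derived forms, all vanishing to order \<open>T\<close> because theta does not lower the order;
  \<open>f 0\<close> accounts for at most \<open>v\<close>.\<close>

lemma det_vanishes_at_0:
  assumes sys: "triangular_sys N c n f" and bd: "order_bound N f v" and N: "N > 0"
    and van: "\<And>k. k < T \<Longrightarrow> fps_nth (lin_form N P f) k = 0"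
    and k: "k + v < T"
  shows "coeff (fdet N (\<lambda>k. (lf_deriv N c n ^^ k) P)) k = 0"
proof -
  let ?D = "\<lambda>k. (lf_deriv N c n ^^ k) P"
  define d where "d = fdet N ?D"
  obtain w where w: "\<And>i. i < N \<Longrightarrow> (\<Sum>k<N. w k * ?D k i) = (if i = 0 then d else 0)"
    using fdet_adjugate[OF N, of ?D] unfolding d_def by blast
  have "(\<Sum>k<N. fps_of_poly (w k) * lin_form N (?D k) f) = (\<Sum>i<N. fps_of_poly (\<Sum>k<N. w k * ?D k i) * f i)"
    unfolding lin_form_def
    by (simp add: sum_distrib_left sum_distrib_right fps_of_poly_sum fps_of_poly_mult mult.assoc)
       (rule sum.swap)
  also have "\<dots> = (\<Sum>i<N. if i = 0 then fps_of_poly d * f 0 else 0)"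
    by (intro sum.cong refl) (simp add: w)
  also have "\<dots> = fps_of_poly d * f 0" using N by (simp add: sum.delta)
  finally have eq: "fps_of_poly d * f 0 = (\<Sum>k<N. fps_of_poly (w k) * lin_form N (?D k) f)" by simp
  have vanD: "fps_nth (lin_form N (?D k) f) i = 0" if "i < T" for i k
    using van[OF that] by (simp add: lin_form_lf_deriv_pow[OF sys] fps_theta_pow_nth)
  have van_prod: "fps_nth (fps_of_poly d * f 0) i = 0" if "i < T" for i
    unfolding eq fps_sum_nth fps_mult_nth using that by (intro sum.neutral ballI) (simp add: vanD)
  obtain k0 where k0: "k0 \<le> v" "fps_nth (f 0) k0 \<noteq> 0" using order_bound_nth[OF bd N] by blast
  show ?thesis
  proof (rule ccontr)
    assume "coeff (fdet N ?D) k \<noteq> 0"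
    then have *: "fps_nth (fps_of_poly d) k \<noteq> 0" by (simp add: d_def)
    have "subdegree (fps_of_poly d) \<le> k" "subdegree (f 0) \<le> k0"
      using * k0(2) by (auto intro: subdegree_leI)
    moreover have nz: "fps_of_poly d * f 0 \<noteq> 0" using * k0(2) by auto
    moreover have "subdegree (fps_of_poly d * f 0) = subdegree (fps_of_poly d) + subdegree (f 0)"
      using nz by (intro subdegree_mult) auto
    ultimately have "subdegree (fps_of_poly d * f 0) < T" using k0(1) k by linarith
    then show False using van_prod nth_subdegree_nonzero[OF nz] by blast
  qed
qed

lemma degree_det_lf_deriv_le:
  assumes "\<And>j. j < N \<Longrightarrow> degree (P j) \<le> m"
  shows "degree (fdet N (\<lambda>k. (lf_deriv N c n ^^ k) P)) \<le> N * (m + N)"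
proof -
  have "degree ((lf_deriv N c n ^^ i) P j) \<le> m + N" if "i < N" "j < N" for i j
    using degree_lf_deriv_pow_le[where P = P and m = m and k = i and j = j, OF assms that(2)] that(1)
    by (meson add_left_mono le_trans less_imp_le)
  then show ?thesis
    using degree_fdet_le[where N = N and k = "m + N" and A = "\<lambda>k. (lf_deriv N c n ^^ k) P"] by (simp add: mult.commute)
qed

text \<open>A nonzero determinant of derivatives has order at least T - v at 0, which its degree
  bounds. If the determinant is zero, a function can be eliminated and the induction hypothesis
  applies.\<close>

lemma zero_estimate:
  assumes "triangular_sys N c n f" "order_bound N f v" "\<exists>i<N. P i \<noteq> 0" "\<And>i. i < N \<Longrightarrow> degree (P i) \<le> m"
    "\<And>k. k < T \<Longrightarrow> fps_nth (lin_form N P f) k = 0"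
  shows "T \<le> N * (m + N) + v"
  using assms
proof (induction N arbitrary: c n f P)
  case (Suc N)
  let ?d = "fdet (Suc N) (\<lambda>k. (lf_deriv (Suc N) c n ^^ k) P)"
  show ?case
  proof (cases "?d = 0")
    case False
    then have "coeff ?d (degree ?d) \<noteq> 0" by simp
    then have "\<not> degree ?d + v < T"
      using det_vanishes_at_0[OF Suc.prems(1,2) _ Suc.prems(5), where T = T and k = "degree ?d"] by auto
    then show ?thesis using degree_det_lf_deriv_le[of "Suc N" P m c n, OF Suc.prems(4)] by linarith
  next
    case True
    from eliminate_function[OF Suc.prems(1,2) True Suc.prems(3)]
    obtain c' n' g i0 where *: "triangular_sys N c' n' g" "order_bound N g v" "i0 < Suc N"
      "lin_form (Suc N) P f = lin_form N (\<lambda>i. P (skip i0 i)) g" "\<exists>i<N. P (skip i0 i) \<noteq> 0" by metis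
    have "T \<le> N * (m + N) + v"
      using Suc.prems(4,5) *(3,4) by (intro Suc.IH[OF *(1,2,5)]) (auto simp: skip_less)
    also have "N * (m + N) \<le> Suc N * (m + Suc N)" by (intro mult_mono) auto
    finally show ?thesis by simp
  qed
qed simp

text \<open>A zero determinant would reduce the form to N - 1 functions, contradicting
  \<open>zero_estimate\<close>. With N - 1 in place of N the threshold for \<open>T\<close> is
  within reach of Siegel's lemma.\<close>

lemma det_lf_deriv_nonzero:
  assumes "triangular_sys N c n f" "order_bound N f v" "\<exists>i<N. P i \<noteq> 0" "\<And>i. i < N \<Longrightarrow> degree (P i) \<le> m"
    "\<And>k. k < T \<Longrightarrow> fps_nth (lin_form N P f) k = 0" and T: "(N - 1) * (m + N) + v < T"
  shows "fdet N (\<lambda>k. (lf_deriv N c n ^^ k) P) \<noteq> 0"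
proof
  assume 0: "fdet N (\<lambda>k. (lf_deriv N c n ^^ k) P) = 0"
  obtain N' where N: "N = Suc N'" using assms(3) by (cases N) auto
  from eliminate_function[OF assms(1-2)[unfolded N] 0[unfolded N] assms(3)[unfolded N]]
  obtain c' n' g i0 where *: "triangular_sys N' c' n' g" "order_bound N' g v" "i0 < Suc N'"
    "lin_form (Suc N') P f = lin_form N' (\<lambda>i. P (skip i0 i)) g" "\<exists>i<N'. P (skip i0 i) \<noteq> 0" by metis
  have "T \<le> N' * (m + N') + v"
    using assms(4,5) *(3,4) unfolding N by (intro zero_estimate[OF *(1,2,5)]) (auto simp: skip_less)
  also have "N' * (m + N') \<le> N' * (m + N)" using N by (intro mult_mono) auto
  finally show False using T N by simp
qed

section \<open>Zeros of the determinant at z = 1\<close>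

lemma linear_power_dvd_cancel:
  fixes p q :: "'a::idom poly"
  assumes "[:-a, 1:] ^ k dvd p * q" "poly q a \<noteq> 0"
  shows "[:-a, 1:] ^ k dvd p"
proof (cases "p = 0")
  case False
  moreover have "q \<noteq> 0" using assms(2) by auto
  ultimately have pq: "p * q \<noteq> 0" by simp
  have "k \<le> order a (p * q)" using assms(1) pq order_divides by blast
  then have "k \<le> order a p" using order_mult[OF pq] order_0I[OF assms(2)] by simp
  then show ?thesis using order_divides by blast
qed simp

lemma smult_sum_right: "smult a (\<Sum>i\<in>A. p i) = (\<Sum>i\<in>A. smult a (p i))"
  by (induction A rule: infinite_finite_induct) (simp_all add: smult_add_right)

text \<open>If \<open>u\<close> is orthogonal to the derivatives of \<open>P\<close> modulo \<open>(z - 1)\<^sup>s\<close>, then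
  \<open>s u - (z - 1) dual_deriv u\<close> is so modulo \<open>(z - 1)\<^sup>s\<^sup>+\<^sup>1\<close>, at the cost of one derivative.\<close>
lemma det_vanishes_at_1:
  assumes u0: "\<exists>j<N. u0 j \<noteq> 0"
    and orth: "\<And>k. k < N + t \<Longrightarrow> (\<Sum>j<N. poly ((lf_deriv N c n ^^ k) P j) 1 * u0 j) = 0"
  shows "[:-1, 1:] ^ Suc t dvd fdet N (\<lambda>k. (lf_deriv N c n ^^ k) P)"
proof -
  let ?D = "\<lambda>k. (lf_deriv N c n ^^ k) P" and ?w = "[:-1, 1:] :: rat poly"
  have "s \<le> t \<Longrightarrow> \<exists>u. (\<exists>j<N. poly (u j) 1 \<noteq> 0) \<and> (\<forall>k<N + t - s. ?w ^ Suc s dvd (\<Sum>j<N. ?D k j * u j))" for s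
  proof (induction s)
    case 0
    have "?w dvd (\<Sum>j<N. ?D k j * [:u0 j:])" if "k < N + t" for k
      using orth[OF that] by (simp add: poly_eq_0_iff_dvd[symmetric] poly_sum mult.commute)
    then show ?case using u0 by (intro exI[of _ "\<lambda>j. [:u0 j:]"]) auto
  next
    case (Suc s)
    then obtain u where u: "\<exists>j<N. poly (u j) 1 \<noteq> 0" "\<And>k. k < N + t - s \<Longrightarrow> ?w ^ Suc s dvd (\<Sum>j<N. ?D k j * u j)"
      by auto
    \<comment> \<open>The multiple Suc s cancels the term that theta produces by differentiating the
      power of z - 1. At 1 the new vector is Suc s times the old one, hence still nonzero.\<close>
    define u' where "u' j = smult (of_nat (Suc s)) (u j) - ?w * dual_deriv c n u j" for j
    have "?w ^ Suc (Suc s) dvd (\<Sum>j<N. ?D k j * u' j)" if "k < N + t - Suc s" for k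
    proof -
      define S where "S k = (\<Sum>j<N. ?D k j * u j)" for k
      have k: "k < N + t - s" "Suc k < N + t - s" using that by simp_all
      obtain g where g: "S k = ?w ^ Suc s * g" using u(2)[OF k(1)] unfolding S_def dvd_def by blast
      obtain h where h: "S (Suc k) = ?w ^ Suc s * h" using u(2)[OF k(2)] unfolding S_def dvd_def by blast
      have "?D (Suc k) = lf_deriv N c n (?D k)" by simp
      then have Nab_S: "(\<Sum>j<N. ?D k j * dual_deriv c n u j) = poly_theta (S k) - S (Suc k)"
        using poly_theta_pairing[where N = N and P = "?D k" and u = u and c = c and n = n]
        unfolding S_def by (simp only: add_diff_cancel_left')
      have "(\<Sum>j<N. ?D k j * u' j) = smult (of_nat (Suc s)) (S k) - ?w * (\<Sum>j<N. ?D k j * dual_deriv c n u j)"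
        unfolding u'_def S_def
        by (simp add: right_diff_distrib sum_subtractf smult_sum_right sum_distrib_left mult.left_commute del: of_nat_Suc mult_pCons_left mult_pCons_right)
      also note Nab_S
      also have "poly_theta (S k) = [:0, 1:] * (smult (of_nat (Suc s)) (?w ^ s) * g + ?w ^ Suc s * pderiv g)"
        unfolding g poly_theta_def pderiv_mult pderiv_power_Suc by (simp add: pderiv_pCons mult.commute)
      also have "smult (of_nat (Suc s)) (S k) - ?w * (\<dots> - S (Suc k)) =
         ?w ^ Suc (Suc s) * (h - smult (of_nat (Suc s)) g - [:0, 1:] * pderiv g)"
      proof -
        have lin: "[:0, 1:] = ?w + 1" by (simp add: one_pCons)
        have sm: "smult a p = [:a:] * p" for a and p :: "rat poly" by simp
        have "E * (W * X * p) - W * ((W + 1) * (E * X * p + W * X * p') - W * X * p'') =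
            W * (W * X) * (p'' - E * p - (W + 1) * p')" for E W X p p' p'' :: "rat poly"
          by (simp add: algebra_simps)
        then show ?thesis unfolding g h lin sm power_Suc .
      qed
      finally show ?thesis by simp
    qed
    moreover have "\<exists>j<N. poly (u' j) 1 \<noteq> 0" using u(1) by (auto simp: u'_def simp del: of_nat_Suc)
    ultimately show ?case by blast
  qed
  from this[OF order_refl] obtain u where u: "\<exists>j<N. poly (u j) 1 \<noteq> 0"
      "\<And>k. k < N \<Longrightarrow> ?w ^ Suc t dvd (\<Sum>j<N. ?D k j * u j)"
    unfolding add_diff_cancel_right' by blast
  obtain j where j: "j < N" "poly (u j) 1 \<noteq> 0" using u(1) by blast
  \<comment> \<open>The adjugate isolates an entry of \<open>u\<close> that is nonzero at 1, so the
    power of z - 1 divides the determinant itself.\<close>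
  obtain a where a: "\<And>i. i < N \<Longrightarrow> (\<Sum>k<N. a k * ?D k i) = (if i = j then fdet N ?D else 0)"
    using fdet_adjugate[OF j(1), of ?D] by blast
  have "(\<Sum>k<N. a k * (\<Sum>i<N. ?D k i * u i)) = (\<Sum>i<N. (\<Sum>k<N. a k * ?D k i) * u i)"
    by (simp add: sum_distrib_left sum_distrib_right mult.assoc) (rule sum.swap)
  also have "\<dots> = (\<Sum>i<N. if i = j then fdet N ?D * u j else 0)"
    by (intro sum.cong refl) (simp add: a)
  also have "\<dots> = fdet N ?D * u j" using j by (simp add: sum.delta)
  finally have "?w ^ Suc t dvd fdet N ?D * u j"
    using u(2) by (metis (no_types, lifting) dvd_mult dvd_sum lessThan_iff)
  then show ?thesis using j(2) linear_power_dvd_cancel by blast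
qed

text \<open>The determinant has degree at most N (m + N), of which at least T - v is used up at 0,
  so its order at 1 is at most \<open>t\<close>. Orthogonality of \<open>u0\<close> to N + t
  derivatives would make it at least t + 1.\<close>

lemma spanning_at_1:
  assumes "triangular_sys N c n f" "order_bound N f v" "\<exists>i<N. P i \<noteq> 0" "\<And>i. i < N \<Longrightarrow> degree (P i) \<le> m"
    "\<And>k. k < T \<Longrightarrow> fps_nth (lin_form N P f) k = 0" and T: "(N - 1) * (m + N) + v < T"
    and t: "N * (m + N) + v \<le> T + t" and u0: "\<exists>j<N. u0 j \<noteq> 0"
  shows "\<exists>k<N + t. (\<Sum>j<N. poly ((lf_deriv N c n ^^ k) P j) 1 * u0 j) \<noteq> 0"
proof (rule ccontr)
  assume "\<not> ?thesis"
  then have 1: "[:-1, 1:] ^ Suc t dvd fdet N (\<lambda>k. (lf_deriv N c n ^^ k) P)"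
    by (intro det_vanishes_at_1[OF u0]) auto
  define d where "d = fdet N (\<lambda>k. (lf_deriv N c n ^^ k) P)"
  have d0: "d \<noteq> 0" unfolding d_def by (rule det_lf_deriv_nonzero[OF assms(1-6)])
  have N: "N > 0" using u0 by auto
  have "monom 1 (T - v) dvd d"
    unfolding monom_1_dvd_iff'
    using det_vanishes_at_0[OF assms(1,2) N assms(5)] by (auto simp: d_def)
  then obtain q where q: "d = monom 1 (T - v) * q" by (auto elim: dvdE)
  have q0: "q \<noteq> 0" using q d0 by auto
  have "poly (monom (1::rat) (T - v)) 1 \<noteq> 0" by (simp add: poly_monom)
  then have "[:-1, 1:] ^ Suc t dvd q"
    using 1 linear_power_dvd_cancel unfolding d_def[symmetric] q by (metis mult.commute)
  then have "Suc t \<le> degree q"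
    using dvd_imp_degree_le[OF _ q0] by (metis degree_linear_power)
  moreover have "degree d = T - v + degree q"
    using q0 unfolding q by (simp add: degree_mult_eq degree_monom_eq)
  moreover have "degree d \<le> N * (m + N)" unfolding d_def by (intro degree_det_lf_deriv_le assms(4))
  ultimately show False using t T by linarith
qed

section \<open>Siegel's lemma and evaluation of power series\<close>

text \<open>Two combinations with the same last coefficient which vanish to an order exceeding the bound
  for the remaining functions coincide.\<close>
lemma order_bound_exists:
  assumes "\<And>a. \<exists>i<N. a i \<noteq> 0 \<Longrightarrow> (\<Sum>i<N. fps_const (a i) * f i) \<noteq> 0"
  shows "\<exists>v. order_bound N f v"
  using assms
proof (induction N)
  case 0
  then show ?case by (auto simp: order_bound_def)
next
  case (Suc N)
  have "(\<Sum>i<N. fps_const (a i) * f i) \<noteq> 0" if "\<exists>i<N. a i \<noteq> 0" for a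
  proof -
    have "(\<Sum>i<Suc N. fps_const (if i < N then a i else 0) * f i) \<noteq> 0"
      using that by (intro Suc.prems) (auto intro: less_SucI)
    then show ?thesis by simp
  qed
  then obtain v where v: "order_bound N f v" using Suc.IH by blast
  let ?h = "\<lambda>a. \<Sum>i<Suc N. fps_const (a i) * f i"
  show ?case
  proof (cases "\<exists>a. a N = 1 \<and> (\<forall>k\<le>v. fps_nth (?h a) k = 0)")
    case False
    have "order_bound (Suc N) f v"
      unfolding order_bound_def
    proof (intro allI impI)
      fix a assume a: "\<exists>i<Suc N. a i \<noteq> (0::rat)"
      show "\<exists>k\<le>v. fps_nth (?h a) k \<noteq> 0"
      proof (cases "a N = 0")
        case True
        then have "\<exists>i<N. a i \<noteq> 0" using a less_Suc_eq by auto
        then show ?thesis using v True by (simp add: order_bound_def)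
      next
        case aN: False
        obtain k where k: "k \<le> v" "fps_nth (?h (\<lambda>i. a i / a N)) k \<noteq> 0"
          using False aN by (metis divide_self)
        have "?h (\<lambda>i. a i / a N) = fps_const (1 / a N) * ?h a"
          unfolding sum_distrib_left by (intro sum.cong refl) (simp flip: mult.assoc)
        then show ?thesis using k by (auto intro!: exI[of _ k])
      qed
    qed
    then show ?thesis by blast
  next
    case True
    then obtain b where b: "b N = 1" "\<And>k. k \<le> v \<Longrightarrow> fps_nth (?h b) k = 0" by blast
    have "?h b \<noteq> 0" using b(1) by (intro Suc.prems) auto
    then obtain k0 where k0: "fps_nth (?h b) k0 \<noteq> 0" by (metis fps_nonzero_nth)
    \<comment> \<open>\<open>b\<close> is the only combination with last coefficient 1 that vanishes
      up to \<open>v\<close>; coefficient \<open>k0\<close> detects it and its nonzero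
      multiples.\<close>
    have "order_bound (Suc N) f (max v k0)"
      unfolding order_bound_def
    proof (intro allI impI)
      fix a assume a: "\<exists>i<Suc N. a i \<noteq> (0::rat)"
      show "\<exists>k\<le>max v k0. fps_nth (?h a) k \<noteq> 0"
      proof (rule ccontr)
        assume neg: "\<not> ?thesis"
        define e where "e i = a i - a N * b i" for i
        have he: "?h e = ?h a - fps_const (a N) * ?h b"
          by (simp add: e_def algebra_simps sum_subtractf sum_distrib_left flip: fps_const_sub fps_const_mult)
        have "fps_nth (?h e) k = 0" if "k \<le> v" for k
          unfolding he using neg b(2)[OF that] that by simp
        moreover have hN: "?h e = (\<Sum>i<N. fps_const (e i) * f i)" using b(1) by (simp add: e_def)
        ultimately have e0: "e i = 0" if "i < N" for i
          using v that unfolding order_bound_def by metis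
        then have "?h e = 0" unfolding hN by simp
        then have "fps_nth (?h a) k0 = a N * fps_nth (?h b) k0" unfolding he by simp
        then have "a N = 0" using neg k0 by auto
        then have "a i = 0" if "i < Suc N" for i using that e0 by (cases "i = N") (auto simp: e_def)
        then show False using a by auto
      qed
    qed
    then show ?thesis by blast
  qed
qed

text \<open>Pigeonhole principle. With e mu unknowns and (e - 1) mu equations the exponent in the
  bound depends on \<open>e\<close> alone, not on mu.\<close>

lemma siegel:
  fixes A :: "nat \<Rightarrow> nat \<Rightarrow> int"
  assumes e: "e > 0" and \<mu>: "\<mu> > 0" and B: "B > 0"
    and A: "\<And>t i. t < (e - 1) * \<mu> \<Longrightarrow> i < e * \<mu> \<Longrightarrow> \<bar>A t i\<bar> \<le> int B"
  shows "\<exists>x. (\<exists>i<e * \<mu>. x i \<noteq> 0) \<and> (\<forall>t<(e - 1) * \<mu>. (\<Sum>i<e * \<mu>. A t i * x i) = 0) \<and>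
    (\<forall>i<e * \<mu>. \<bar>x i\<bar> \<le> int ((2 * (e * \<mu>) * B) ^ e))"
proof -
  define n T where "n = e * \<mu>" and "T = (e - 1) * \<mu>"
  define b where "b = 2 * n * B"
  \<comment> \<open>The count comes down to b^(e-1) < X + 1, raised to the power mu.\<close>
  define X where "X = b ^ e"
  have b1: "b \<ge> 1" using assms by (simp add: b_def n_def Suc_le_eq)
  define S where "S = ({..<n} \<rightarrow>\<^sub>E {0..int X})"
  define R where "R = ({..<T} \<rightarrow>\<^sub>E {- int (n * B * X)..int (n * B * X)})"
  define \<phi> where "\<phi> x = (\<lambda>t\<in>{..<T}. \<Sum>i<n. A t i * x i)" for x
  have S_mem: "0 \<le> x i" "x i \<le> int X" if "x \<in> S" "i < n" for x i
    using PiE_mem[OF that(1)[unfolded S_def], of i] that(2) by simp_all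
  have S_out: "x i = undefined" if "x \<in> S" "\<not> i < n" for x i
    using PiE_arb[OF that(1)[unfolded S_def], of i] that(2) by simp
  have \<phi>: "\<phi> x \<in> R" if "x \<in> S" for x
    unfolding R_def \<phi>_def
  proof (intro restrict_PiE_iff[THEN iffD2] ballI)
    fix t assume t: "t \<in> {..<T}"
    have "\<bar>\<Sum>i<n. A t i * x i\<bar> \<le> (\<Sum>i<n. \<bar>A t i * x i\<bar>)" by (rule sum_abs)
    also have "\<dots> \<le> (\<Sum>i<n. int B * int X)"
    proof (intro sum_mono)
      fix i assume i: "i \<in> {..<n}"
      then show "\<bar>A t i * x i\<bar> \<le> int B * int X"
        using A[of t i] t S_mem[OF that] by (auto simp: abs_mult T_def n_def intro!: mult_mono)
    qed
    finally have "\<bar>\<Sum>i<n. A t i * x i\<bar> \<le> int (n * B * X)" by (simp add: mult.assoc)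
    then show "(\<Sum>i<n. A t i * x i) \<in> {- int (n * B * X)..int (n * B * X)}" by (simp add: abs_le_iff)
  qed
  have cardS: "card S = (X + 1) ^ n" by (simp add: S_def card_PiE nat_add_distrib)
  have cardR: "card R = (b * X + 1) ^ T"
  proof -
    have "nat (1 + (int n * (int B * int X) + int n * (int B * int X))) = b * X + 1"
      by (simp add: b_def nat_eq_iff algebra_simps)
    then show ?thesis by (simp add: R_def card_PiE algebra_simps)
  qed
  have "card R \<le> (b * (X + 1)) ^ T" unfolding cardR using b1 by (intro power_mono) auto
  also have "\<dots> = (b ^ (e - 1)) ^ \<mu> * (X + 1) ^ T" by (simp only: power_mult_distrib T_def power_mult)
  also have "\<dots> < (X + 1) ^ \<mu> * (X + 1) ^ T"
  proof (intro mult_strict_right_mono power_strict_mono)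
    have "b ^ (e - 1) \<le> X" unfolding X_def using b1 by (intro power_increasing) auto
    then show "b ^ (e - 1) < X + 1" by simp
  qed (use \<mu> in auto)
  also have "\<dots> = card S"
  proof -
    have "\<mu> + T = n" using e by (cases e) (auto simp: n_def T_def)
    then show ?thesis unfolding cardS by (simp flip: power_add)
  qed
  finally have "card R < card S" .
  have "\<not> inj_on \<phi> S"
  proof
    assume "inj_on \<phi> S"
    moreover have "finite R" by (simp add: R_def finite_PiE)
    ultimately have "card S \<le> card R" using \<phi> by (intro card_inj_on_le[of \<phi>]) auto
    then show False using \<open>card R < card S\<close> by simp
  qed
  then obtain x y where xy: "x \<in> S" "y \<in> S" "x \<noteq> y" "\<phi> x = \<phi> y" by (auto simp: inj_on_def)
  have "(\<Sum>i<n. A t i * (x i - y i)) = 0" if "t < T" for t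
    using fun_cong[OF xy(4), of t] that by (simp add: \<phi>_def right_diff_distrib sum_subtractf)
  moreover have "\<exists>i<n. x i - y i \<noteq> 0"
  proof (rule ccontr)
    assume "\<not> ?thesis"
    then have "x i = y i" for i using S_out[OF xy(1), of i] S_out[OF xy(2), of i] by (cases "i < n") auto
    then show False using xy(3) by auto
  qed
  moreover have "\<bar>x i - y i\<bar> \<le> int X" if "i < n" for i
    using S_mem[OF xy(1) that] S_mem[OF xy(2) that] by linarith
  ultimately show ?thesis unfolding X_def b_def n_def T_def
    by (intro exI[of _ "\<lambda>i. x i - y i"]) auto
qed

section \<open>Values of power series with rational coefficients\<close>

text \<open>Absolute rather than plain convergence, because products are evaluated by the Cauchy
  product.\<close>

definition abs_conv :: "rat fps \<Rightarrow> real \<Rightarrow> bool" where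
  "abs_conv f x \<longleftrightarrow> summable (\<lambda>k. \<bar>of_rat (fps_nth f k) * x ^ k\<bar>)"

definition fps_value :: "rat fps \<Rightarrow> real \<Rightarrow> real" where
  "fps_value f x = (\<Sum>k. of_rat (fps_nth f k) * x ^ k)"

lemma abs_conv_add:
  assumes "abs_conv f x" "abs_conv g x"
  shows "abs_conv (f + g) x"
  unfolding abs_conv_def
proof (rule summable_comparison_test')
  show "summable (\<lambda>k. \<bar>of_rat (fps_nth f k) * x ^ k\<bar> + \<bar>of_rat (fps_nth g k) * x ^ k\<bar>)"
    using assms unfolding abs_conv_def by (rule summable_add)
  show "norm \<bar>of_rat (fps_nth (f + g) k) * x ^ k\<bar> \<le>
      \<bar>of_rat (fps_nth f k) * x ^ k\<bar> + \<bar>of_rat (fps_nth g k) * x ^ k\<bar>" for k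
    using abs_triangle_ineq[of "of_rat (fps_nth f k) * x ^ k" "of_rat (fps_nth g k) * x ^ k"]
    by (simp add: of_rat_add distrib_right)
qed

lemma fps_value_add: "abs_conv f x \<Longrightarrow> abs_conv g x \<Longrightarrow> fps_value (f + g) x = fps_value f x + fps_value g x"
  unfolding abs_conv_def fps_value_def
  by (subst suminf_add) (auto dest: summable_rabs_cancel simp: of_rat_add distrib_right)

lemma prod_nth_eq:
  "of_rat (fps_nth (f * g) k) * x ^ k =
    (\<Sum>i\<le>k. (of_rat (fps_nth f i) * x ^ i) * (of_rat (fps_nth g (k - i)) * x ^ (k - i)) :: real)"
proof -
  have "of_rat (fps_nth (f * g) k) * x ^ k = (\<Sum>i\<le>k. of_rat (fps_nth f i * fps_nth g (k - i)) * (x ^ i * x ^ (k - i)))"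
    unfolding fps_mult_nth of_rat_sum sum_distrib_right atLeast0AtMost
    by (intro sum.cong refl) (simp flip: power_add)
  then show ?thesis by (simp add: of_rat_mult mult_ac)
qed

lemma abs_conv_mult:
  assumes "abs_conv f x" "abs_conv g x"
  shows "abs_conv (f * g) x"
  unfolding abs_conv_def
proof (rule summable_comparison_test')
  let ?a = "\<lambda>f k. \<bar>of_rat (fps_nth f k) * x ^ k\<bar>"
  show "summable (\<lambda>k. \<Sum>i\<le>k. ?a f i * ?a g (k - i))"
    using assms unfolding abs_conv_def by (intro summable_Cauchy_product) simp_all
  show "norm (?a (f * g) k) \<le> (\<Sum>i\<le>k. ?a f i * ?a g (k - i))" for k
    unfolding prod_nth_eq abs_mult[symmetric] by simp
qed

lemma fps_value_mult: "abs_conv f x \<Longrightarrow> abs_conv g x \<Longrightarrow> fps_value (f * g) x = fps_value f x * fps_value g x"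
  unfolding abs_conv_def fps_value_def prod_nth_eq by (rule Cauchy_product[symmetric]) simp_all

lemma abs_conv_fps_of_poly: "abs_conv (fps_of_poly p) x"
  unfolding abs_conv_def
  by (rule summable_finite[of "{..degree p}"]) (auto simp: coeff_eq_0)

lemma fps_value_fps_of_poly: "fps_value (fps_of_poly p) x = (\<Sum>k\<le>degree p. of_rat (coeff p k) * x ^ k)"
  unfolding fps_value_def by (subst suminf_finite[of "{..degree p}"]) (auto simp: coeff_eq_0)

lemma fps_value_fps_of_poly_1: "fps_value (fps_of_poly p) 1 = of_rat (poly p 1)"
  unfolding fps_value_fps_of_poly poly_altdef by (simp add: of_rat_sum)

lemma abs_conv_const: "abs_conv (fps_const a) x"
  using abs_conv_fps_of_poly[of "[:a:]"] by (simp add: fps_of_poly_const)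

lemma fps_value_const: "fps_value (fps_const a) x = of_rat a"
  using fps_value_fps_of_poly[of "[:a:]"] by (simp add: fps_of_poly_const)

lemma abs_conv_sum: "(\<And>i. i \<in> A \<Longrightarrow> abs_conv (f i) x) \<Longrightarrow> abs_conv (\<Sum>i\<in>A. f i) x"
  by (induction A rule: infinite_finite_induct) (use abs_conv_const[of 0 x] in \<open>auto simp: abs_conv_add\<close>)

lemma fps_value_sum: "(\<And>i. i \<in> A \<Longrightarrow> abs_conv (f i) x) \<Longrightarrow> fps_value (\<Sum>i\<in>A. f i) x = (\<Sum>i\<in>A. fps_value (f i) x)"
  by (induction A rule: infinite_finite_induct)
     (use fps_value_const[of 0 x] in \<open>auto simp: fps_value_add abs_conv_sum\<close>)

text \<open>As the corner is zero, every nonzero Leibniz term takes one other entry of row 0, one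
  other entry of column 0 and N - 2 entries outside both. Row 0 will be the fixed relation, so it
  must cost \<open>L\<close> and not a factor \<open>H\<close>.\<close>

lemma fdet_bound:
  fixes A :: "nat \<Rightarrow> nat \<Rightarrow> real"
  assumes A00: "A 0 0 = 0" and N: "N > 0" and nn: "L \<ge> 0" "\<epsilon> \<ge> 0" "H \<ge> 0"
    and L: "\<And>j. j < N \<Longrightarrow> \<bar>A 0 j\<bar> \<le> L"
    and \<epsilon>: "\<And>i. 0 < i \<Longrightarrow> i < N \<Longrightarrow> \<bar>A i 0\<bar> \<le> \<epsilon>"
    and H: "\<And>i j. 0 < i \<Longrightarrow> 0 < j \<Longrightarrow> i < N \<Longrightarrow> j < N \<Longrightarrow> \<bar>A i j\<bar> \<le> H"
  shows "\<bar>fdet N A\<bar> \<le> fact N * (L * \<epsilon> * H ^ (N - 2))"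
proof -
  have "\<bar>fdet N A\<bar> \<le> (\<Sum>p | p permutes {0..<N}. \<bar>signof p * (\<Prod>i = 0..<N. A i (p i))\<bar>)"
    unfolding fdet_leibniz by (rule sum_abs)
  also have "\<dots> \<le> (\<Sum>p | p permutes {0..<N}. L * \<epsilon> * H ^ (N - 2))"
  proof (intro sum_mono)
    fix p assume "p \<in> {p. p permutes {0..<N}}"
    then have p: "p permutes {0..<N}" by simp
    have pN: "p i < N" if "i < N" for i using permutes_in_image[OF p, of i] that by auto
    have "\<bar>signof p * (\<Prod>i = 0..<N. A i (p i))\<bar> = (\<Prod>i = 0..<N. \<bar>A i (p i)\<bar>)"
      by (simp add: abs_mult abs_prod sign_def)
    also have "\<dots> \<le> L * \<epsilon> * H ^ (N - 2)"
    proof (cases "p 0 = 0")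
      case True
      then have z: "(\<Prod>i = 0..<N. \<bar>A i (p i)\<bar>) = 0" using N A00 by (intro prod_zero bexI[of _ 0]) auto
      show ?thesis unfolding z using nn by simp
    next
      case False
      obtain k where k: "k < N" "p k = 0"
        using permutes_surj[OF p] N permutes_in_image[OF p] by (metis atLeastLessThan_iff surjD zero_le)
      have k0: "k \<noteq> 0" using False k by metis
      have "{0..<N} = insert 0 (insert k ({0..<N} - {0, k}))" using k(1) N by auto
      then have "(\<Prod>i = 0..<N. \<bar>A i (p i)\<bar>) = \<bar>A 0 (p 0)\<bar> * (\<bar>A k (p k)\<bar> * (\<Prod>i\<in>{0..<N} - {0, k}. \<bar>A i (p i)\<bar>))"
        using k0 by (metis (no_types, lifting) Diff_iff finite_Diff finite_atLeastLessThan finite_insert insertCI insertE prod.insert)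
      also have "\<dots> \<le> L * (\<epsilon> * H ^ (N - 2))"
      proof (intro mult_mono)
        show "\<bar>A 0 (p 0)\<bar> \<le> L" using L pN N by blast
        show "\<bar>A k (p k)\<bar> \<le> \<epsilon>" using \<epsilon>[of k] k k0 by simp
        have "(\<Prod>i\<in>{0..<N} - {0, k}. \<bar>A i (p i)\<bar>) \<le> (\<Prod>i\<in>{0..<N} - {0, k}. H)"
        proof (intro prod_mono conjI)
          fix i assume i: "i \<in> {0..<N} - {0, k}"
          then have "p i \<noteq> 0" using k(2) permutes_inj[OF p] by (metis DiffD2 injD insertCI)
          then show "\<bar>A i (p i)\<bar> \<le> H" using H[of i "p i"] pN[of i] i by auto
        qed simp
        also have "\<dots> = H ^ (N - 2)"
        proof -
          have "card ({0..<N} - {0, k}) = N - 2" using k k0 N by (subst card_Diff_subset) auto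
          then show ?thesis by simp
        qed
        finally show "(\<Prod>i\<in>{0..<N} - {0, k}. \<bar>A i (p i)\<bar>) \<le> H ^ (N - 2)" .
      qed (use nn in \<open>auto intro!: mult_nonneg_nonneg prod_nonneg\<close>)
      finally show ?thesis by (simp add: mult.assoc)
    qed
    finally show "\<bar>signof p * (\<Prod>i = 0..<N. A i (p i))\<bar> \<le> L * \<epsilon> * H ^ (N - 2)" .
  qed
  also have "\<dots> = fact N * (L * \<epsilon> * H ^ (N - 2))"
    using card_permutations[of "{0..<N}" N] by simp
  finally show ?thesis .
qed

section \<open>Auxiliary polynomials\<close>

lemma exp_tail_le:
  assumes "L \<ge> (0::real)"
  shows "summable (\<lambda>t. L ^ t / fact t)" "(\<Sum>t. L ^ (t + T) / fact (t + T)) \<le> L ^ T / fact T * exp L"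
proof -
  show s: "summable (\<lambda>t. L ^ t / fact t)"
    using summable_exp[of L] by (simp add: divide_inverse mult.commute)
  have le: "L ^ (t + T) / fact (t + T) \<le> L ^ T / fact T * (L ^ t / fact t)" for t
  proof -
    have "fact t * fact T \<le> (fact (t + T) :: real)"
      using fact_fact_dvd_fact[of t T] by (metis dvd_imp_le fact_gt_zero of_nat_fact of_nat_le_iff of_nat_mult)
    then have "L ^ (t + T) / fact (t + T) \<le> L ^ (t + T) / (fact t * fact T)"
      using assms by (intro divide_left_mono) auto
    then show ?thesis by (simp add: power_add mult.commute)
  qed
  have "(\<Sum>t. L ^ (t + T) / fact (t + T)) \<le> (\<Sum>t. L ^ T / fact T * (L ^ t / fact t))"
    using s by (intro suminf_le le summable_mult summable_ignore_initial_segment)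
  also have "\<dots> = L ^ T / fact T * exp L"
    using s by (subst suminf_mult) (auto simp: exp_def divide_inverse mult.commute)
  finally show "(\<Sum>t. L ^ (t + T) / fact (t + T)) \<le> L ^ T / fact T * exp L" .
qed

lemma power_le_fact_exp:
  assumes "x \<ge> (0::real)"
  shows "x ^ k \<le> fact k * exp x"
proof -
  have "(\<Sum>i\<in>{k}. x ^ i / fact i) \<le> (\<Sum>i. x ^ i / fact i)"
    using assms by (intro sum_le_suminf exp_tail_le(1)) auto
  then have "x ^ k / fact k \<le> exp x" by (simp add: exp_def divide_inverse mult.commute)
  then show ?thesis by (simp add: divide_le_eq mult.commute)
qed

text \<open>theta^k multiplies coefficient t by t^k; this trades the factor for k! 3^t, uniformly in
  t. With k = t it also bounds t! from below by (t/3)^t.\<close>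

lemma power_le_fact_3: "real t ^ k \<le> fact k * 3 ^ t"
proof -
  have "real t ^ k \<le> fact k * exp (real t)" by (rule power_le_fact_exp) simp
  also have "exp (real t) = exp 1 ^ t" by (simp add: exp_of_nat_mult[symmetric])
  also have "fact k * exp 1 ^ t \<le> (fact k * 3 ^ t :: real)"
    by (intro mult_left_mono power_mono exp_le) auto
  finally show ?thesis .
qed

lemma sum_nat_blocks:
  fixes F :: "nat \<Rightarrow> 'a::comm_monoid_add"
  shows "(\<Sum>j<N. \<Sum>k<m. F (j * m + k)) = (\<Sum>i<N * m. F i)"
  unfolding sum.nat_group[symmetric]
proof (rule sum.cong[OF refl])
  fix j
  show "(\<Sum>k<m. F (j * m + k)) = sum F {j * m..<j * m + m}"
    using sum.shift_bounds_nat_ivl[of F 0 "j * m" m] by (simp add: atLeast0LessThan add.commute)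
qed

lemma coeff_pCons_smult: "coeff (pCons 0 (smult a p)) i = a * coeff (pCons 0 p) i"
  by (cases i) auto

lemma of_rat_fact: "of_rat (fact k) = (fact k :: real)"
  by (metis of_nat_fact of_rat_of_nat_eq)

lemma abs_conv_of_coeff_bound:
  assumes C: "\<And>k. \<bar>fact k * fps_nth f k\<bar> \<le> rat_of_nat C ^ Suc k"
  shows "abs_conv f x"
  unfolding abs_conv_def
proof (rule summable_comparison_test')
  show "summable (\<lambda>k. real C * ((real C * \<bar>x\<bar>) ^ k / fact k))"
    by (intro summable_mult exp_tail_le) simp
  fix k
  have "real_of_rat \<bar>fact k * fps_nth f k\<bar> \<le> real_of_rat (of_nat C ^ Suc k)"
    using C[of k] of_rat_less_eq by blast
  then have "\<bar>real_of_rat (fps_nth f k)\<bar> \<le> real C ^ Suc k / fact k"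
    by (simp add: abs_mult of_rat_mult of_rat_power of_rat_fact le_divide_eq mult.commute)
  then have "\<bar>real_of_rat (fps_nth f k)\<bar> * \<bar>x\<bar> ^ k \<le> real C ^ Suc k / fact k * \<bar>x\<bar> ^ k"
    by (intro mult_right_mono) auto
  then show "norm \<bar>real_of_rat (fps_nth f k) * x ^ k\<bar> \<le> real C * ((real C * \<bar>x\<bar>) ^ k / fact k)"
    by (simp add: abs_mult power_abs power_mult_distrib)
qed

text \<open>\<open>q\<close> clears the denominators of the system and \<open>G\<close> bounds its
  entries; \<open>C\<close> and \<open>d\<close> are growth and denominator data, in the sense of
  E-functions, common to all \<open>f i\<close>.\<close>

locale approximation_system =
  fixes N :: nat and c :: "nat \<Rightarrow> rat" and n :: "nat \<Rightarrow> nat \<Rightarrow> rat" and f :: "nat \<Rightarrow> rat fps"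
    and v q G C :: nat and d :: "nat \<Rightarrow> nat"
  assumes sys: "triangular_sys N c n f" and bd: "order_bound N f v" and N: "N > 0"
    and q: "q > 0" "\<And>i. of_nat q * c i \<in> \<int>" "\<And>i j. of_nat q * n i j \<in> \<int>"
    and G: "\<And>i. \<bar>c i\<bar> \<le> of_nat G" "\<And>i j. \<bar>n i j\<bar> \<le> of_nat G"
    and C: "C > 0" "\<And>i k. i < N \<Longrightarrow> \<bar>fact k * fps_nth (f i) k\<bar> \<le> of_nat C ^ Suc k"
    and d: "\<And>k. d k > 0" "\<And>k. d k \<le> C ^ Suc k"
      "\<And>i j k. i < N \<Longrightarrow> j \<le> k \<Longrightarrow> of_nat (d k) * (fact j * fps_nth (f i) j) \<in> \<int>"
begin

abbreviation D :: "(nat \<Rightarrow> rat poly) \<Rightarrow> nat \<Rightarrow> nat \<Rightarrow> rat poly" where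
  "D P k \<equiv> (lf_deriv N c n ^^ k) P"

lemma abs_conv_f: "i < N \<Longrightarrow> abs_conv (f i) x"
  by (rule abs_conv_of_coeff_bound[OF C(2)])

lemma fps_value_lin_form: "fps_value (lin_form N P f) 1 = (\<Sum>j<N. of_rat (poly (P j) 1) * fps_value (f j) 1)"
  unfolding lin_form_def
  by (subst fps_value_sum) (auto simp: abs_conv_mult abs_conv_fps_of_poly abs_conv_f fps_value_mult fps_value_fps_of_poly_1)

lemma lf_deriv_integral:
  assumes "\<And>j i. j < N \<Longrightarrow> coeff (P j) i \<in> \<int>" "j < N"
  shows "of_nat q ^ k * coeff (D P k j) i \<in> \<int>"
  using assms(2)
proof (induction k arbitrary: j i)
  case 0
  then show ?case using assms(1) by simp
next
  case (Suc k)
  let ?P = "D P k"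
  have IH: "of_nat q ^ k * coeff (?P j) i \<in> \<int>" if "j < N" for i j using Suc.IH[OF that] .
  have "of_nat q ^ Suc k * coeff (D P (Suc k) j) i =
      of_nat q * of_nat i * (of_nat q ^ k * coeff (?P j) i) +
      (of_nat q * c j) * (of_nat q ^ k * coeff (pCons 0 (?P j)) i) +
      (\<Sum>l\<in>{j<..<N}. (of_nat q * n l j) * (of_nat q ^ k * coeff (?P l) i))"
    by (simp add: lf_deriv_def coeff_poly_theta coeff_sum coeff_pCons_smult algebra_simps sum_distrib_left del: smult_pCons)
  also have "\<dots> \<in> \<int>"
  proof (intro Ints_add Ints_mult[OF q(2)] Ints_sum)
    show "of_nat q * of_nat i * (of_nat q ^ k * coeff (?P j) i) \<in> \<int>"
      using IH[OF Suc.prems] by (intro Ints_mult[of "of_nat q * of_nat i"]) auto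
    show "of_nat q ^ k * coeff (pCons 0 (?P j)) i \<in> \<int>"
      using IH[OF Suc.prems] by (cases i) auto
    show "of_nat q * n l j * (of_nat q ^ k * coeff (?P l) i) \<in> \<int>" if "l \<in> {j<..<N}" for l
      using IH[of l] that by (intro Ints_mult[OF q(3)]) auto
  qed
  finally show ?case .
qed

text \<open>One derivative costs at most m + K (theta, by the degree), G (the diagonal) and N G (the
  rows below). Fixing \<open>K\<close> beforehand makes this factor the same in every step.\<close>

lemma lf_deriv_coeff_bound:
  assumes "\<And>j. j < N \<Longrightarrow> degree (P j) \<le> m" "\<And>j i. j < N \<Longrightarrow> \<bar>coeff (P j) i\<bar> \<le> h" "j < N" "k \<le> K"
  shows "\<bar>coeff (D P k j) i\<bar> \<le> of_nat (m + K + Suc N * G) ^ k * h"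
  using assms(3,4)
proof (induction k arbitrary: j i)
  case 0
  then show ?case using assms(2) by simp
next
  case (Suc k)
  let ?P = "D P k"
  define X where "X = of_nat (m + K + Suc N * G) ^ k * h"
  have IH: "\<bar>coeff (?P j) i\<bar> \<le> X" if "j < N" for i j
    using Suc.IH[OF that] Suc.prems by (simp add: X_def)
  have X0: "X \<ge> 0" using IH[OF Suc.prems(1), of 0] by simp
  have 1: "\<bar>of_nat i * coeff (?P j) i\<bar> \<le> of_nat (m + K) * X"
  proof (cases "i \<le> m + K")
    case True
    then show ?thesis unfolding abs_mult
      using IH[OF Suc.prems(1), of i] X0 by (intro mult_mono) (auto simp flip: of_nat_add)
  next
    case False
    have "degree (?P j) \<le> m + k"
      by (rule degree_lf_deriv_pow_le[OF _ Suc.prems(1)]) (use assms(1) in auto)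
    then have "coeff (?P j) i = 0" using False Suc.prems(2) by (intro coeff_eq_0) simp
    then show ?thesis using X0 by simp
  qed
  have 2: "\<bar>c j * coeff (pCons 0 (?P j)) i\<bar> \<le> of_nat G * X"
    unfolding abs_mult using G(1)[of j] IH[OF Suc.prems(1)] X0
    by (intro mult_mono) (cases i; auto)+
  have 3: "\<bar>\<Sum>l\<in>{j<..<N}. n l j * coeff (?P l) i\<bar> \<le> of_nat N * (of_nat G * X)"
  proof -
    have "\<bar>\<Sum>l\<in>{j<..<N}. n l j * coeff (?P l) i\<bar> \<le> (\<Sum>l\<in>{j<..<N}. of_nat G * X)"
    proof (intro order_trans[OF sum_abs] sum_mono)
      fix l assume "l \<in> {j<..<N}"
      then show "\<bar>n l j * coeff (?P l) i\<bar> \<le> of_nat G * X"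
        unfolding abs_mult using G(2)[of l j] IH[of l i] X0 by (intro mult_mono) auto
    qed
    also have "\<dots> = of_nat (N - Suc j) * (of_nat G * X)" by simp
    also have "\<dots> \<le> of_nat N * (of_nat G * X)" using X0 by (intro mult_right_mono) auto
    finally show ?thesis .
  qed
  have "coeff (D P (Suc k) j) i = of_nat i * coeff (?P j) i + c j * coeff (pCons 0 (?P j)) i +
      (\<Sum>l\<in>{j<..<N}. n l j * coeff (?P l) i)"
    by (simp add: lf_deriv_def coeff_poly_theta coeff_sum coeff_pCons_smult del: smult_pCons)
  also have "\<bar>\<dots>\<bar> \<le> of_nat (m + K) * X + of_nat G * X + of_nat N * (of_nat G * X)"
    using 1 2 3 by linarith
  also have "\<dots> = of_nat (m + K + Suc N * G) * X" by (simp add: algebra_simps)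
  finally show ?case by (simp add: X_def mult.assoc)
qed

lemma lf_deriv_value_bound:
  assumes "\<And>j. j < N \<Longrightarrow> degree (P j) \<le> m" "\<And>j i. j < N \<Longrightarrow> \<bar>coeff (P j) i\<bar> \<le> h" "j < N" "k \<le> K"
  shows "\<bar>poly (D P k j) 1\<bar> \<le> of_nat (Suc (m + K)) * (of_nat (m + K + Suc N * G) ^ k * h)"
proof -
  have deg: "degree (D P k j) \<le> m + k"
    by (rule degree_lf_deriv_pow_le[OF _ assms(3)]) (use assms(1) in auto)
  have h: "h \<ge> 0" using assms(2)[OF assms(3), of 0] by simp
  have "\<bar>poly (D P k j) 1\<bar> = \<bar>\<Sum>i\<le>degree (D P k j). coeff (D P k j) i\<bar>" by (simp add: poly_altdef)
  also have "\<dots> \<le> (\<Sum>i\<le>degree (D P k j). of_nat (m + K + Suc N * G) ^ k * h)"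
    by (intro order_trans[OF sum_abs] sum_mono lf_deriv_coeff_bound assms) auto
  also have "\<dots> = of_nat (Suc (degree (D P k j))) * (of_nat (m + K + Suc N * G) ^ k * h)" by simp
  also have "\<dots> \<le> of_nat (Suc (m + K)) * (of_nat (m + K + Suc N * G) ^ k * h)"
    using deg assms(4) h by (intro mult_right_mono mult_nonneg_nonneg) (auto simp flip: of_nat_add of_nat_Suc)
  finally show ?thesis .
qed

text \<open>Siegel's lemma for the N m = N s mu coefficients of the \<open>P j\<close> under (N s -
  1) mu vanishing conditions at 0, so with e = N s.\<close>

lemma auxiliary_polynomials:
  assumes "s > 0" "\<mu> > 0"
  defines "m \<equiv> s * \<mu>" and "T \<equiv> (N * s - 1) * \<mu>"
  defines "X \<equiv> (2 * (N * m) * (2 * C ^ 2) ^ Suc T) ^ (N * s)"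
  obtains P :: "nat \<Rightarrow> rat poly" where "\<exists>j<N. P j \<noteq> 0" "\<And>j. j < N \<Longrightarrow> degree (P j) \<le> m"
    "\<And>j i. j < N \<Longrightarrow> coeff (P j) i \<in> \<int>" "\<And>j i. j < N \<Longrightarrow> \<bar>coeff (P j) i\<bar> \<le> fact m * of_nat X"
    "\<And>t. t < T \<Longrightarrow> fps_nth (lin_form N P f) t = 0"
    "\<And>t. \<bar>fps_nth (lin_form N P f) t\<bar> \<le> fact m / fact t * of_nat (N * m * X * (2 * C) ^ Suc t)"
proof -
  have m0: "m > 0" using assms by (simp add: m_def)
  \<comment> \<open>An unknown x enters \<open>P j\<close> as the term x m!/k! z^k. In coefficient t
    of the form, multiplied by t!/m!, it then has the factor \<open>a t j k\<close>: the factorials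
    combine to a binomial coefficient and an E-function coefficient, so growth is only
    exponential.\<close>
  define a where "a t j k = (if k \<le> t then of_nat (t choose k) * (fact (t - k) * fps_nth (f j) (t - k)) else 0)" for t j k :: nat
  have a_bound: "\<bar>a t j k\<bar> \<le> of_nat ((2 * C) ^ Suc t)" if "j < N" for t j k
  proof (cases "k \<le> t")
    case True
    have "\<bar>a t j k\<bar> = of_nat (t choose k) * \<bar>fact (t - k) * fps_nth (f j) (t - k)\<bar>"
      using True by (simp add: a_def abs_mult)
    also have "\<dots> \<le> of_nat (2 ^ t) * of_nat C ^ Suc (t - k)"
      by (intro mult_mono C(2) that) (auto simp: binomial_le_pow2 simp flip: of_nat_power)
    also have "\<dots> \<le> of_nat (2 ^ Suc t) * of_nat C ^ Suc t"
      using C(1) by (intro mult_mono power_increasing) (auto simp: simp del: of_nat_power)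
    finally show ?thesis by (simp only: power_mult_distrib of_nat_mult of_nat_power)
  qed (simp add: a_def)
  \<comment> \<open>\<open>d T\<close> is a common denominator for all t up to \<open>T\<close>; the
    pair (j, k) is coded as i = j m + k.\<close>
  define A where "A t i = \<lfloor>of_nat (d T) * a t (i div m) (i mod m)\<rfloor>" for t i
  have a_int: "of_nat (d T) * a t j k \<in> \<int>" if "t \<le> T" "j < N" for t j k
  proof (cases "k \<le> t")
    case True
    have "of_nat (d T) * a t j k = of_nat (t choose k) * (of_nat (d T) * (fact (t - k) * fps_nth (f j) (t - k)))"
      using True by (simp add: a_def)
    also have "\<dots> \<in> \<int>" using that by (intro Ints_mult d(3)) auto
    finally show ?thesis .
  qed (simp add: a_def)
  have ij: "i div m < N" if "i < N * m" for i using that m0 by (simp add: less_mult_imp_div_less)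
  have A_eq: "of_int (A t i) = of_nat (d T) * a t (i div m) (i mod m)" if "t \<le> T" "i < N * m" for t i
    using a_int[OF that(1) ij[OF that(2)]] unfolding A_def by (metis Ints_cases floor_of_int)
  have A_bound: "\<bar>A t i\<bar> \<le> int ((2 * C ^ 2) ^ Suc T)" if "t < T" "i < N * m" for t i
  proof -
    have "\<bar>rat_of_int (A t i)\<bar> = of_nat (d T) * \<bar>a t (i div m) (i mod m)\<bar>"
      using that by (simp add: A_eq abs_mult)
    also have "\<dots> \<le> of_nat (C ^ Suc T) * of_nat ((2 * C) ^ Suc t)"
      using d(2)[of T] a_bound[OF ij[OF that(2)]] by (intro mult_mono of_nat_mono) auto
    also have "\<dots> \<le> of_nat (C ^ Suc T) * of_nat ((2 * C) ^ Suc T)"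
      using that C(1) by (intro mult_mono of_nat_mono power_increasing) auto
    also have "\<dots> = of_nat ((2 * C ^ 2) ^ Suc T)"
      unfolding of_nat_mult[symmetric] power_mult_distrib[symmetric] power2_eq_square by (simp only: mult_ac)
    finally show ?thesis by (metis of_int_abs of_int_le_iff of_int_of_nat_eq)
  qed
  have Nm: "N * m = N * s * \<mu>" by (simp add: m_def)
  obtain x :: "nat \<Rightarrow> int" where x: "\<exists>i<N * m. x i \<noteq> 0"
    "\<And>t. t < T \<Longrightarrow> (\<Sum>i<N * m. A t i * x i) = 0" "\<And>i. i < N * m \<Longrightarrow> \<bar>x i\<bar> \<le> int X"
    using siegel[of "N * s" \<mu> "(2 * C ^ 2) ^ Suc T" A] A_bound C(1) assms(1,2) N
    unfolding X_def Nm T_def by auto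
  define P where "P j = (\<Sum>k<m. monom (rat_of_int (x (j * m + k)) * (fact m / fact k)) k)" for j
  have coeff_P: "coeff (P j) i = (if i < m then of_int (x (j * m + i)) * (fact m / fact i) else 0)" for i j
    by (simp add: P_def coeff_sum)
  have jk: "j * m + k < N * m" if "j < N" "k < m" for j k
  proof -
    have "j * m + k < Suc j * m" using that by simp
    also have "\<dots> \<le> N * m" using that by (intro mult_right_mono) auto
    finally show ?thesis .
  qed
  have fact_int: "(fact m / fact i :: rat) \<in> \<int>" if "i \<le> m" for i
  proof -
    have "fact i dvd (fact m :: nat)" using that by (rule fact_dvd)
    then obtain r :: nat where "fact m = fact i * r" unfolding dvd_def by blast
    then have "(fact m :: rat) = fact i * of_nat r" by (metis of_nat_fact of_nat_mult)
    then show ?thesis by simp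
  qed
  have form_nth: "fps_nth (lin_form N P f) t = fact m / fact t * (\<Sum>j<N. \<Sum>k<m. of_int (x (j * m + k)) * a t j k)" for t
  proof -
    have "fps_nth (fps_of_poly (P j) * f j) t = fact m / fact t * (\<Sum>k<m. of_int (x (j * m + k)) * a t j k)" for j
    proof -
      have "fps_nth (fps_of_poly (P j) * f j) t = (\<Sum>k=0..t. coeff (P j) k * fps_nth (f j) (t - k))"
        by (simp add: fps_mult_nth)
      also have "\<dots> = (\<Sum>k<m. if k \<le> t then coeff (P j) k * fps_nth (f j) (t - k) else 0)"
        by (rule sum.mono_neutral_cong[where S = "{0..t}" and T = "{..<m}"]) (auto simp: coeff_P)
      also have "\<dots> = (\<Sum>k<m. fact m / fact t * (of_int (x (j * m + k)) * a t j k))"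
        by (intro sum.cong refl) (auto simp: coeff_P a_def binomial_fact)
      finally show ?thesis by (simp add: sum_distrib_left)
    qed
    then show ?thesis by (simp add: lin_form_def fps_sum_nth sum_distrib_left)
  qed
  show ?thesis
  proof (rule that[of P])
    obtain i where i: "i < N * m" "x i \<noteq> 0" using x(1) by blast
    have "coeff (P (i div m)) (i mod m) \<noteq> 0" using i m0 by (simp add: coeff_P)
    then have "P (i div m) \<noteq> 0" by auto
    then show "\<exists>j<N. P j \<noteq> 0" using ij[OF i(1)] by blast
    show "degree (P j) \<le> m" for j by (rule degree_le) (simp add: coeff_P)
    show "coeff (P j) i \<in> \<int>" for i j
      using Ints_mult[OF Ints_of_int fact_int[of i], of "x (j * m + i)"] by (simp add: coeff_P)
    show "\<bar>coeff (P j) i\<bar> \<le> fact m * of_nat X" if "j < N" for i j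
    proof (cases "i < m")
      case True
      have "\<bar>coeff (P j) i\<bar> = \<bar>rat_of_int (x (j * m + i))\<bar> * (fact m / fact i)"
        using True by (simp add: coeff_P abs_mult)
      also have "\<dots> \<le> of_nat X * (fact m / 1)"
      proof (intro mult_mono divide_left_mono)
        show "\<bar>rat_of_int (x (j * m + i))\<bar> \<le> of_nat X"
          using x(3)[OF jk[OF that True]] by (metis of_int_abs of_int_le_iff of_int_of_nat_eq)
        show "(1::rat) \<le> fact i" by (rule fact_ge_1)
      qed auto
      finally show ?thesis by (simp add: mult.commute)
    qed (simp add: coeff_P)
    show "fps_nth (lin_form N P f) t = 0" if "t < T" for t
    proof -
      have "of_nat (d T) * (\<Sum>j<N. \<Sum>k<m. of_int (x (j * m + k)) * a t j k)
          = (\<Sum>j<N. \<Sum>k<m. rat_of_int (A t (j * m + k) * x (j * m + k)))"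
        unfolding sum_distrib_left using that jk m0 by (intro sum.cong refl) (simp add: A_eq)
      also have "\<dots> = rat_of_int (\<Sum>j<N. \<Sum>k<m. A t (j * m + k) * x (j * m + k))" by simp
      also have "(\<Sum>j<N. \<Sum>k<m. A t (j * m + k) * x (j * m + k)) = (\<Sum>i<N * m. A t i * x i)"
        by (rule sum_nat_blocks)
      also have "\<dots> = 0" using x(2)[OF that] .
      finally show ?thesis using d(1)[of T] by (simp add: form_nth)
    qed
    show "\<bar>fps_nth (lin_form N P f) t\<bar> \<le> fact m / fact t * of_nat (N * m * X * (2 * C) ^ Suc t)" for t
    proof -
      have "\<bar>\<Sum>j<N. \<Sum>k<m. of_int (x (j * m + k)) * a t j k\<bar>
          \<le> (\<Sum>j<N. \<Sum>k<m. of_nat X * of_nat ((2 * C) ^ Suc t))"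
      proof (intro order_trans[OF sum_abs] sum_mono)
        fix j k assume jk': "j \<in> {..<N}" "k \<in> {..<m}"
        have "\<bar>rat_of_int (x (j * m + k))\<bar> \<le> of_nat X"
          using x(3)[OF jk, of j k] jk' by (metis lessThan_iff of_int_abs of_int_le_iff of_int_of_nat_eq)
        then show "\<bar>rat_of_int (x (j * m + k)) * a t j k\<bar> \<le> of_nat X * of_nat ((2 * C) ^ Suc t)"
          unfolding abs_mult using a_bound[of j t k] jk' by (intro mult_mono) simp_all
      qed
      also have "\<dots> = of_nat (N * m * X * (2 * C) ^ Suc t)" by simp
      finally have "fact m / fact t * \<bar>\<Sum>j<N. \<Sum>k<m. of_int (x (j * m + k)) * a t j k\<bar>
          \<le> fact m / fact t * of_nat (N * m * X * (2 * C) ^ Suc t)"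
        by (intro mult_left_mono) auto
      then show ?thesis unfolding form_nth abs_mult by simp
    qed
  qed
qed

end

section \<open>Independence of the values\<close>

text \<open>theta^k preserves the vanishing below \<open>T\<close> and costs k! 3^t elsewhere; what
  remains is an exponential tail starting at \<open>T\<close>.\<close>

lemma fps_value_fps_theta_pow_tail_bound:
  fixes M L :: real
  assumes van: "\<And>t. t < T \<Longrightarrow> fps_nth g t = 0"
    and bound: "\<And>t. \<bar>of_rat (fps_nth g t)\<bar> \<le> M / fact t * L ^ t" and nn: "M \<ge> 0" "L \<ge> 0"
  shows "\<bar>fps_value ((fps_theta ^^ k) g) 1\<bar> \<le> M * fact k * ((3 * L) ^ T / fact T * exp (3 * L))"
proof -
  define u where "u t = real_of_rat (fps_nth ((fps_theta ^^ k) g) t)" for t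
  define w where "w t = M * fact k * ((3 * L) ^ t / fact t)" for t
  have uw: "\<bar>u t\<bar> \<le> w t" for t
  proof -
    have "\<bar>u t\<bar> = real t ^ k * \<bar>of_rat (fps_nth g t)\<bar>"
      by (simp add: u_def fps_theta_pow_nth of_rat_mult of_rat_power abs_mult)
    also have "\<dots> \<le> (fact k * 3 ^ t) * (M / fact t * L ^ t)"
      by (intro mult_mono power_le_fact_3 bound) auto
    finally show ?thesis by (simp add: w_def power_mult_distrib mult_ac)
  qed
  have sw: "summable w" unfolding w_def using nn by (intro summable_mult exp_tail_le(1)) simp
  have su: "summable (\<lambda>t. \<bar>u t\<bar>)" by (rule summable_comparison_test'[OF sw]) (simp add: uw)
  have "fps_value ((fps_theta ^^ k) g) 1 = (\<Sum>t. u (t + T)) + (\<Sum>t<T. u t)"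
    using suminf_split_initial_segment[OF summable_rabs_cancel[OF su], of T] by (simp add: fps_value_def u_def)
  also have "(\<Sum>t<T. u t) = 0" by (intro sum.neutral) (simp add: u_def fps_theta_pow_nth van)
  finally have "\<bar>fps_value ((fps_theta ^^ k) g) 1\<bar> = \<bar>\<Sum>t. u (t + T)\<bar>" by simp
  also have "\<dots> \<le> (\<Sum>t. \<bar>u (t + T)\<bar>)"
    by (rule summable_rabs) (rule summable_ignore_initial_segment[OF su])
  also have "\<dots> \<le> (\<Sum>t. w (t + T))"
    by (intro suminf_le uw summable_ignore_initial_segment su sw)
  also have "\<dots> = M * fact k * (\<Sum>t. (3 * L) ^ (t + T) / fact (t + T))"
    unfolding w_def using nn
    by (intro suminf_mult summable_ignore_initial_segment exp_tail_le(1)) simp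
  also have "\<dots> \<le> M * fact k * ((3 * L) ^ T / fact T * exp (3 * L))"
    using nn by (intro mult_left_mono exp_tail_le(2)) auto
  finally show ?thesis .
qed

lemma fact_le_self_power: "fact m \<le> real m ^ m"
  using fact_le_power[of m, where 'a = real] by simp

lemma linear_le_power: "\<mu> > 0 \<Longrightarrow> a \<ge> 1 \<Longrightarrow> a * real \<mu> \<le> (2 * a) ^ \<mu>"
proof -
  assume "\<mu> > 0" "a \<ge> 1"
  then have "a \<le> a ^ \<mu>" using power_increasing[of 1 \<mu> a] by simp
  moreover have "real \<mu> \<le> 2 ^ \<mu>" using of_nat_less_two_power[of \<mu>, where 'a = real] by simp
  ultimately show ?thesis unfolding power_mult_distrib using \<open>a \<ge> 1\<close> 
    by (subst mult.commute) (intro mult_mono; simp)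
qed

context approximation_system
begin

text \<open>Base of an exponential bound in mu for the solution from Siegel's lemma with s = 2 N,
  hence e = 2 N^2; its factor 4 N^2 mu is absorbed into (8 N^2)^mu by
  \<open>linear_le_power\<close>.\<close>

definition bX :: real where
  "bX = (8 * real N ^ 2 * (2 * real C ^ 2) ^ (2 * N ^ 2)) ^ (2 * N ^ 2)"

lemma X_bound:
  assumes "\<mu> > 0"
  shows "real ((2 * (N * (2 * N * \<mu>)) * (2 * C ^ 2) ^ Suc ((N * (2 * N) - 1) * \<mu>)) ^ (N * (2 * N))) \<le> bX ^ \<mu>"
proof -
  have NN: "N * (2 * N) = 2 * N ^ 2" by (simp add: power2_eq_square)
  have N1: "real N \<ge> 1" "real C \<ge> 1" using N C(1) by simp_all
  have T: "Suc ((2 * N ^ 2 - 1) * \<mu>) \<le> 2 * N ^ 2 * \<mu>"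
  proof -
    have "2 * N ^ 2 * \<mu> = (2 * N ^ 2 - 1) * \<mu> + \<mu>" using N by (cases "2 * N ^ 2") auto
    then show ?thesis using assms by simp
  qed
  have "real (2 * (N * (2 * N * \<mu>)) * (2 * C ^ 2) ^ Suc ((N * (2 * N) - 1) * \<mu>))
      = (4 * real N ^ 2 * real \<mu>) * (2 * real C ^ 2) ^ Suc ((2 * N ^ 2 - 1) * \<mu>)"
    unfolding NN by (simp add: power2_eq_square)
  also have "\<dots> \<le> (2 * (4 * real N ^ 2)) ^ \<mu> * (2 * real C ^ 2) ^ (2 * N ^ 2 * \<mu>)"
  proof (intro mult_mono linear_le_power assms power_increasing T)
    have "1 \<le> real N ^ 2" "1 \<le> real C ^ 2" using N1 by simp_all
    then show "1 \<le> 4 * (real N)\<^sup>2" "1 \<le> 2 * (real C)\<^sup>2" by linarith+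
  qed auto
  also have "\<dots> = (8 * real N ^ 2 * (2 * real C ^ 2) ^ (2 * N ^ 2)) ^ \<mu>"
    by (simp add: power_mult power_mult_distrib)
  finally have "real (2 * (N * (2 * N * \<mu>)) * (2 * C ^ 2) ^ Suc ((N * (2 * N) - 1) * \<mu>)) ^ (N * (2 * N))
      \<le> ((8 * real N ^ 2 * (2 * real C ^ 2) ^ (2 * N ^ 2)) ^ \<mu>) ^ (N * (2 * N))"
    by (intro power_mono) auto
  then show ?thesis unfolding NN bX_def by (simp only: of_nat_power power_mult[symmetric] mult.commute)
qed

text \<open>Spanning is phrased as the absence of a nonzero orthogonal vector, the shape used by
  \<open>exists_nonsingular_rows\<close>. The bound H / Z for the values is multiplied out.\<close>

definition small_forms :: "(nat \<Rightarrow> int) set \<Rightarrow> real \<Rightarrow> real \<Rightarrow> bool" where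
  "small_forms S H Z \<longleftrightarrow> (\<forall>u. (\<exists>j<N. u j \<noteq> 0) \<longrightarrow> (\<exists>s\<in>S. (\<Sum>j<N. s j * u j) \<noteq> 0)) \<and>
     (\<forall>s\<in>S. \<forall>j<N. \<bar>real_of_int (s j)\<bar> \<le> H) \<and>
     (\<forall>s\<in>S. \<bar>\<Sum>j<N. of_int (s j) * fps_value (f j) 1\<bar> * Z \<le> H)"

text \<open>The auxiliary polynomials have degree \<open>2 N \<mu>\<close> because then the exponents of \<open>\<mu>\<close> leave room:
  \<open>(2 N + 2) (N - 1) - (2 N\<^sup>2 - 1) = -1\<close>.\<close>
lemma exists_small_forms:
  shows "\<exists>b\<ge>(1::real). \<forall>\<mu>>N ^ 2 + N + v. \<exists>S. small_forms S (b ^ \<mu> * real \<mu> ^ ((2 * N + 2) * \<mu>)) (real \<mu> ^ ((2 * N ^ 2 - 1) * \<mu>))"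
proof -
  define a1 where "a1 = 2 * N + 2 + Suc N * G"
  \<comment> \<open>\<open>bH\<close> and \<open>bR\<close> collect the bases of all factors
    exponential in mu, for the coefficients and the values; powers of mu itself are kept
    apart.\<close>
  define bH where "bH = real q ^ 2 * (2 * real (2 * N + 3)) * real a1 ^ 2 * real (2 * N) ^ (2 * N) * bX"
  define bR where "bR = real q ^ 2 * real (2 * N) ^ (2 * N) * (2 * (2 * real N ^ 2)) * bX * (2 * real C) * 4 *
    (18 * real C) ^ (2 * N ^ 2) * exp (6 * real C)"
  have N1: "real N \<ge> 1" "real C \<ge> 1" "real q \<ge> 1" using N C(1) q(1) by simp_all
  have bX0: "bX \<ge> 0" by (simp add: bX_def)
  define b where "b = max 1 (max bH bR)"
  have bH0: "bH \<ge> 0" "bR \<ge> 0" using bX0 by (simp_all add: bH_def bR_def)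
  have le: "bH ^ \<mu> * y \<le> b ^ \<mu> * y" "bR ^ \<mu> * y \<le> b ^ \<mu> * y" if "y \<ge> 0" for \<mu> y
    using that bH0 by (auto simp: b_def intro!: mult_right_mono power_mono)
  have "\<exists>S. small_forms S (b ^ \<mu> * real \<mu> ^ ((2 * N + 2) * \<mu>)) (real \<mu> ^ ((2 * N ^ 2 - 1) * \<mu>))"
    if \<mu>: "\<mu> > N ^ 2 + N + v" for \<mu>
  proof -
    have \<mu>0: "\<mu> > 0" and \<mu>1: "real \<mu> \<ge> 1" using \<mu> by simp_all
    define m where "m = 2 * N * \<mu>"
    define T where "T = (N * (2 * N) - 1) * \<mu>"
    define X where "X = (2 * (N * m) * (2 * C ^ 2) ^ Suc T) ^ (N * (2 * N))"
    have X: "real X \<le> bX ^ \<mu>" unfolding X_def m_def T_def by (rule X_bound[OF \<mu>0])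
    have T': "T = (2 * N ^ 2 - 1) * \<mu>" by (simp add: T_def power2_eq_square mult_ac)
    have T\<mu>: "T + \<mu> = N * m"
    proof -
      obtain r where r: "2 * N ^ 2 = Suc r" using N by (cases "2 * N ^ 2") auto
      have "N * m = 2 * N ^ 2 * \<mu>" by (simp add: m_def power2_eq_square)
      then show ?thesis unfolding T' r by simp
    qed
    have muT: "\<mu> \<le> T"
    proof -
      have "1 \<le> N ^ 2" using N by (intro one_le_power) simp
      then have "1 \<le> 2 * N ^ 2 - 1" by arith
      then have "1 * \<mu> \<le> (2 * N ^ 2 - 1) * \<mu>" by (intro mult_le_mono1)
      then show ?thesis by (simp add: T')
    qed
    from N have "2 * N > 0" by simp
    from auxiliary_polynomials[OF this \<mu>0, folded m_def, folded T_def, folded X_def]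
    obtain P where P: "\<exists>j<N. P j \<noteq> 0" "\<And>j. j < N \<Longrightarrow> degree (P j) \<le> m"
      "\<And>j i. j < N \<Longrightarrow> coeff (P j) i \<in> \<int>" "\<And>j i. j < N \<Longrightarrow> \<bar>coeff (P j) i\<bar> \<le> fact m * of_nat X"
      "\<And>t. t < T \<Longrightarrow> fps_nth (lin_form N P f) t = 0"
      "\<And>t. \<bar>fps_nth (lin_form N P f) t\<bar> \<le> fact m / fact t * of_nat (N * m * X * (2 * C) ^ Suc t)" by blast
    \<comment> \<open>The summand in parentheses is the \<open>t\<close> of
      \<open>spanning_at_1\<close>, forced by T = N m - mu. The lower bound on mu then gives K <= 2
      mu.\<close>
    define K where "K = N + (\<mu> + N ^ 2 + v)"
    have K: "K \<le> 2 * \<mu>" using \<mu> by (simp add: K_def)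
    \<comment> \<open>Each derivative introduces at most one denominator \<open>q\<close>.\<close>
    define w where "w k j = of_nat q ^ k * poly (D P k j) 1" for k j
    have w_int: "w k j \<in> \<int>" if "j < N" for k j
      unfolding w_def poly_altdef sum_distrib_left
      using lf_deriv_integral[OF P(3) that] by (intro Ints_sum) simp
    define s where "s k j = \<lfloor>w k j\<rfloor>" for k j
    have s_eq: "rat_of_int (s k j) = w k j" if "j < N" for k j
      using w_int[OF that] unfolding s_def by (metis Ints_cases floor_of_int)
    have s_real: "real_of_int (s k j) = real_of_rat (w k j)" if "j < N" for k j
      using s_eq[OF that] by (metis of_rat_of_int_eq)
    have span: "\<exists>k<K. (\<Sum>j<N. s k j * u j) \<noteq> 0" if u: "\<exists>j<N. u j \<noteq> 0" for u :: "nat \<Rightarrow> int"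
    proof -
      have "\<exists>k<N + (\<mu> + N ^ 2 + v). (\<Sum>j<N. poly (D P k j) 1 * rat_of_int (u j)) \<noteq> 0"
      proof (rule spanning_at_1[OF sys bd P(1,2,5)])
        have "(N - 1) * (m + N) + v + m = N * m + (N - 1) * N + v"
          using N by (cases N) (auto simp: algebra_simps)
        moreover have "(N - 1) * N \<le> N ^ 2" by (simp add: power2_eq_square)
        moreover have "2 * \<mu> \<le> m" using N by (simp add: m_def)
        ultimately show "(N - 1) * (m + N) + v < T" using T\<mu> \<mu> by linarith
        show "N * (m + N) + v \<le> T + (\<mu> + N ^ 2 + v)"
          using T\<mu> by (simp add: power2_eq_square algebra_simps)
      qed (use u in auto)
      then obtain k where k: "k < K" "(\<Sum>j<N. poly (D P k j) 1 * rat_of_int (u j)) \<noteq> 0"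
        unfolding K_def by blast
      have eq: "rat_of_int (\<Sum>j<N. s k j * u j) = of_nat q ^ k * (\<Sum>j<N. poly (D P k j) 1 * rat_of_int (u j))"
        by (simp add: s_eq w_def sum_distrib_left mult.assoc)
      have "rat_of_int (\<Sum>j<N. s k j * u j) \<noteq> 0" unfolding eq using k(2) q(1) by simp
      then have "(\<Sum>j<N. s k j * u j) \<noteq> 0" by (metis of_int_0)
      then show ?thesis using k(1) by blast
    qed
    have factm: "fact m \<le> (real (2 * N) ^ (2 * N)) ^ \<mu> * real \<mu> ^ (2 * N * \<mu>)"
    proof -
      have "fact m \<le> real m ^ m" by (rule fact_le_self_power)
      also have "real m = real (2 * N) * real \<mu>" by (simp add: m_def)
      also have "\<dots> ^ m = (real (2 * N) ^ (2 * N)) ^ \<mu> * real \<mu> ^ (2 * N * \<mu>)"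
        by (simp only: power_mult_distrib m_def power_mult)
      finally show ?thesis .
    qed
    have qk: "real q ^ k \<le> (real q ^ 2) ^ \<mu>" if "k < K" for k
      unfolding power_mult[symmetric] using that K N1 by (intro power_increasing) auto
    \<comment> \<open>m! contributes mu^(2 N mu) and the up to 2 mu derivatives contribute mu^(2
      mu); all other factors are exponential.\<close>
    have H: "\<bar>real_of_int (s k j)\<bar> \<le> bH ^ \<mu> * real \<mu> ^ ((2 * N + 2) * \<mu>)" if "k < K" "j < N" for k j
    proof -
      have "\<bar>poly (D P k j) 1\<bar> \<le> of_nat (Suc (m + 2 * \<mu>)) * (of_nat (m + 2 * \<mu> + Suc N * G) ^ k * (fact m * of_nat X))"
        using that K by (intro lf_deriv_value_bound P) auto
      then have "real_of_rat \<bar>poly (D P k j) 1\<bar> \<le>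
          real_of_rat (of_nat (Suc (m + 2 * \<mu>)) * (of_nat (m + 2 * \<mu> + Suc N * G) ^ k * (fact m * of_nat X)))"
        using of_rat_less_eq by blast
      also have "\<dots> = real (Suc (m + 2 * \<mu>)) * (real (m + 2 * \<mu> + Suc N * G) ^ k * (fact m * real X))"
        by (simp only: of_rat_mult of_rat_power of_rat_of_nat_eq of_rat_fact)
      also have "\<dots> \<le> (2 * real (2 * N + 3)) ^ \<mu> * (((real a1 ^ 2) ^ \<mu> * real \<mu> ^ (2 * \<mu>)) *
          (((real (2 * N) ^ (2 * N)) ^ \<mu> * real \<mu> ^ (2 * N * \<mu>)) * bX ^ \<mu>))"
      proof (intro mult_mono factm X)
        have "real (Suc (m + 2 * \<mu>)) \<le> real (2 * N + 3) * real \<mu>"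
          using \<mu>0 unfolding of_nat_mult[symmetric] of_nat_le_iff m_def by (simp add: algebra_simps)
        also have "\<dots> \<le> (2 * real (2 * N + 3)) ^ \<mu>" using \<mu>0 by (intro linear_le_power) auto
        finally show "real (Suc (m + 2 * \<mu>)) \<le> (2 * real (2 * N + 3)) ^ \<mu>" .
        have 1: "m + 2 * \<mu> + Suc N * G \<le> a1 * \<mu>"
        proof -
          have "Suc N * G * 1 \<le> Suc N * G * \<mu>" using \<mu>0 by (intro mult_le_mono2) auto
          then show ?thesis unfolding a1_def m_def by (simp add: algebra_simps)
        qed
        have "real (m + 2 * \<mu> + Suc N * G) ^ k \<le> (real a1 * real \<mu>) ^ k"
          using 1 by (intro power_mono) (auto simp flip: of_nat_mult)
        also have "\<dots> \<le> (real a1 * real \<mu>) ^ (2 * \<mu>)"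
        proof (intro power_increasing)
          have "1 * 1 \<le> real a1 * real \<mu>" using \<mu>1 by (intro mult_mono) (auto simp: a1_def)
          then show "1 \<le> real a1 * real \<mu>" by simp
        qed (use that K in auto)
        also have "\<dots> = (real a1 ^ 2) ^ \<mu> * real \<mu> ^ (2 * \<mu>)" by (simp only: power_mult_distrib power_mult)
        finally show "real (m + 2 * \<mu> + Suc N * G) ^ k \<le> (real a1 ^ 2) ^ \<mu> * real \<mu> ^ (2 * \<mu>)" .
      qed (auto simp: bX0)
      finally have 2: "real_of_rat \<bar>poly (D P k j) 1\<bar> \<le> \<dots>" .
      have "\<bar>real_of_int (s k j)\<bar> = real q ^ k * real_of_rat \<bar>poly (D P k j) 1\<bar>"
        by (simp add: s_real that w_def of_rat_mult of_rat_power abs_mult)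
      also have "\<dots> \<le> (real q ^ 2) ^ \<mu> * ((2 * real (2 * N + 3)) ^ \<mu> * (((real a1 ^ 2) ^ \<mu> * real \<mu> ^ (2 * \<mu>)) *
          (((real (2 * N) ^ (2 * N)) ^ \<mu> * real \<mu> ^ (2 * N * \<mu>)) * bX ^ \<mu>)))"
        by (intro mult_mono qk that 2) auto
      also have "\<dots> = bH ^ \<mu> * (real \<mu> ^ (2 * N * \<mu>) * real \<mu> ^ (2 * \<mu>))"
        unfolding bH_def power_mult_distrib by (simp only: mult_ac)
      also have "real \<mu> ^ (2 * N * \<mu>) * real \<mu> ^ (2 * \<mu>) = real \<mu> ^ ((2 * N + 2) * \<mu>)"
        by (simp only: power_add[symmetric] distrib_right)
      finally show ?thesis .
    qed
    have R: "\<bar>\<Sum>j<N. of_int (s k j) * fps_value (f j) 1\<bar> * real \<mu> ^ T \<le> bR ^ \<mu> * real \<mu> ^ ((2 * N + 2) * \<mu>)"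
      if k: "k < K" for k
    proof -
      define M where "M = fact m * real (N * m) * real X * (2 * real C)"
      have M0: "M \<ge> 0" by (simp add: M_def)
      have bnd: "\<bar>real_of_rat (fps_nth (lin_form N P f) t)\<bar> \<le> M / fact t * (2 * real C) ^ t" for t
      proof -
        have "real_of_rat \<bar>fps_nth (lin_form N P f) t\<bar> \<le> real_of_rat (fact m / fact t * of_nat (N * m * X * (2 * C) ^ Suc t))"
          using P(6)[of t] of_rat_less_eq by blast
        also have "\<dots> = M / fact t * (2 * real C) ^ t"
          by (simp add: of_rat_mult of_rat_divide of_rat_fact of_rat_power M_def)
        finally show ?thesis by simp
      qed
      have "\<bar>\<Sum>j<N. of_int (s k j) * fps_value (f j) 1\<bar> = real q ^ k * \<bar>fps_value ((fps_theta ^^ k) (lin_form N P f)) 1\<bar>"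
        unfolding lin_form_lf_deriv_pow[OF sys, symmetric] fps_value_lin_form
        by (simp add: s_real w_def of_rat_mult of_rat_power mult.assoc abs_mult flip: sum_distrib_left)
      also have "\<dots> \<le> real q ^ k * (M * fact k * ((3 * (2 * real C)) ^ T / fact T * exp (3 * (2 * real C))))"
        by (intro mult_left_mono fps_value_fps_theta_pow_tail_bound P bnd M0) auto
      finally have "\<bar>\<Sum>j<N. of_int (s k j) * fps_value (f j) 1\<bar> * real \<mu> ^ T
          \<le> real q ^ k * (M * fact k * ((3 * (2 * real C)) ^ T / fact T * exp (3 * (2 * real C)))) * real \<mu> ^ T"
        by (intro mult_right_mono) auto
      also have "\<dots> = real q ^ k * M * fact k * (6 * real C) ^ T * exp (6 * real C) * (real \<mu> ^ T / fact T)"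
        by simp
      also have "\<dots> \<le> (real q ^ 2) ^ \<mu> * (((real (2 * N) ^ (2 * N)) ^ \<mu> * real \<mu> ^ (2 * N * \<mu>)) *
          (2 * (2 * real N ^ 2)) ^ \<mu> * bX ^ \<mu> * (2 * real C) ^ \<mu>) * (4 ^ \<mu> * real \<mu> ^ (2 * \<mu>)) * (6 * real C) ^ T *
          exp (6 * real C) ^ \<mu> * 3 ^ T"
        unfolding M_def
      proof (intro mult_mono factm X qk k)
        have "real (N * m) = (2 * real N ^ 2) * real \<mu>" by (simp add: m_def power2_eq_square)
        also have "\<dots> \<le> (2 * (2 * real N ^ 2)) ^ \<mu>"
        proof (intro linear_le_power \<mu>0)
          have "1 \<le> real N ^ 2" using N1 by simp
          then show "1 \<le> 2 * real N ^ 2" by linarith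
        qed
        finally show "real (N * m) \<le> (2 * (2 * real N ^ 2)) ^ \<mu>" .
        show "2 * real C \<le> (2 * real C) ^ \<mu>" using N1 \<mu>0 power_increasing[of 1 \<mu> "2 * real C"] by simp
        show "exp (6 * real C) \<le> exp (6 * real C) ^ \<mu>" using \<mu>0 power_increasing[of 1 \<mu> "exp (6 * real C)"] by simp
        have "fact k \<le> (fact (2 * \<mu>) :: real)" using k K by (intro fact_mono) auto
        also have "\<dots> \<le> real (2 * \<mu>) ^ (2 * \<mu>)" by (rule fact_le_self_power)
        also have "real (2 * \<mu>) = 2 * real \<mu>" by simp
        also have "\<dots> ^ (2 * \<mu>) = (2 ^ 2) ^ \<mu> * real \<mu> ^ (2 * \<mu>)"
          by (simp only: power_mult_distrib power_mult)
        finally show "fact k \<le> 4 ^ \<mu> * real \<mu> ^ (2 * \<mu>)" by simp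
        \<comment> \<open>The source of the smallness: 1 / T! is at most 3^T / mu^T, because mu <=
          T.\<close>
        have "real \<mu> ^ T \<le> real T ^ T" using muT by (intro power_mono) auto
        also have "\<dots> \<le> fact T * 3 ^ T" by (rule power_le_fact_3)
        finally show "real \<mu> ^ T / fact T \<le> 3 ^ T" by (simp add: divide_le_eq mult.commute)
      qed (auto simp: bX0 intro!: mult_nonneg_nonneg)
      also have "\<dots> = (real q ^ 2) ^ \<mu> * (((real (2 * N) ^ (2 * N)) ^ \<mu> * real \<mu> ^ (2 * N * \<mu>)) *
          (2 * (2 * real N ^ 2)) ^ \<mu> * bX ^ \<mu> * (2 * real C) ^ \<mu>) * (4 ^ \<mu> * real \<mu> ^ (2 * \<mu>)) *
          exp (6 * real C) ^ \<mu> * (18 * real C) ^ T"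
      proof -
        have "18 * real C = 6 * real C * 3" by simp
        then have "(18 * real C) ^ T = (6 * real C) ^ T * 3 ^ T" by (simp only: power_mult_distrib)
        then have "y * (6 * real C) ^ T * z * 3 ^ T = y * z * (18 * real C) ^ T" for y z
          by (simp only: mult.assoc mult.left_commute)
        then show ?thesis .
      qed
      also have "\<dots> \<le> (real q ^ 2) ^ \<mu> * (((real (2 * N) ^ (2 * N)) ^ \<mu> * real \<mu> ^ (2 * N * \<mu>)) *
          (2 * (2 * real N ^ 2)) ^ \<mu> * bX ^ \<mu> * (2 * real C) ^ \<mu>) * (4 ^ \<mu> * real \<mu> ^ (2 * \<mu>)) *
          exp (6 * real C) ^ \<mu> * ((18 * real C) ^ (2 * N ^ 2)) ^ \<mu>"
        unfolding power_mult[symmetric, of "18 * real C"]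
        using N1 by (intro mult_left_mono power_increasing) (auto simp: T' bX0 intro!: mult_nonneg_nonneg)
      also have "\<dots> = bR ^ \<mu> * (real \<mu> ^ (2 * N * \<mu>) * real \<mu> ^ (2 * \<mu>))"
        unfolding bR_def power_mult_distrib by (simp only: mult_ac)
      also have "real \<mu> ^ (2 * N * \<mu>) * real \<mu> ^ (2 * \<mu>) = real \<mu> ^ ((2 * N + 2) * \<mu>)"
        by (simp only: power_add[symmetric] distrib_right)
      finally show ?thesis .
    qed
    have y: "bH ^ \<mu> * real \<mu> ^ ((2 * N + 2) * \<mu>) \<le> b ^ \<mu> * real \<mu> ^ ((2 * N + 2) * \<mu>)"
      "bR ^ \<mu> * real \<mu> ^ ((2 * N + 2) * \<mu>) \<le> b ^ \<mu> * real \<mu> ^ ((2 * N + 2) * \<mu>)" by (simp_all add: le)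
    show ?thesis
      unfolding small_forms_def
    proof (intro exI[of _ "s ` {..<K}"] conjI ballI)
      show "\<forall>u. (\<exists>j<N. u j \<noteq> 0) \<longrightarrow> (\<exists>s\<in>s ` {..<K}. (\<Sum>j<N. s j * u j) \<noteq> 0)" using span by blast
    next
      fix x assume "x \<in> s ` {..<K}"
      then obtain k where k: "k < K" "x = s k" by blast
      show "\<forall>j<N. \<bar>real_of_int (x j)\<bar> \<le> b ^ \<mu> * real \<mu> ^ ((2 * N + 2) * \<mu>)"
        using order_trans[OF H[OF k(1)] y(1)] k(2) by blast
      show "\<bar>\<Sum>j<N. of_int (x j) * fps_value (f j) 1\<bar> * real \<mu> ^ ((2 * N ^ 2 - 1) * \<mu>)
          \<le> b ^ \<mu> * real \<mu> ^ ((2 * N + 2) * \<mu>)"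
        using order_trans[OF R[OF k(1)] y(2)] unfolding k(2) T' .
    qed
  qed
  then show ?thesis by (intro exI[of _ b]) (auto simp: b_def)
qed

text \<open>The relation as row 0 above N - 1 small forms gives a nonzero integer determinant.
  Replacing column 0 by the values of the forms, possible since \<open>f 0\<close> has value 1,
  makes the corner zero and the column small. The determinant is then at most N! L H^(N-1) / Z,
  which falls below 1.\<close>

theorem values_independent:
  assumes f0: "f 0 = 1" and rel: "(\<Sum>j<N. of_int (a j) * fps_value (f j) 1) = 0"
  shows "\<forall>j<N. a j = (0::int)"
proof (rule ccontr)
  assume "\<not> ?thesis"
  then have a: "\<exists>j<N. a j \<noteq> 0" by blast
  have ev0: "fps_value (f 0) 1 = 1" using fps_value_const[of 1 1] f0 by simp
  have N2: "N \<ge> 2"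
  proof (rule ccontr)
    assume "\<not> N \<ge> 2"
    then have "N = 1" using N by simp
    then show False using rel a ev0 by auto
  qed
  obtain b where b: "b \<ge> 1"
    "\<forall>\<mu>>N ^ 2 + N + v. \<exists>S. small_forms S (b ^ \<mu> * real \<mu> ^ ((2 * N + 2) * \<mu>)) (real \<mu> ^ ((2 * N ^ 2 - 1) * \<mu>))"
    using exists_small_forms by blast
  define L where "L = (\<Sum>j<N. \<bar>real_of_int (a j)\<bar>)"
  have L0: "L \<ge> 0" by (simp add: L_def sum_nonneg)
  \<comment> \<open>The second condition leaves a gain of 2^mu in mu^mu over b^((N-1) mu); since
    2^mu > mu, the third makes this gain exceed N! L.\<close>
  obtain \<mu> where \<mu>: "\<mu> > N ^ 2 + N + v" "real \<mu> \<ge> 2 * b ^ (N - 1)" "real \<mu> \<ge> fact N * L"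
  proof -
    obtain \<mu>1 where "real \<mu>1 \<ge> 2 * b ^ (N - 1)" using real_arch_simple by blast
    moreover obtain \<mu>2 where "real \<mu>2 \<ge> fact N * L" using real_arch_simple by blast
    moreover obtain e where e: "e = N ^ 2 + N + v" by simp
    ultimately show ?thesis
      by (intro that[of "\<mu>1 + \<mu>2 + Suc e"]) (simp_all add: e[symmetric])
  qed
  have \<mu>0: "real \<mu> > 0" using \<mu>(1) by simp
  define H where "H = b ^ \<mu> * real \<mu> ^ ((2 * N + 2) * \<mu>)"
  have H0: "H \<ge> 0" using b(1) by (simp add: H_def)
  define Z where "Z = real \<mu> ^ ((2 * N ^ 2 - 1) * \<mu>)"
  have Z0: "Z > 0" using \<mu>0 by (simp add: Z_def)
  obtain S where "small_forms S H Z"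
    using b(2)[rule_format, OF \<mu>(1)] unfolding H_def Z_def by blast
  then have S: "\<And>u. \<exists>j<N. u j \<noteq> 0 \<Longrightarrow> \<exists>s\<in>S. (\<Sum>j<N. s j * u j) \<noteq> 0"
    "\<And>s j. s \<in> S \<Longrightarrow> j < N \<Longrightarrow> \<bar>real_of_int (s j)\<bar> \<le> H"
    "\<And>s. s \<in> S \<Longrightarrow> \<bar>\<Sum>j<N. of_int (s j) * fps_value (f j) 1\<bar> * Z \<le> H"
    unfolding small_forms_def by blast+
  obtain V where V: "V 0 = a" "\<And>i. 0 < i \<Longrightarrow> i < N \<Longrightarrow> V i \<in> S" "fdet N V \<noteq> 0"
    using exists_nonsingular_rows[OF a, of S] S(1) by blast
  let ?x = "\<lambda>j. fps_value (f j) 1"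
  define A where "A i j = (if j = 0 then \<Sum>l<N. of_int (V i l) * ?x l else real_of_int (V i j))" for i j
  have "fdet N A = ?x 0 * fdet N (\<lambda>i j. real_of_int (V i j))"
    unfolding A_def by (rule fdet_cramer[OF N])
  then have "\<bar>fdet N A\<bar> = \<bar>real_of_int (fdet N V)\<bar>" by (simp add: ev0 fdet_of_int)
  also have "\<dots> \<ge> 1" using V(3) by linarith
  finally have "1 \<le> \<bar>fdet N A\<bar>" .
  also have "\<dots> \<le> fact N * (L * (H / Z) * H ^ (N - 2))"
  proof (rule fdet_bound[OF _ N L0 _ H0])
    show A00: "A 0 0 = 0" using rel V(1) by (simp add: A_def)
    show "0 \<le> H / Z" using H0 Z0 by simp
    show "\<bar>A 0 j\<bar> \<le> L" if "j < N" for j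
    proof (cases "j = 0")
      case False
      have "\<bar>real_of_int (a j)\<bar> \<le> L" unfolding L_def using that by (intro member_le_sum) auto
      then show ?thesis using False V(1) by (simp add: A_def)
    qed (use A00 L0 in simp)
    show "\<bar>A i 0\<bar> \<le> H / Z" if "0 < i" "i < N" for i
      using S(3)[OF V(2)[OF that]] Z0 by (simp add: A_def le_divide_eq)
    show "\<bar>A i j\<bar> \<le> H" if "0 < i" "0 < j" "i < N" "j < N" for i j
      using S(2)[OF V(2)[OF that(1,3)] that(4)] that by (simp add: A_def)
  qed
  finally have "Z \<le> fact N * L * (H * H ^ (N - 2))" using Z0 by (simp add: field_simps)
  also have "H * H ^ (N - 2) = H ^ (N - 1)" using N2 by (simp flip: power_Suc add: Suc_diff_Suc numeral_2_eq_2)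
  also have "\<dots> = (b ^ (N - 1)) ^ \<mu> * real \<mu> ^ ((2 * N ^ 2 - 2) * \<mu>)"
  proof -
    have "(2 * N + 2) * (N - 1) = 2 * N ^ 2 - 2"
      using N2 by (cases N) (auto simp: power2_eq_square algebra_simps)
    then have "(2 * N + 2) * \<mu> * (N - 1) = (2 * N ^ 2 - 2) * \<mu>" by (metis mult.assoc mult.commute)
    then show ?thesis unfolding H_def power_mult_distrib power_mult[symmetric] by (simp only: mult.commute)
  qed
  also have "Z = real \<mu> ^ \<mu> * real \<mu> ^ ((2 * N ^ 2 - 2) * \<mu>)"
  proof -
    have "1 \<le> N ^ 2" using N by (intro one_le_power) simp
    then have "2 * N ^ 2 - 1 = Suc (2 * N ^ 2 - 2)" by arith
    then show ?thesis unfolding Z_def by (simp add: power_add)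
  qed
  finally have "real \<mu> ^ \<mu> * real \<mu> ^ ((2 * N ^ 2 - 2) * \<mu>)
      \<le> (fact N * L * (b ^ (N - 1)) ^ \<mu>) * real \<mu> ^ ((2 * N ^ 2 - 2) * \<mu>)" by (simp only: mult.assoc)
  then have "real \<mu> ^ \<mu> \<le> fact N * L * (b ^ (N - 1)) ^ \<mu>" using \<mu>0 by simp
  moreover have "(2 * b ^ (N - 1)) ^ \<mu> \<le> real \<mu> ^ \<mu>" using \<mu>(2) b(1) by (intro power_mono) auto
  ultimately have "2 ^ \<mu> * (b ^ (N - 1)) ^ \<mu> \<le> fact N * L * (b ^ (N - 1)) ^ \<mu>"
    by (simp add: power_mult_distrib)
  then have "2 ^ \<mu> \<le> fact N * L" using b(1) by simp
  moreover have "real \<mu> < 2 ^ \<mu>" by (rule of_nat_less_two_power)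
  ultimately show False using \<mu>(3) by linarith
qed

end

section \<open>E-functions in triangular systems\<close>

text \<open>k (p^a choose k) is divisible by p^a; were the binomial coefficient prime to p, then p^a
  would divide k < p^a.\<close>

lemma prime_power_dvd_choose:
  assumes "prime (p::nat)" "0 < k" "k < p ^ a"
  shows "p dvd (p ^ a choose k)"
proof (rule ccontr)
  assume "\<not> p dvd (p ^ a choose k)"
  then have "coprime (p ^ a) (p ^ a choose k)" using assms(1) by (simp add: prime_imp_coprime)
  moreover have "p ^ a dvd k * (p ^ a choose k)"
    using assms(2,3) by (subst times_binomial_minus1_eq) auto
  ultimately have "p ^ a dvd k" by (simp add: coprime_dvd_mult_left_iff)
  then show False using assms(2,3) by (simp add: nat_dvd_not_less)
qed

text \<open>Vandermonde with 2 n = p^a + (2 n - p^a): the term k = 0 vanishes because 2 n - p^a < n,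
  and p divides the others because k <= n < p^a.\<close>

lemma prime_dvd_central_binomial:
  assumes p: "prime (p::nat)" and "n < p ^ a" "p ^ a \<le> 2 * n"
  shows "p dvd (2 * n choose n)"
proof -
  have "2 * n choose n = (\<Sum>k\<le>n. (p ^ a choose k) * ((2 * n - p ^ a) choose (n - k)))"
    using vandermonde[of "p ^ a" "2 * n - p ^ a" n] assms(3) by simp
  also have "p dvd \<dots>"
  proof (intro dvd_sum)
    fix k assume k: "k \<in> {..n}"
    show "p dvd (p ^ a choose k) * ((2 * n - p ^ a) choose (n - k))"
    proof (cases "k = 0")
      case True
      then show ?thesis using assms(2,3) by (simp add: binomial_eq_0)
    next
      case False
      then show ?thesis using prime_power_dvd_choose[OF p, of k a] k assms(2) by simp
    qed
  qed
  finally show ?thesis .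
qed

lemma dvd_if_prime_powers_dvd:
  fixes j R :: nat
  assumes "j > 0" "\<And>p a. prime p \<Longrightarrow> p ^ a dvd j \<Longrightarrow> p ^ a dvd R"
  shows "j dvd R"
proof (cases "R = 0")
  case False
  show ?thesis
  proof (rule multiplicity_le_imp_dvd)
    show "multiplicity p j \<le> multiplicity p R" if "prime p" for p
      using assms(2)[OF that multiplicity_dvd] False that by (intro multiplicity_geI) auto
  qed (use assms(1) in simp)
qed simp

text \<open>A prime power p^a <= n already divides lcm(1..n). If n < p^a <= 2 n, then p^(a-1) does,
  and the missing p comes from the central binomial coefficient.\<close>

lemma Lcm_double_dvd: "Lcm {1..2 * n} dvd Lcm {1..n} * (2 * n choose n)" for n :: nat
proof (rule Lcm_least)
  fix j assume j: "j \<in> {1..2 * n}"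
  show "j dvd Lcm {1..n} * (2 * n choose n)"
  proof (rule dvd_if_prime_powers_dvd)
    fix p a :: nat assume p: "prime p" and "p ^ a dvd j"
    then have pa: "p ^ a \<le> 2 * n" using j dvd_imp_le[of "p ^ a" j] by auto
    have p2: "p \<ge> 2" using p by (rule prime_ge_2_nat)
    show "p ^ a dvd Lcm {1..n} * (2 * n choose n)"
    proof (cases "p ^ a \<le> n")
      case True
      then have "p ^ a dvd Lcm {1..n}" using p2 by (intro dvd_Lcm) auto
      then show ?thesis by simp
    next
      case False
      then have "a > 0" using j by (cases a) auto
      then obtain a' where a: "a = Suc a'" by (cases a) auto
      have "2 * p ^ a' \<le> p * p ^ a'" using p2 by (intro mult_right_mono) auto
      then have "p ^ a' \<le> n" using pa unfolding a power_Suc by linarith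
      then have "p ^ a' dvd Lcm {1..n}" using p2 by (intro dvd_Lcm) auto
      moreover have "p dvd (2 * n choose n)" using False pa by (intro prime_dvd_central_binomial[OF p, of n a]) auto
      ultimately have "p ^ a' * p dvd Lcm {1..n} * (2 * n choose n)" by (rule mult_dvd_mono)
      then show ?thesis by (simp add: a mult.commute)
    qed
  qed (use j in auto)
qed

lemma Lcm_pos: "Lcm {1..n} > (0::nat)"
  using Lcm_0_iff[of "{1..n}"] by (simp flip: neq0_conv)

lemma Lcm_double_le: "Lcm {1..2 * n} \<le> Lcm {1..n} * 4 ^ n" for n :: nat
proof -
  have "Lcm {1..2 * n} \<le> Lcm {1..n} * (2 * n choose n)"
    using Lcm_pos[of n] by (intro dvd_imp_le Lcm_double_dvd) simp
  also have "(2 * n choose n) \<le> 2 ^ (2 * n)" by (rule binomial_le_pow2)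
  finally show ?thesis by (simp add: power_mult)
qed

text \<open>Halving the argument. Odd n = 2 m + 1 passes through 2 (m + 1) and picks up a constant
  factor, which base 16 leaves room to absorb once m >= 1.\<close>

lemma Lcm_le: "Lcm {1..n} \<le> (16::nat) ^ n"
proof (induction n rule: less_induct)
  case (less n)
  consider "n = 0" | "n = 1" | m where "n = 2 * m" "m \<ge> 1" | m where "n = 2 * m + 1" "m \<ge> 1"
  proof -
    have "n = 2 * (n div 2) \<or> n = 2 * (n div 2) + 1" by presburger
    then show ?thesis
      using that(1,2) that(3)[of "n div 2"] that(4)[of "n div 2"] by (cases "n div 2 = 0") auto
  qed
  then show ?case
  proof cases
    case (3 m)
    have "Lcm {1..2 * m} \<le> Lcm {1..m} * 4 ^ m" by (rule Lcm_double_le)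
    also have "\<dots> \<le> 16 ^ m * 16 ^ m" using less[of m] 3 by (intro mult_mono power_mono) auto
    finally show ?thesis by (simp add: 3 mult_2 power_add)
  next
    case (4 m)
    have "Lcm {1..n} \<le> Lcm {1..2 * (m + 1)}"
      using Lcm_pos[of "2 * (m + 1)"] by (intro dvd_imp_le Lcm_least dvd_Lcm) (auto simp: 4)
    also have "\<dots> \<le> Lcm {1..m + 1} * 4 ^ (m + 1)" by (rule Lcm_double_le)
    also have "\<dots> \<le> 16 ^ (m + 1) * 4 ^ (m + 1)" using less[of "m + 1"] 4 by (intro mult_right_mono) auto
    also have "\<dots> = 64 * (16 ^ m * 4 ^ m)" by simp
    also have "\<dots> = 16 * (16 ^ m * (4 * 4 ^ m))" by simp
    also have "4 * 4 ^ m \<le> 4 ^ m * (4 ^ m :: nat)"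
      using 4 power_increasing[of 1 m "4::nat"] by (intro mult_right_mono) auto
    also have "4 ^ m * 4 ^ m = (16::nat) ^ m" by (simp flip: power_mult_distrib)
    finally show ?thesis by (simp add: 4 mult_2 power_add)
  qed simp_all
qed

text \<open>The arithmetic part of Siegel's definition, for rational coefficients; the differential
  equation comes from the triangular system. The exponent Suc k leaves room for a constant at k =
  0.\<close>

definition E_function :: "rat fps \<Rightarrow> bool" where
  "E_function f \<longleftrightarrow> (\<exists>C d. C > 0 \<and> (\<forall>k. \<bar>fact k * fps_nth f k\<bar> \<le> of_nat C ^ Suc k) \<and>
    (\<forall>k. d k > 0 \<and> d k \<le> C ^ Suc k) \<and> (\<forall>k. \<forall>j\<le>k. of_nat (d k) * (fact j * fps_nth f j) \<in> \<int>))"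

lemma E_functionI:
  assumes "C > 0" "\<And>k. \<bar>fact k * fps_nth f k\<bar> \<le> of_nat C ^ Suc k" "\<And>k. d k > 0" "\<And>k. d k \<le> C ^ Suc k"
    "\<And>j k. j \<le> k \<Longrightarrow> of_nat (d k) * (fact j * fps_nth f j) \<in> \<int>"
  shows "E_function f"
  unfolding E_function_def using assms by (intro exI[of _ C] exI[of _ d]) auto

lemma E_functionE:
  assumes "E_function f"
  obtains C d where "C > 0" "\<And>k. \<bar>fact k * fps_nth f k\<bar> \<le> of_nat C ^ Suc k" "\<And>k. d k > 0" "\<And>k. d k \<le> C ^ Suc k"
    "\<And>j k. j \<le> k \<Longrightarrow> of_nat (d k) * (fact j * fps_nth f j) \<in> \<int>"
  using assms unfolding E_function_def by blast

lemma E_function_one: "E_function 1"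
  by (rule E_functionI[of 1 _ "\<lambda>_. 1"]) auto

text \<open>For the numbers k! f_k the product is a binomial convolution; the row sums 2^k explain
  the factor 2 in the constant.\<close>

lemma E_function_mult:
  assumes "E_function f" "E_function g"
  shows "E_function (f * g)"
proof -
  obtain C d where C: "C > 0" "\<And>k. \<bar>fact k * fps_nth f k\<bar> \<le> of_nat C ^ Suc k" "\<And>k. d k > 0" "\<And>k. d k \<le> C ^ Suc k"
    "\<And>j k. j \<le> k \<Longrightarrow> of_nat (d k) * (fact j * fps_nth f j) \<in> \<int>" using E_functionE[OF assms(1)] by blast
  obtain C' d' where C': "C' > 0" "\<And>k. \<bar>fact k * fps_nth g k\<bar> \<le> of_nat C' ^ Suc k" "\<And>k. d' k > 0" "\<And>k. d' k \<le> C' ^ Suc k"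
    "\<And>j k. j \<le> k \<Longrightarrow> of_nat (d' k) * (fact j * fps_nth g j) \<in> \<int>" using E_functionE[OF assms(2)] by blast
  have nth: "fact k * fps_nth (f * g) k = (\<Sum>i\<le>k. of_nat (k choose i) * (fact i * fps_nth f i) * (fact (k - i) * fps_nth g (k - i)))" for k
    unfolding fps_mult_nth sum_distrib_left atLeast0AtMost
    by (intro sum.cong refl) (simp add: binomial_fact)
  show ?thesis
  proof (rule E_functionI[of "2 * C * C'" _ "\<lambda>k. d k * d' k"])
    show "2 * C * C' > 0" using C(1) C'(1) by simp
    fix k
    have "\<bar>fact k * fps_nth (f * g) k\<bar> \<le> (\<Sum>i\<le>k. of_nat (k choose i) * (of_nat C ^ Suc k * of_nat C' ^ Suc k))"
      unfolding nth
    proof (intro order_trans[OF sum_abs] sum_mono)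
      fix i assume i: "i \<in> {..k}"
      have 1: "\<bar>fact i * fps_nth f i\<bar> \<le> of_nat C ^ Suc k"
        using C(1) i by (intro order_trans[OF C(2)] power_increasing) auto
      have 2: "\<bar>fact (k - i) * fps_nth g (k - i)\<bar> \<le> of_nat C' ^ Suc k"
        using C'(1) i by (intro order_trans[OF C'(2)] power_increasing) auto
      show "\<bar>of_nat (k choose i) * (fact i * fps_nth f i) * (fact (k - i) * fps_nth g (k - i))\<bar>
          \<le> of_nat (k choose i) * (of_nat C ^ Suc k * of_nat C' ^ Suc k)"
      proof -
        have "\<bar>of_nat (k choose i) * (fact i * fps_nth f i) * (fact (k - i) * fps_nth g (k - i))\<bar>
            = of_nat (k choose i) * (\<bar>fact i * fps_nth f i\<bar> * \<bar>fact (k - i) * fps_nth g (k - i)\<bar>)"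
          by (simp only: abs_mult abs_of_nat mult.assoc)
        also have "\<dots> \<le> of_nat (k choose i) * (of_nat C ^ Suc k * of_nat C' ^ Suc k)"
          by (intro mult_left_mono mult_mono[OF 1 2]) auto
        finally show ?thesis .
      qed
    qed
    also have "\<dots> = of_nat (\<Sum>i\<le>k. k choose i) * (of_nat C ^ Suc k * of_nat C' ^ Suc k)"
      by (simp add: sum_distrib_right)
    also have "\<dots> = 2 ^ k * (of_nat C ^ Suc k * of_nat C' ^ Suc k)" by (simp add: choose_row_sum)
    also have "\<dots> \<le> 2 ^ Suc k * (of_nat C ^ Suc k * of_nat C' ^ Suc k)" by (intro mult_right_mono) auto
    also have "\<dots> = of_nat (2 * C * C') ^ Suc k" by (simp only: of_nat_mult power_mult_distrib of_nat_numeral mult.assoc)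
    finally show "\<bar>fact k * fps_nth (f * g) k\<bar> \<le> of_nat (2 * C * C') ^ Suc k" .
    show "0 < d k * d' k" using C(3) C'(3) by simp
    have "d k * d' k \<le> C ^ Suc k * C' ^ Suc k" using C(4) C'(4) by (intro mult_mono) auto
    also have "\<dots> \<le> (2 * C * C') ^ Suc k"
      unfolding power_mult_distrib[symmetric] by (intro power_mono) auto
    finally show "d k * d' k \<le> (2 * C * C') ^ Suc k" .
    fix j assume "j \<le> k"
    have "of_nat (d k * d' k) * (fact j * fps_nth (f * g) j) =
        (\<Sum>i\<le>j. of_nat (j choose i) * (of_nat (d k) * (fact i * fps_nth f i)) * (of_nat (d' k) * (fact (j - i) * fps_nth g (j - i))))"
      unfolding nth sum_distrib_left by (intro sum.cong refl) simp
    also have "\<dots> \<in> \<int>"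
      using \<open>j \<le> k\<close> by (intro Ints_sum Ints_mult[OF Ints_mult] C(5) C'(5)) auto
    finally show "of_nat (d k * d' k) * (fact j * fps_nth (f * g) j) \<in> \<int>" .
  qed
qed

lemma E_function_power: "E_function f \<Longrightarrow> E_function (f ^ k)"
  by (induction k) (auto simp: E_function_one E_function_mult)

section \<open>The functions e^(-z) and y_n\<close>

definition expm :: "rat fps" where
  "expm = Abs_fps (\<lambda>k. (-1) ^ k / fact k)"

definition polyexp :: "nat \<Rightarrow> rat fps" where
  "polyexp n = Abs_fps (\<lambda>j. if j = 0 then 0 else (-1) ^ (j - 1) / (fact j * of_nat j ^ n))"

lemma E_function_expm: "E_function expm"
  by (rule E_functionI[of 1 _ "\<lambda>_. 1"]) (auto simp: expm_def abs_mult power_abs)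

text \<open>After multiplication by j! the coefficients are (-1)^(j-1) / j^n: bounded, with common
  denominator lcm(1..k)^n, whose growth \<open>Lcm_le\<close> controls.\<close>

lemma E_function_polyexp: "E_function (polyexp n)"
proof (rule E_functionI[of "16 ^ n" _ "\<lambda>k. Lcm {1..k} ^ n"])
  show "(0::nat) < 16 ^ n" by simp
  fix k
  have "\<bar>fact k * fps_nth (polyexp n) k\<bar> \<le> 1"
    by (auto simp: polyexp_def abs_mult power_abs divide_le_eq)
  also have "\<dots> \<le> of_nat (16 ^ n) ^ Suc k" by (intro one_le_power) simp
  finally show "\<bar>fact k * fps_nth (polyexp n) k\<bar> \<le> of_nat (16 ^ n) ^ Suc k" .
  show "0 < Lcm {1..k} ^ n" using Lcm_pos[of k] by simp
  have "Lcm {1..k} ^ n \<le> (16 ^ Suc k) ^ n"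
    using order_trans[OF Lcm_le[of k] power_increasing[of k "Suc k" "16::nat"]] by (intro power_mono) auto
  then show "Lcm {1..k} ^ n \<le> (16 ^ n) ^ Suc k" by (simp only: power_mult[symmetric] mult.commute)
  fix j assume "j \<le> k"
  show "of_nat (Lcm {1..k} ^ n) * (fact j * fps_nth (polyexp n) j) \<in> \<int>"
  proof (cases "j = 0")
    case False
    then have "j dvd Lcm {1..k}" using \<open>j \<le> k\<close> by (intro dvd_Lcm) auto
    then obtain r where r: "Lcm {1..k} = j * r" by (elim dvdE)
    have "of_nat (Lcm {1..k} ^ n) * (fact j * fps_nth (polyexp n) j) = (-1) ^ (j - 1) * (of_nat r ^ n)"
      unfolding r using False by (simp add: polyexp_def power_mult_distrib)
    also have "\<dots> \<in> \<int>" by (intro Ints_mult Ints_power) auto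
    finally show ?thesis .
  qed (simp add: polyexp_def)
qed

lemma fps_theta_expm: "fps_theta expm = - fps_X * expm"
  by (rule fps_ext) (simp add: fps_theta_nth expm_def, case_tac n, auto simp: fps_X_mult_nth divide_simps)

lemma polyexp_0: "polyexp 0 = 1 - expm"
  by (rule fps_ext) (simp add: polyexp_def expm_def, case_tac n, auto)

lemma fps_theta_polyexp: "fps_theta (polyexp (Suc n)) = polyexp n"
  by (rule fps_ext) (simp add: fps_theta_nth polyexp_def)

section \<open>Lists of functions forming a triangular system\<close>

definition rat_span :: "rat fps list \<Rightarrow> rat fps set" where
  "rat_span fs = {f. \<exists>a. f = (\<Sum>i<length fs. fps_const (a i) * fs ! i)}"

lemma rat_spanI: "f = (\<Sum>i<length fs. fps_const (a i) * fs ! i) \<Longrightarrow> f \<in> rat_span fs"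
  unfolding rat_span_def by blast

lemma rat_span_zero: "0 \<in> rat_span fs"
  by (rule rat_spanI[where a = "\<lambda>_. 0"]) simp

lemma rat_span_add: "f \<in> rat_span fs \<Longrightarrow> g \<in> rat_span fs \<Longrightarrow> f + g \<in> rat_span fs"
proof -
  assume "f \<in> rat_span fs" "g \<in> rat_span fs"
  then obtain a b where "f = (\<Sum>i<length fs. fps_const (a i) * fs ! i)" "g = (\<Sum>i<length fs. fps_const (b i) * fs ! i)"
    unfolding rat_span_def by blast
  then have "f + g = (\<Sum>i<length fs. fps_const (a i + b i) * fs ! i)"
    by (simp add: sum.distrib distrib_right flip: fps_const_add)
  then show ?thesis by (rule rat_spanI)
qed

lemma rat_span_scale: "f \<in> rat_span fs \<Longrightarrow> fps_const r * f \<in> rat_span fs"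
proof -
  assume "f \<in> rat_span fs"
  then obtain a where "f = (\<Sum>i<length fs. fps_const (a i) * fs ! i)" unfolding rat_span_def by blast
  then have "fps_const r * f = (\<Sum>i<length fs. fps_const (r * a i) * fs ! i)"
    by (simp add: sum_distrib_left mult.assoc flip: fps_const_mult)
  then show ?thesis by (rule rat_spanI)
qed

lemma rat_span_diff: "f \<in> rat_span fs \<Longrightarrow> g \<in> rat_span fs \<Longrightarrow> f - g \<in> rat_span fs"
  using rat_span_add[of f fs "fps_const (-1) * g"] rat_span_scale[of g fs "-1"] by (simp flip: fps_const_neg)

lemma rat_span_sum: "(\<And>i. i \<in> A \<Longrightarrow> f i \<in> rat_span fs) \<Longrightarrow> (\<Sum>i\<in>A. f i) \<in> rat_span fs"
  by (induction A rule: infinite_finite_induct) (auto intro: rat_span_zero rat_span_add)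

lemma rat_span_append: "rat_span fs \<subseteq> rat_span (fs @ [h])"
proof
  fix f assume "f \<in> rat_span fs"
  then obtain a where "f = (\<Sum>i<length fs. fps_const (a i) * fs ! i)" unfolding rat_span_def by blast
  then have "f = (\<Sum>i<length (fs @ [h]). fps_const (if i < length fs then a i else 0) * (fs @ [h]) ! i)"
    by (simp add: nth_append)
  then show "f \<in> rat_span (fs @ [h])" by (rule rat_spanI)
qed

lemma rat_span_last: "h \<in> rat_span (fs @ [h])"
proof -
  have "h = (\<Sum>i<length (fs @ [h]). fps_const (if i < length fs then 0 else 1) * (fs @ [h]) ! i)"
    by (simp add: nth_append)
  then show ?thesis by (rule rat_spanI)
qed

text \<open>A basis built one function at a time. Not lying in the previous span gives independence
  over Q, and starting from 1 supplies the function of value 1 that the determinant argument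
  uses.\<close>

inductive triangular :: "rat fps list \<Rightarrow> bool" where
  triangular_one: "triangular [1]"
| triangular_append: "triangular fs \<Longrightarrow> h \<notin> rat_span fs \<Longrightarrow> E_function h \<Longrightarrow> c \<in> \<int> \<Longrightarrow>
    fps_theta h - fps_const c * (fps_X * h) \<in> rat_span fs \<Longrightarrow> triangular (fs @ [h])"

lemma triangular_basic:
  assumes "triangular fs"
  shows "fs \<noteq> []" "fs ! 0 = 1" "h \<in> set fs \<Longrightarrow> E_function h"
  using assms by (induction) (auto simp: E_function_one nth_append)

lemma triangular_independent:
  assumes "triangular fs"
  shows "\<exists>i<length fs. a i \<noteq> 0 \<Longrightarrow> (\<Sum>i<length fs. fps_const (a i) * fs ! i) \<noteq> 0"
  using assms
proof (induction arbitrary: a)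
  case (triangular_append fs h c)
  let ?n = "length fs"
  have eq: "(\<Sum>i<length (fs @ [h]). fps_const (a i) * (fs @ [h]) ! i) = (\<Sum>i<?n. fps_const (a i) * fs ! i) + fps_const (a ?n) * h"
    by (simp add: nth_append)
  show ?case
  proof (cases "a ?n = 0")
    case True
    then have "\<exists>i<?n. a i \<noteq> 0" using triangular_append.prems by (auto simp: less_Suc_eq)
    then show ?thesis using triangular_append.IH True by (simp add: nth_append)
  next
    case False
    show ?thesis
    proof
      assume 0: "(\<Sum>i<length (fs @ [h]). fps_const (a i) * (fs @ [h]) ! i) = 0"
      define S where "S = (\<Sum>i<?n. fps_const (a i) * fs ! i)"
      have "S \<in> rat_span fs" unfolding S_def by (rule rat_spanI[OF refl])
      then have "fps_const (- 1 / a ?n) * S \<in> rat_span fs" by (rule rat_span_scale)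
      moreover have "S = - (fps_const (a ?n) * h)" using 0 unfolding eq S_def[symmetric] by (simp add: eq_neg_iff_add_eq_0)
      moreover have "fps_const (- 1 / a ?n) * - (fps_const (a ?n) * h) = fps_const (- 1 / a ?n * - a ?n) * h"
        by (simp only: mult_minus_right mult_minus_left fps_const_mult[symmetric] mult.assoc fps_const_neg[symmetric])
      ultimately have "h \<in> rat_span fs" using False by simp
      then show False using triangular_append.hyps by blast
    qed
  qed
qed auto

lemma triangular_system:
  assumes "triangular fs"
  shows "\<exists>c n. triangular_sys (length fs) c n (\<lambda>i. fs ! i) \<and> (\<forall>i. c i \<in> \<int>)"
  using assms
proof induction
  case triangular_one
  have "triangular_sys (length [1]) (\<lambda>_. 0) (\<lambda>_ _. 0) (\<lambda>i. [1] ! i)"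
    by (simp add: triangular_sys_def fps_theta_def)
  then show ?case by (intro exI[of _ "\<lambda>_. 0"] exI[of _ "\<lambda>_ _. 0"]) simp
next
  case (triangular_append fs h c0)
  then obtain c n where IH: "triangular_sys (length fs) c n (\<lambda>i. fs ! i)" "\<And>i. c i \<in> \<int>" by blast
  obtain a where a: "fps_theta h - fps_const c0 * (fps_X * h) = (\<Sum>i<length fs. fps_const (a i) * fs ! i)"
    using triangular_append.hyps unfolding rat_span_def by blast
  then have fh: "fps_theta h = fps_const c0 * (fps_X * h) + (\<Sum>i<length fs. fps_const (a i) * fs ! i)"
    by (simp add: algebra_simps)
  have "triangular_sys (length (fs @ [h])) (c(length fs := c0)) (n(length fs := a)) (\<lambda>i. (fs @ [h]) ! i)"
    unfolding triangular_sys_def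
  proof (intro allI impI)
    fix i assume "i < length (fs @ [h])"
    then consider "i < length fs" | "i = length fs" by fastforce
    then show "fps_theta ((fs @ [h]) ! i) = fps_const ((c(length fs := c0)) i) * (fps_X * (fs @ [h]) ! i) +
        (\<Sum>j<i. fps_const ((n(length fs := a)) i j) * (fs @ [h]) ! j)"
    proof cases
      case 1
      then show ?thesis using IH(1) by (simp add: triangular_sys_def nth_append)
    next
      case 2
      then show ?thesis using fh by (simp add: nth_append)
    qed
  qed
  moreover have "\<forall>i. (c(length fs := c0)) i \<in> \<int>" using IH(2) triangular_append.hyps by simp
  ultimately show ?case by blast
qed

lemma common_denominator:
  "finite A \<Longrightarrow> \<exists>q>0. \<forall>x\<in>A. rat_of_nat q * x \<in> \<int>"
proof (induction rule: finite_induct)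
  case empty
  show ?case by (intro exI[of _ 1]) auto
next
  case (insert x A)
  then obtain q where q: "q > 0" "\<forall>x\<in>A. rat_of_nat q * x \<in> \<int>" by blast
  obtain a b where x: "x = of_int a / of_int b" "b > 0" by (metis quotient_of_div quotient_of_denom_pos surj_pair)
  have "rat_of_nat (q * nat b) * y \<in> \<int>" if "y \<in> insert x A" for y
  proof (cases "y = x")
    case True
    have "rat_of_nat (nat b) * x = of_int a" using x by simp
    then have "rat_of_nat (q * nat b) * y = of_nat q * of_int a" unfolding True of_nat_mult mult.assoc by simp
    then show ?thesis by (simp only: Ints_mult Ints_of_nat Ints_of_int)
  next
    case False
    then have "rat_of_nat q * y \<in> \<int>" using q that by blast
    then have "rat_of_nat (nat b) * (rat_of_nat q * y) \<in> \<int>" by (rule Ints_mult[OF Ints_of_nat])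
    then show ?thesis by (simp add: mult_ac)
  qed
  moreover have "q * nat b > 0" using q x by simp
  ultimately show ?case by blast
qed

theorem triangular_values_independent:
  assumes fs: "triangular fs" and rel: "(\<Sum>i<length fs. of_rat (a i) * fps_value (fs ! i) 1) = 0"
  shows "\<forall>i<length fs. a i = 0"
proof -
  let ?N = "length fs" and ?f = "\<lambda>i. fs ! i"
  obtain c n where cn: "triangular_sys ?N c n ?f" "\<And>i. c i \<in> \<int>" using triangular_system[OF fs] by blast
  \<comment> \<open>Zero out of range, because the locale imposes its bounds on \<open>c\<close> and
    \<open>n\<close> for all indices.\<close>
  define c' where "c' i = (if i < ?N then c i else 0)" for i
  define n' where "n' i j = (if i < ?N \<and> j < ?N then n i j else 0)" for i j
  have sys: "triangular_sys ?N c' n' ?f" using cn(1) by (simp add: triangular_sys_def c'_def n'_def)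
  obtain v where v: "order_bound ?N ?f v" using order_bound_exists[of ?N ?f] triangular_independent[OF fs] by blast
  define B where "B = insert 0 (c' ` {..<?N} \<union> (\<lambda>(i, j). n' i j) ` ({..<?N} \<times> {..<?N}))"
  have finB: "finite B" by (simp add: B_def)
  have cB: "c' i \<in> B" for i by (cases "i < ?N") (auto simp: B_def c'_def)
  have nB: "n' i j \<in> B" for i j
  proof (cases "i < ?N \<and> j < ?N")
    case True
    then have "(\<lambda>(i, j). n' i j) (i, j) \<in> B" unfolding B_def by blast
    then show ?thesis by simp
  qed (auto simp: B_def n'_def)
  obtain q where q: "q > 0" "\<forall>x\<in>B. rat_of_nat q * x \<in> \<int>" using common_denominator[OF finB] by blast
  obtain G where G: "\<forall>x\<in>B. \<bar>x\<bar> \<le> rat_of_nat G"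
  proof -
    obtain G where G: "(\<Sum>x\<in>B. \<bar>x\<bar>) < rat_of_nat G" using reals_Archimedean2 by blast
    have "\<bar>x\<bar> \<le> rat_of_nat G" if "x \<in> B" for x
      using member_le_sum[of x B abs] that finB G by simp
    then show ?thesis using that[of G] by blast
  qed
  have "\<forall>i\<in>{..<?N}. \<exists>C d. C > 0 \<and> (\<forall>k. \<bar>fact k * fps_nth (?f i) k\<bar> \<le> of_nat C ^ Suc k) \<and>
    (\<forall>k. d k > 0 \<and> d k \<le> C ^ Suc k) \<and> (\<forall>k. \<forall>j\<le>k. of_nat (d k) * (fact j * fps_nth (?f i) j) \<in> \<int>)"
    using triangular_basic(3)[OF fs] unfolding E_function_def by simp
  then obtain C d where Cd: "\<And>i. i < ?N \<Longrightarrow> C i > 0"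
    "\<And>i k. i < ?N \<Longrightarrow> \<bar>fact k * fps_nth (?f i) k\<bar> \<le> of_nat (C i) ^ Suc k"
    "\<And>i k. i < ?N \<Longrightarrow> d i k > 0" "\<And>i k. i < ?N \<Longrightarrow> d i k \<le> C i ^ Suc k"
    "\<And>i j k. i < ?N \<Longrightarrow> j \<le> k \<Longrightarrow> of_nat (d i k) * (fact j * fps_nth (?f i) j) \<in> \<int>"
    unfolding bchoice_iff by (metis lessThan_iff)
  \<comment> \<open>Products serve as common data: each \<open>C i\<close> is at most
    \<open>C0\<close>, and each \<open>d i k\<close> divides \<open>d0 k\<close>.\<close>
  define C0 where "C0 = (\<Prod>i<?N. C i)"
  define d0 where "d0 k = (\<Prod>i<?N. d i k)" for k
  have C0: "C0 > 0" using Cd(1) by (auto simp: C0_def intro!: prod_pos)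
  have CC: "C i \<le> C0" if "i < ?N" for i
    using C0 that unfolding C0_def by (intro dvd_imp_le dvd_prodI) auto
  interpret approximation_system ?N c' n' ?f v q G C0 d0
  proof
    show "triangular_sys ?N c' n' ?f" by (rule sys)
    show "order_bound ?N ?f v" by (rule v)
    show "0 < ?N" using triangular_basic(1)[OF fs] by simp
    show "of_nat q * c' i \<in> \<int>" "of_nat q * n' i j \<in> \<int>" "\<bar>c' i\<bar> \<le> of_nat G" "\<bar>n' i j\<bar> \<le> of_nat G" for i j
      using q(2) G cB nB by blast+
    show "\<bar>fact k * fps_nth (?f i) k\<bar> \<le> of_nat C0 ^ Suc k" if "i < ?N" for i k
      using CC[OF that] by (intro order_trans[OF Cd(2)[OF that]] power_mono) auto
    show "0 < d0 k" for k using Cd(3) by (auto simp: d0_def intro!: prod_pos)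
    show "d0 k \<le> C0 ^ Suc k" for k
      unfolding d0_def C0_def prod_power_distrib using Cd(4) by (intro prod_mono) auto
    show "of_nat (d0 k) * (fact j * fps_nth (?f i) j) \<in> \<int>" if "i < ?N" "j \<le> k" for i j k
    proof -
      have "d i k dvd d0 k" using that(1) unfolding d0_def by (intro dvd_prodI) auto
      then obtain r where "d0 k = r * d i k" by (metis dvdE mult.commute)
      then have "of_nat (d0 k) * (fact j * fps_nth (?f i) j) = of_nat r * (of_nat (d i k) * (fact j * fps_nth (?f i) j))"
        by simp
      also have "\<dots> \<in> \<int>" by (rule Ints_mult[OF Ints_of_nat Cd(5)[OF that]])
      finally show ?thesis .
    qed
  qed (use q C0 in auto)
  obtain Q where Q: "Q > 0" "\<forall>x\<in>a ` {..<?N}. rat_of_nat Q * x \<in> \<int>"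
    using common_denominator[of "a ` {..<?N}"] by auto
  define b where "b i = \<lfloor>of_nat Q * a i\<rfloor>" for i
  have b: "of_int (b i) = rat_of_nat Q * a i" if "i < ?N" for i
    using Q(2) that unfolding b_def by (metis Ints_cases floor_of_int image_eqI lessThan_iff)
  have "(\<Sum>j<?N. of_int (b j) * fps_value (?f j) 1) = (\<Sum>j<?N. real Q * (of_rat (a j) * fps_value (?f j) 1))"
  proof (intro sum.cong refl)
    fix j assume "j \<in> {..<?N}"
    then have "real_of_int (b j) = of_rat (rat_of_nat Q * a j)" using b[of j] by (metis lessThan_iff of_rat_of_int_eq)
    then show "real_of_int (b j) * fps_value (?f j) 1 = real Q * (of_rat (a j) * fps_value (?f j) 1)" by (simp add: of_rat_mult)
  qed
  also have "\<dots> = 0" using rel by (simp flip: sum_distrib_left)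
  finally have "\<forall>j<?N. b j = 0" using triangular_basic(2)[OF fs] by (intro values_independent) auto
  then show ?thesis using b Q(1) by fastforce
qed

section \<open>Monomials in the exponential and polylogarithmic functions\<close>

text \<open>The new functions have derivatives in the old span up to the diagonal term, so they can
  be appended in any order; those already in the span are skipped.\<close>

lemma triangular_extend:
  assumes "finite H" "triangular fs" "\<And>h. h \<in> H \<Longrightarrow> E_function h"
    "\<And>h. h \<in> H \<Longrightarrow> \<exists>c\<in>\<int>. fps_theta h - fps_const c * (fps_X * h) \<in> rat_span fs"
  shows "\<exists>fs'. triangular fs' \<and> rat_span fs \<subseteq> rat_span fs' \<and> H \<subseteq> rat_span fs'"
  using assms
proof (induction H rule: finite_induct)
  case empty
  then show ?case by blast
next
  case (insert h H)
  then obtain fs' where fs': "triangular fs'" "rat_span fs \<subseteq> rat_span fs'" "H \<subseteq> rat_span fs'" by blast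
  show ?case
  proof (cases "h \<in> rat_span fs'")
    case True
    then show ?thesis using fs' by blast
  next
    case False
    obtain c where c: "c \<in> \<int>" "fps_theta h - fps_const c * (fps_X * h) \<in> rat_span fs" using insert.prems by blast
    then have "triangular (fs' @ [h])" using fs' False insert.prems by (intro triangular_append[of _ _ c]) auto
    then show ?thesis using fs' rat_span_append[of fs' h] rat_span_last[of h fs'] by blast
  qed
qed

definition monomial :: "nat \<Rightarrow> nat list \<Rightarrow> rat fps" where
  "monomial a l = expm ^ a * prod_list (map polyexp l)"

lemma E_function_monomial: "E_function (monomial a l)"
proof -
  have "E_function (prod_list (map polyexp l))"
    by (induction l) (auto simp: E_function_one E_function_mult E_function_polyexp)
  then show ?thesis unfolding monomial_def by (intro E_function_mult E_function_power E_function_expm)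
qed

lemma fps_theta_expm_power: "fps_theta (expm ^ a) = fps_const (- of_nat a) * (fps_X * expm ^ a)"
proof (induction a)
  case 0
  then show ?case by (simp add: fps_theta_def)
next
  case (Suc a)
  have "fps_const (- of_nat (Suc a) :: rat) = - 1 + fps_const (- of_nat a)"
    by (simp add: fps_eq_iff)
  then show ?case by (simp only: power_Suc fps_theta_mult fps_theta_expm Suc) (simp add: algebra_simps)
qed

text \<open>The weight is the sum of the indices. \<open>D\<close> also counts factors
  \<open>expm\<close>, so replacing \<open>polyexp 1\<close> by 1 - \<open>expm\<close> lowers the
  weight without raising the total degree.\<close>

definition weighted_monomials :: "nat \<Rightarrow> nat \<Rightarrow> nat \<Rightarrow> rat fps set" where
  "weighted_monomials D n w = (\<lambda>(a, l). monomial a l) `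
    {(a, l). a + length l \<le> D \<and> set l \<subseteq> {1..n} \<and> sum_list l \<le> w}"

lemma weighted_monomialsI:
  "a + length l \<le> D \<Longrightarrow> set l \<subseteq> {1..n} \<Longrightarrow> sum_list l \<le> w \<Longrightarrow> monomial a l \<in> weighted_monomials D n w"
  unfolding weighted_monomials_def by (intro image_eqI[of _ _ "(a, l)"]) auto

lemma finite_weighted_monomials: "finite (weighted_monomials D n w)"
proof -
  have "{(a, l). a + length l \<le> D \<and> set l \<subseteq> {1..n} \<and> sum_list l \<le> w}
      \<subseteq> {..D} \<times> {l. set l \<subseteq> {1..n} \<and> length l \<le> D}" by auto
  then show ?thesis unfolding weighted_monomials_def
    by (intro finite_imageI finite_subset[OF _ finite_cartesian_product[OF _ finite_lists_length_le]]) auto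
qed

text \<open>\<open>\<theta>\<close> lowers the weight of every factor \<open>polyexp k\<close>, and replaces \<open>polyexp 1\<close> by \<open>1 - expm\<close>.\<close>
lemma fps_theta_prod_polyexp:
  assumes W: "weighted_monomials D n w \<subseteq> rat_span fs"
    and "a + length l1 + length l \<le> D" "set l1 \<subseteq> {1..n}" "set l \<subseteq> {1..n}" "sum_list l1 + sum_list l \<le> Suc w"
  shows "monomial a l1 * fps_theta (prod_list (map polyexp l)) \<in> rat_span fs"
  using assms(2-)
\<comment> \<open>\<open>l1\<close> holds the factors that the product rule has already
  passed.\<close>
proof (induction l arbitrary: l1)
  case Nil
  then show ?case using rat_span_zero by (simp add: fps_theta_def)
next
  case (Cons k l)
  have k: "k \<ge> 1" "k \<le> n" using Cons.prems by auto
  have "monomial a l1 * fps_theta (prod_list (map polyexp (k # l))) =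
      monomial a l1 * fps_theta (polyexp k) * prod_list (map polyexp l) + monomial a (l1 @ [k]) * fps_theta (prod_list (map polyexp l))"
    by (simp add: fps_theta_mult monomial_def algebra_simps)
  moreover have "monomial a (l1 @ [k]) * fps_theta (prod_list (map polyexp l)) \<in> rat_span fs"
    using Cons.prems k by (intro Cons.IH) auto
  moreover have "monomial a l1 * fps_theta (polyexp k) * prod_list (map polyexp l) \<in> rat_span fs"
  proof (cases "k = 1")
    case True
    have e: "fps_theta (polyexp k) = 1 - expm" using fps_theta_polyexp[of 0] True by (simp add: polyexp_0)
    have "monomial a l1 * fps_theta (polyexp k) * prod_list (map polyexp l) = monomial a (l1 @ l) - monomial (Suc a) (l1 @ l)"
      unfolding e by (simp add: monomial_def algebra_simps)
    also have "\<dots> \<in> rat_span fs"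
      using Cons.prems True by (intro rat_span_diff subsetD[OF W] weighted_monomialsI) auto
    finally show ?thesis .
  next
    case False
    then obtain k' where k': "k = Suc k'" "k' \<ge> 1" using k by (cases k) auto
    have "monomial a l1 * fps_theta (polyexp k) * prod_list (map polyexp l) = monomial a (l1 @ k' # l)"
      by (simp add: k' fps_theta_polyexp monomial_def algebra_simps)
    also have "\<dots> \<in> rat_span fs"
      using Cons.prems k' by (intro subsetD[OF W] weighted_monomialsI) auto
    finally show ?thesis .
  qed
  ultimately show ?case by (simp add: rat_span_add)
qed

text \<open>For h of weight at most w + 1, theta h + a z h is a combination of monomials of weight
  at most w, so h can extend a list spanning those. Weight 0 consists of the powers of
  \<open>expm\<close>.\<close>

lemma monomials_in_triangular:
  "\<exists>fs. triangular fs \<and> weighted_monomials D n w \<subseteq> rat_span fs"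
proof (induction w)
  case 0
  have "\<exists>fs'. triangular fs' \<and> rat_span [1] \<subseteq> rat_span fs' \<and> weighted_monomials D n 0 \<subseteq> rat_span fs'"
  proof (rule triangular_extend[OF finite_weighted_monomials triangular_one])
    fix h assume "h \<in> weighted_monomials D n 0"
    then obtain a l where h: "h = monomial a l" "set l \<subseteq> {1..n}" "sum_list l = 0"
      unfolding weighted_monomials_def by auto
    then have "l = []" by (cases l) auto
    then have h: "h = expm ^ a" using h by (simp add: monomial_def)
    show "E_function h" unfolding h by (intro E_function_power E_function_expm)
    show "\<exists>c\<in>\<int>. fps_theta h - fps_const c * (fps_X * h) \<in> rat_span [1]"
      unfolding h fps_theta_expm_power by (intro bexI[of _ "- of_nat a"]) (auto simp: rat_span_zero)
  qed
  then show ?case by blast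
next
  case (Suc w)
  then obtain fs where fs: "triangular fs" "weighted_monomials D n w \<subseteq> rat_span fs" by blast
  have "\<exists>fs'. triangular fs' \<and> rat_span fs \<subseteq> rat_span fs' \<and> weighted_monomials D n (Suc w) \<subseteq> rat_span fs'"
  proof (rule triangular_extend[OF finite_weighted_monomials fs(1)])
    fix h assume "h \<in> weighted_monomials D n (Suc w)"
    then obtain a l where h: "h = monomial a l" "a + length l \<le> D" "set l \<subseteq> {1..n}" "sum_list l \<le> Suc w"
      unfolding weighted_monomials_def by auto
    show "E_function h" unfolding h by (rule E_function_monomial)
    have "fps_theta h = fps_const (- of_nat a) * (fps_X * h) + monomial a [] * fps_theta (prod_list (map polyexp l))"
      unfolding h(1) monomial_def fps_theta_mult fps_theta_expm_power by (simp add: mult_ac)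
    then have "fps_theta h - fps_const (- of_nat a) * (fps_X * h) = monomial a [] * fps_theta (prod_list (map polyexp l))"
      by simp
    also have "\<dots> \<in> rat_span fs" using h by (intro fps_theta_prod_polyexp[OF fs(2)]) auto
    finally show "\<exists>c\<in>\<int>. fps_theta h - fps_const c * (fps_X * h) \<in> rat_span fs"
      by (intro bexI[of _ "- of_nat a"]) auto
  qed
  then show ?case by blast
qed

section \<open>Values at real points and growth along the negative axis\<close>

lemma abs_conv_E_function: "E_function f \<Longrightarrow> abs_conv f x"
  unfolding E_function_def using abs_conv_of_coeff_bound by blast

lemma fps_value_power: "E_function f \<Longrightarrow> fps_value (f ^ k) x = fps_value f x ^ k"
  using fps_value_const[of 1 x] by (induction k) (auto simp: fps_value_mult abs_conv_E_function E_function_power)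

lemma fps_value_expm: "fps_value expm x = exp (- x)"
proof -
  have "(\<lambda>k. (- x) ^ k /\<^sub>R fact k) sums exp (- x)" by (rule exp_converges)
  moreover have "(- x) ^ k /\<^sub>R fact k = of_rat (fps_nth expm k) * x ^ k" for k
    by (simp add: expm_def of_rat_divide of_rat_power of_rat_fact of_rat_minus of_rat_mult of_rat_inverse divide_inverse power_minus[of x])
  ultimately show ?thesis unfolding fps_value_def by (simp add: sums_iff)
qed

text \<open>This is -y_n(-t), whose Taylor coefficients are all nonnegative, so for t > 0 it can be
  estimated termwise.\<close>

definition neg_polyexp :: "nat \<Rightarrow> real \<Rightarrow> real" where
  "neg_polyexp n t = (\<Sum>j. t ^ Suc j / (fact (Suc j) * real (Suc j) ^ n))"

lemma polyexp_neg_sums: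
  "(\<lambda>j. t ^ Suc j / (fact (Suc j) * real (Suc j) ^ n)) sums (- fps_value (polyexp n) (- t))"
proof -
  let ?u = "\<lambda>k. of_rat (fps_nth (polyexp n) k) * (- t) ^ k :: real"
  have "summable ?u" using abs_conv_E_function[OF E_function_polyexp, of n "- t"] unfolding abs_conv_def by (rule summable_rabs_cancel)
  then have "?u sums fps_value (polyexp n) (- t)" unfolding fps_value_def by (rule summable_sums)
  then have "(\<lambda>k. - ?u (Suc k)) sums - fps_value (polyexp n) (- t)"
    using sums_Suc_iff[of ?u] by (intro sums_minus) (simp add: polyexp_def)
  moreover have "- ?u (Suc k) = t ^ Suc k / (fact (Suc k) * real (Suc k) ^ n)" for k
  proof -
    have a: "of_rat (fps_nth (polyexp n) (Suc k)) = ((- 1) ^ k / (fact (Suc k) * real (Suc k) ^ n) :: real)"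
      by (simp add: polyexp_def of_rat_divide of_rat_mult of_rat_power of_rat_fact of_rat_minus
            del: fact_Suc of_nat_Suc)
    have "- ((- 1) ^ k * (- t) ^ Suc k) = t ^ Suc k"
      by (cases "even k") simp_all
    then have "- ((- 1) ^ k * (- t) ^ Suc k) / (fact (Suc k) * real (Suc k) ^ n) = t ^ Suc k / (fact (Suc k) * real (Suc k) ^ n)"
      by (rule arg_cong)
    then show ?thesis unfolding a by (simp only: times_divide_eq_left minus_divide_left)
  qed
  ultimately show ?thesis by (simp only:)
qed

lemma neg_polyexp_sums: "(\<lambda>j. t ^ Suc j / (fact (Suc j) * real (Suc j) ^ n)) sums neg_polyexp n t"
  using polyexp_neg_sums[of t n] unfolding neg_polyexp_def by (simp add: sums_iff del: fact_Suc of_nat_Suc power_Suc)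

lemma fps_value_polyexp_neg: "fps_value (polyexp n) (- t) = - neg_polyexp n t"
  using sums_unique2[OF polyexp_neg_sums[of t n] neg_polyexp_sums[of t n]] by simp

lemma exp_shift_sums: "(\<lambda>j. (t::real) ^ (j + m) / fact (j + m)) sums (exp t - (\<Sum>i<m. t ^ i / fact i))"
proof -
  have "(\<lambda>k. t ^ k / fact k) sums exp t"
    using exp_converges[of t] by (simp add: divide_inverse mult.commute)
  then show ?thesis using sums_iff_shift[of "\<lambda>k. t ^ k / fact k" m] by simp
qed

text \<open>Termwise, (j + 2)! <= 2 (j + 1)! (j + 1)^n; the comparison series is 2/t times a tail of
  the exponential series.\<close>

lemma neg_polyexp_upper:
  assumes "n \<ge> 1" "t > 0"
  shows "neg_polyexp n t \<le> 2 / t * exp t"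
proof -
  have A: "(\<lambda>j. 2 / t * (t ^ (j + 2) / fact (j + 2))) sums (2 / t * (exp t - (\<Sum>i<2. t ^ i / fact i)))"
    by (intro sums_mult exp_shift_sums)
  have le: "t ^ Suc j / (fact (Suc j) * real (Suc j) ^ n) \<le> 2 / t * (t ^ (j + 2) / fact (j + 2))" for j
  proof -
    have "real (Suc j) \<le> real (Suc j) ^ n" using power_increasing[of 1 n "real (Suc j)"] assms by simp
    then have "fact (Suc j) * (2 * real (Suc j)) \<le> fact (Suc j) * (2 * real (Suc j) ^ n)" by (intro mult_left_mono) auto
    moreover have "fact (j + 2) = (fact (Suc j) * real (j + 2) :: real)" by simp
    moreover have "real (j + 2) \<le> 2 * real (Suc j)" by simp
    then have "fact (Suc j) * real (j + 2) \<le> (fact (Suc j) * (2 * real (Suc j)) :: real)" by (intro mult_left_mono) auto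
    ultimately have le: "fact (j + 2) \<le> (fact (Suc j) * (2 * real (Suc j) ^ n) :: real)" by linarith
    have "t ^ Suc j / (fact (Suc j) * real (Suc j) ^ n) = 2 * t ^ Suc j / (fact (Suc j) * (2 * real (Suc j) ^ n))" by simp
    also have "\<dots> \<le> 2 * t ^ Suc j / fact (j + 2)" using le assms by (intro divide_left_mono) auto
    also have "\<dots> = 2 / t * (t ^ (j + 2) / fact (j + 2))" using assms by (simp add: field_simps)
    finally show ?thesis .
  qed
  have "neg_polyexp n t \<le> 2 / t * (exp t - (\<Sum>i<2. t ^ i / fact i))" by (rule sums_le[OF le neg_polyexp_sums A])
  also have "\<dots> \<le> 2 / t * exp t" using assms by (intro mult_left_mono) (auto simp: sum_nonneg)
  finally show ?thesis .
qed

text \<open>Termwise, (j + 1)! (j + 1)^n <= (j + 1 + n)!; the comparison series is t^(-n) times a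
  tail of the exponential series.\<close>

lemma neg_polyexp_lower:
  assumes "t > 0"
  shows "(exp t - (\<Sum>i<Suc n. t ^ i / fact i)) / t ^ n \<le> neg_polyexp n t"
proof -
  have A: "(\<lambda>j. t ^ (j + Suc n) / fact (j + Suc n) / t ^ n) sums ((exp t - (\<Sum>i<Suc n. t ^ i / fact i)) / t ^ n)"
    by (intro sums_divide exp_shift_sums)
  have le: "t ^ (j + Suc n) / fact (j + Suc n) / t ^ n \<le> t ^ Suc j / (fact (Suc j) * real (Suc j) ^ n)" for j
  proof -
    have "fact (Suc j) * real (Suc j) ^ n \<le> fact (j + Suc n)"
    proof (induction n)
      case (Suc n)
      have "fact (Suc j) * real (Suc j) ^ n * real (Suc j) \<le> fact (j + Suc n) * real (j + Suc (Suc n))"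
        using Suc by (intro mult_mono) auto
      also have "\<dots> = fact (j + Suc (Suc n))" by (simp add: mult.commute)
      finally show ?case by (simp add: mult_ac)
    qed simp
    then have "t ^ Suc j / fact (j + Suc n) \<le> t ^ Suc j / (fact (Suc j) * real (Suc j) ^ n)"
      using assms by (intro divide_left_mono) auto
    then show ?thesis using assms by (simp add: power_add)
  qed
  show ?thesis by (rule sums_le[OF le A neg_polyexp_sums])
qed

lemma neg_polyexp_over_exp_tendsto:
  assumes "n \<ge> 1"
  shows "((\<lambda>t. neg_polyexp n t / exp t) \<longlongrightarrow> 0) at_top"
proof (rule tendsto_sandwich)
  show "\<forall>\<^sub>F t in at_top. 0 \<le> neg_polyexp n t / exp t"
    using eventually_gt_at_top[of 0]
  proof eventually_elim
    case (elim t)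
    have "0 \<le> neg_polyexp n t" unfolding neg_polyexp_def using elim neg_polyexp_sums[of t n] by (intro suminf_nonneg) (auto simp: sums_iff)
    then show ?case by simp
  qed
  show "\<forall>\<^sub>F t in at_top. neg_polyexp n t / exp t \<le> 2 / t"
    using eventually_gt_at_top[of 0]
    by eventually_elim (use neg_polyexp_upper[OF assms] in \<open>auto simp: divide_le_eq\<close>)
  show "((\<lambda>t::real. 2 / t) \<longlongrightarrow> 0) at_top"
    by (intro tendsto_divide_0[OF tendsto_const] filterlim_at_top_imp_at_infinity filterlim_ident)
qed simp

lemma neg_polyexp_lower_eventually:
  "\<forall>\<^sub>F t in at_top. neg_polyexp n t / exp t > 0 \<and> inverse (neg_polyexp n t / exp t) \<le> 2 * t ^ n"
proof -
  have "((\<lambda>t::real. \<Sum>i<Suc n. (t ^ i / exp t) / fact i) \<longlongrightarrow> (\<Sum>i<Suc n. 0 / fact i)) at_top"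
    by (intro tendsto_sum tendsto_divide[OF tendsto_power_div_exp_0 tendsto_const]) auto
  then have "\<forall>\<^sub>F t in at_top. (\<Sum>i<Suc n. (t ^ i / exp t) / fact i) < 1 / (2::real)"
    by (intro order_tendstoD(2)) auto
  then show ?thesis using eventually_gt_at_top[of 0]
  proof eventually_elim
    case (elim t)
    have "(\<Sum>i<Suc n. t ^ i / fact i) = exp t * (\<Sum>i<Suc n. (t ^ i / exp t) / fact i)"
      unfolding sum_distrib_left by (intro sum.cong refl) simp
    also have "\<dots> \<le> exp t * (1 / 2)" using elim by (intro mult_left_mono) auto
    finally have "exp t / 2 \<le> exp t - (\<Sum>i<Suc n. t ^ i / fact i)" by simp
    then have "exp t / 2 / t ^ n \<le> (exp t - (\<Sum>i<Suc n. t ^ i / fact i)) / t ^ n"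
      using elim by (intro divide_right_mono) auto
    also have "\<dots> \<le> neg_polyexp n t" using elim by (intro neg_polyexp_lower) auto
    finally have neg_polyexp: "exp t / 2 / t ^ n \<le> neg_polyexp n t" .
    have pos: "0 < exp t / 2 / t ^ n" using elim by simp
    have Y0: "0 < neg_polyexp n t" using neg_polyexp pos by linarith
    have "inverse (neg_polyexp n t / exp t) = exp t / neg_polyexp n t" by simp
    also have "\<dots> \<le> exp t / (exp t / 2 / t ^ n)"
      by (rule divide_left_mono[OF neg_polyexp _ mult_pos_pos[OF Y0 pos]]) simp
    also have "\<dots> = 2 * t ^ n" by simp
    finally show ?case using Y0 by simp
  qed
qed

section \<open>Passage to algebraic coefficients\<close>

text \<open>As \<open>t\<close> tends to infinity, \<open>neg_polyexp n t / exp t\<close> tends to 0, but only polynomially fast. So among the terms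
  of a relation at \<open>-t\<close> the ones of maximal total degree, and among those the one of minimal degree
  in \<open>polyexp n\<close>, dominates.\<close>
lemma expm_polyexp_independent:
  assumes n: "n \<ge> 1" and I: "finite I" and p: "p \<in> I" "c p \<noteq> 0"
  shows "(\<Sum>(a, b)\<in>I. fps_const (c (a, b)) * (expm ^ a * polyexp n ^ b)) \<noteq> 0"
proof
  assume 0: "(\<Sum>(a, b)\<in>I. fps_const (c (a, b)) * (expm ^ a * polyexp n ^ b)) = 0"
  define J where "J = {p \<in> I. c p \<noteq> 0}"
  have finJ: "finite J" using I by (simp add: J_def)
  have "p \<in> J" using p by (simp add: J_def)
  define d where "d = Max ((\<lambda>(a, b). a + b) ` J)"
  have d_ge: "a + b \<le> d" if "(a, b) \<in> J" for a b
    unfolding d_def using that finJ by (intro Max_ge) (auto intro!: image_eqI[of _ _ "(a, b)"])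
  have "d \<in> (\<lambda>(a, b). a + b) ` J" unfolding d_def using finJ \<open>p \<in> J\<close> by (intro Max_in) auto
  then obtain a1 b1 where ab1: "(a1, b1) \<in> J" "a1 + b1 = d" by auto
  \<comment> \<open>The guard \<open>b \<le> d\<close> rules out truncation in d - b.\<close>
  define b0 where "b0 = (LEAST b. b \<le> d \<and> (d - b, b) \<in> J)"
  have ex: "b1 \<le> d \<and> (d - b1, b1) \<in> J" using ab1 by auto
  have b0: "b0 \<le> d" "(d - b0, b0) \<in> J" using LeastI[where P = "\<lambda>b. b \<le> d \<and> (d - b, b) \<in> J", OF ex] unfolding b0_def by auto
  have b0_le: "b0 \<le> b" if "(a, b) \<in> J" "a + b = d" for a b
  proof -
    have "b \<le> d \<and> (d - b, b) \<in> J" using that by auto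
    then show ?thesis unfolding b0_def by (rule Least_le)
  qed
  define \<gamma> where "\<gamma> p = (of_rat (c p) * (- 1) ^ snd p :: real)" for p
  define u where "u t = neg_polyexp n t / exp t" for t
  \<comment> \<open>Each term divided by the presumed leading one. The limit is 1 for the latter and
    0 for all others, so a relation would make the leading coefficient 0.\<close>
  define g where "g p t = exp t ^ (fst p + snd p) / exp t ^ d * (u t ^ snd p / u t ^ b0)" for p :: "nat \<times> nat" and t :: real
  have u_lim: "(u \<longlongrightarrow> 0) at_top" unfolding u_def by (rule neg_polyexp_over_exp_tendsto[OF n])
  have u_ev: "\<forall>\<^sub>F t in at_top. u t > 0 \<and> inverse (u t) \<le> 2 * t ^ n" unfolding u_def by (rule neg_polyexp_lower_eventually)
  have rel: "(\<Sum>p\<in>J. \<gamma> p * (exp t ^ (fst p + snd p) * u t ^ snd p)) = 0" for t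
  proof -
    have cv: "abs_conv (fps_const (c (a, b)) * (expm ^ a * polyexp n ^ b)) x" "abs_conv (expm ^ a * polyexp n ^ b) x" for a b x
      by (intro abs_conv_mult abs_conv_const abs_conv_E_function E_function_power E_function_expm E_function_polyexp)+
    have tm: "fps_value (fps_const (c (a, b)) * (expm ^ a * polyexp n ^ b)) (- t) = \<gamma> (a, b) * (exp t ^ (a + b) * u t ^ b)" for a b
    proof -
      have "fps_value (fps_const (c (a, b)) * (expm ^ a * polyexp n ^ b)) (- t) = of_rat (c (a, b)) * (exp t ^ a * (- neg_polyexp n t) ^ b)"
        by (subst fps_value_mult[OF abs_conv_const cv(2)], subst fps_value_mult)
           (auto simp: fps_value_const fps_value_power E_function_expm E_function_polyexp fps_value_expm fps_value_polyexp_neg abs_conv_E_function E_function_power)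
      also have "- neg_polyexp n t = (- 1) * (u t * exp t)" by (simp add: u_def)
      finally show ?thesis unfolding power_mult_distrib by (simp add: \<gamma>_def power_add)
    qed
    have "0 = fps_value (\<Sum>p\<in>I. case p of (a, b) \<Rightarrow> fps_const (c (a, b)) * (expm ^ a * polyexp n ^ b)) (- t)"
      using 0 fps_value_const[of 0 "- t"] by simp
    also have "\<dots> = (\<Sum>p\<in>I. \<gamma> p * (exp t ^ (fst p + snd p) * u t ^ snd p))"
      by (subst fps_value_sum) (auto simp: cv tm intro!: sum.cong)
    also have "\<dots> = (\<Sum>p\<in>J. \<gamma> p * (exp t ^ (fst p + snd p) * u t ^ snd p))"
      using I by (intro sum.mono_neutral_right) (auto simp: J_def \<gamma>_def)
    finally show ?thesis by simp
  qed
  have "\<forall>\<^sub>F t in at_top. (\<Sum>p\<in>J. \<gamma> p * g p t) = 0"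
    using u_ev
  proof eventually_elim
    case (elim t)
    have "(\<Sum>p\<in>J. \<gamma> p * g p t) = (\<Sum>p\<in>J. \<gamma> p * (exp t ^ (fst p + snd p) * u t ^ snd p)) / (exp t ^ d * u t ^ b0)"
      unfolding sum_divide_distrib g_def by (intro sum.cong refl) simp
    then show ?case using rel[of t] by simp
  qed
  then have lim0: "((\<lambda>t. \<Sum>p\<in>J. \<gamma> p * g p t) \<longlongrightarrow> 0) at_top" by (rule tendsto_eventually)
  have "(g p \<longlongrightarrow> (if p = (d - b0, b0) then 1 else 0)) at_top" if "p \<in> J" for p
  proof -
    obtain a b where ab: "p = (a, b)" by (cases p)
    have le: "a + b \<le> d" using d_ge that ab by simp
    have ge: "b0 \<le> b" if "a + b = d" using b0_le[OF _ that] \<open>p \<in> J\<close> ab by simp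
    consider "p = (d - b0, b0)" | "a + b = d" "b > b0" | "a + b < d"
    proof (cases "a + b = d")
      case True
      then show ?thesis using ge[OF True] that(1,2) ab by (cases "b = b0") auto
    next
      case False
      then show ?thesis using le that(3) by linarith
    qed
    then show ?thesis
    proof cases
      case 1
      have "\<forall>\<^sub>F t in at_top. g p t = 1"
        using u_ev by eventually_elim (use b0(1) in \<open>simp add: g_def 1\<close>)
      then show ?thesis using 1 by (simp add: tendsto_eventually)
    next
      case 2
      have "\<forall>\<^sub>F t in at_top. u t ^ (b - b0) = g p t"
        using u_ev by eventually_elim (use 2 in \<open>simp add: g_def ab power_diff\<close>)
      moreover have "((\<lambda>t. u t ^ (b - b0)) \<longlongrightarrow> 0 ^ (b - b0)) at_top" by (intro tendsto_power u_lim)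
      ultimately have "(g p \<longlongrightarrow> 0 ^ (b - b0)) at_top" by (rule Lim_transform_eventually[rotated])
      then show ?thesis using 2 ab by (simp add: zero_power)
    next
      case 3
      have "(g p \<longlongrightarrow> 0) at_top"
      proof (rule tendsto_sandwich)
        show "\<forall>\<^sub>F t in at_top. 0 \<le> g p t"
          using u_ev by eventually_elim (simp add: g_def)
        \<comment> \<open>The missing total degree leaves a factor e^(-t), which outweighs the
          polynomial bound on 1/u^b0.\<close>
        show "\<forall>\<^sub>F t in at_top. g p t \<le> u t ^ b * (2 ^ b0 * (t ^ (n * b0) / exp t))"
          using u_ev eventually_gt_at_top[of 0]
        proof eventually_elim
          case (elim t)
          have "exp t ^ (a + b) / exp t ^ d = inverse (exp t ^ (d - (a + b)))"
            using 3 by (simp add: power_diff divide_simps)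
          also have "\<dots> \<le> inverse (exp t ^ 1)"
            using 3 elim by (intro le_imp_inverse_le power_increasing) auto
          finally have 1: "exp t ^ (a + b) / exp t ^ d \<le> inverse (exp t)" by simp
          have "inverse (u t) ^ b0 \<le> (2 * t ^ n) ^ b0" using elim by (intro power_mono) auto
          then have 2: "inverse (u t) ^ b0 \<le> 2 ^ b0 * t ^ (n * b0)" by (simp add: power_mult_distrib power_mult)
          have "g p t = (exp t ^ (a + b) / exp t ^ d) * (u t ^ b * inverse (u t) ^ b0)"
            by (simp add: g_def ab power_inverse divide_inverse)
          also have "\<dots> \<le> inverse (exp t) * (u t ^ b * (2 ^ b0 * t ^ (n * b0)))"
            using elim by (intro mult_mono 1 2 order_refl) auto
          finally show ?case by (simp add: divide_inverse mult_ac)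
        qed
        have "((\<lambda>t. u t ^ b * (2 ^ b0 * (t ^ (n * b0) / exp t))) \<longlongrightarrow> 0 ^ b * (2 ^ b0 * 0)) at_top"
          by (intro tendsto_mult tendsto_power u_lim tendsto_const tendsto_power_div_exp_0)
        then show "((\<lambda>t. u t ^ b * (2 ^ b0 * (t ^ (n * b0) / exp t))) \<longlongrightarrow> 0) at_top" by simp
      qed simp
      then show ?thesis using 3 ab b0(1) by auto
    qed
  qed
  then have "((\<lambda>t. \<Sum>p\<in>J. \<gamma> p * g p t) \<longlongrightarrow> (\<Sum>p\<in>J. \<gamma> p * (if p = (d - b0, b0) then 1 else 0))) at_top"
    by (intro tendsto_sum tendsto_mult tendsto_const)
  then have "(\<Sum>p\<in>J. \<gamma> p * (if p = (d - b0, b0) then 1 else 0)) = 0"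
    using lim0 tendsto_unique trivial_limit_at_top_linorder by blast
  moreover have "(\<Sum>p\<in>J. \<gamma> p * (if p = (d - b0, b0) then 1 else 0)) = \<gamma> (d - b0, b0)"
    using finJ b0(2) by (simp add: if_distrib[of "\<lambda>x. _ * x"] sum.delta' cong: if_cong)
  ultimately show False using b0(2) by (simp add: \<gamma>_def J_def)
qed

section \<open>Rational linear algebra among real numbers\<close>

definition real_rat_span :: "real set \<Rightarrow> real set" where
  "real_rat_span B = {x. \<exists>c. x = (\<Sum>g\<in>B. of_rat (c g) * g)}"

lemma real_rat_span_add: "x \<in> real_rat_span B \<Longrightarrow> y \<in> real_rat_span B \<Longrightarrow> x + y \<in> real_rat_span B"
  unfolding real_rat_span_def
proof clarify
  fix c c'
  show "\<exists>c''. (\<Sum>g\<in>B. of_rat (c g) * g) + (\<Sum>g\<in>B. of_rat (c' g) * g) = (\<Sum>g\<in>B. of_rat (c'' g) * g)"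
    by (intro exI[of _ "\<lambda>g. c g + c' g"]) (simp add: of_rat_add distrib_right sum.distrib)
qed

lemma real_rat_span_scale: "x \<in> real_rat_span B \<Longrightarrow> of_rat r * x \<in> real_rat_span B"
  unfolding real_rat_span_def
proof clarify
  fix c
  show "\<exists>c'. of_rat r * (\<Sum>g\<in>B. of_rat (c g) * g) = (\<Sum>g\<in>B. of_rat (c' g) * g)"
    by (intro exI[of _ "\<lambda>g. r * c g"]) (simp add: of_rat_mult sum_distrib_left mult.assoc)
qed

lemma real_rat_span_sum: "(\<And>i. i \<in> A \<Longrightarrow> f i \<in> real_rat_span B) \<Longrightarrow> (\<Sum>i\<in>A. f i) \<in> real_rat_span B"
proof (induction A rule: infinite_finite_induct)
  case empty
  show ?case unfolding real_rat_span_def by (auto intro!: exI[of _ "\<lambda>_. 0"])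
next
  case (infinite A)
  then show ?case unfolding real_rat_span_def by (auto intro!: exI[of _ "\<lambda>_. 0"])
qed (auto intro: real_rat_span_add)

lemma real_rat_span_base: "finite B \<Longrightarrow> x \<in> B \<Longrightarrow> x \<in> real_rat_span B"
  unfolding real_rat_span_def
  by (auto intro!: exI[of _ "\<lambda>g. if g = x then 1 else 0"] simp: if_distrib[of of_rat] if_distrib[of "\<lambda>y. y * _"] sum.delta cong: if_cong)

lemma rational_dependence:
  assumes "finite B" "finite I" "card B < card I" "\<And>i. i \<in> I \<Longrightarrow> r i \<in> real_rat_span B"
  shows "\<exists>u. (\<exists>i\<in>I. u i \<noteq> 0) \<and> (\<Sum>i\<in>I. of_rat (u i) * r i) = 0"
proof -
  obtain e where e: "bij_betw e {..<card B} B"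
    using ex_bij_betw_nat_finite[OF assms(1)] by (auto simp: atLeast0LessThan)
  obtain h where h: "bij_betw h {..<card I} I"
    using ex_bij_betw_nat_finite[OF assms(2)] by (auto simp: atLeast0LessThan)
  have hI: "h i \<in> I" if "i < card I" for i using h that by (auto simp: bij_betw_def)
  have "\<forall>i\<in>I. \<exists>c. r i = (\<Sum>g\<in>B. of_rat (c g) * g)" using assms(4) unfolding real_rat_span_def by blast
  then obtain c where c: "\<And>i. i \<in> I \<Longrightarrow> r i = (\<Sum>g\<in>B. of_rat (c i g) * g)" by metis
  \<comment> \<open>Zero columns pad the coefficient matrix to a square, hence singular,
    one.\<close>
  define A where "A i k = (if k < card B then c (h i) (e k) else 0)" for i k
  have "fdet (card I) A = fdet (card I) (\<lambda>i j. A j i)" by (rule fdet_transpose[symmetric])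
  also have "\<dots> = 0" using assms(3) by (intro fdet_zero_row[of "card B"]) (auto simp: A_def)
  finally obtain u where u: "\<exists>i<card I. u i \<noteq> 0" "\<And>k. k < card I \<Longrightarrow> (\<Sum>i<card I. u i * A i k) = 0"
    using fdet_left_kernel by blast
  let ?h' = "inv_into {..<card I} h"
  have h': "?h' (h i) = i" if "i < card I" for i using h that by (simp add: bij_betw_def inv_into_f_f)
  have "(\<Sum>i\<in>I. of_rat (u (?h' i)) * r i) = (\<Sum>i<card I. of_rat (u i) * r (h i))"
    by (subst sum.reindex_bij_betw[OF h, symmetric]) (simp add: h')
  also have "\<dots> = (\<Sum>i<card I. \<Sum>k<card B. of_rat (u i * A i k) * e k)"
  proof (intro sum.cong refl)
    fix i assume "i \<in> {..<card I}"
    then have "r (h i) = (\<Sum>g\<in>B. of_rat (c (h i) g) * g)" using c hI by simp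
    also have "\<dots> = (\<Sum>k<card B. of_rat (A i k) * e k)"
      by (subst sum.reindex_bij_betw[OF e, symmetric]) (simp add: A_def)
    finally show "of_rat (u i) * r (h i) = (\<Sum>k<card B. of_rat (u i * A i k) * e k)"
      by (simp add: sum_distrib_left of_rat_mult mult.assoc)
  qed
  also have "\<dots> = (\<Sum>k<card B. of_rat (\<Sum>i<card I. u i * A i k) * e k)"
    by (subst sum.swap) (simp add: of_rat_sum sum_distrib_right)
  also have "\<dots> = 0" using u(2) assms(3) by simp
  finally have "(\<Sum>i\<in>I. of_rat (u (?h' i)) * r i) = 0" .
  moreover have "\<exists>i\<in>I. u (?h' i) \<noteq> 0" using u(1) hI h' by metis
  ultimately show ?thesis by (intro exI[of _ "\<lambda>i. u (?h' i)"]) simp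
qed

text \<open>Multiplication by alpha shifts the coefficients, and the polynomial relation rewrites
  alpha^d. That \<open>d\<close> is independent of \<open>i\<close> is what the dimension count
  needs.\<close>

lemma algebraic_powers:
  fixes \<alpha> :: real
  assumes "algebraic \<alpha>"
  shows "\<exists>d q. \<forall>i. \<alpha> ^ i = (\<Sum>j<d. of_rat (q i j) * \<alpha> ^ j)"
proof -
  obtain p where p: "\<And>i. coeff p i \<in> \<rat>" "p \<noteq> 0" "poly p \<alpha> = 0"
    using assms unfolding algebraic_altdef by blast
  define d where "d = degree p"
  have "\<forall>i. \<exists>x. coeff p i = of_rat x" using p(1) by (metis Rats_cases)
  then obtain r where r: "\<And>i. coeff p i = of_rat (r i)" by metis
  have d0: "d > 0"
  proof (rule ccontr)
    assume "\<not> d > 0"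
    then obtain a where "p = [:a:]" unfolding d_def by (metis degree_eq_zeroE gr0I)
    then show False using p by simp
  qed
  have rd: "r d \<noteq> 0" using p(2) r[of d] unfolding d_def by (metis leading_coeff_0_iff of_rat_0)
  have "0 = (\<Sum>j\<le>d. coeff p j * \<alpha> ^ j)" using p(3) by (simp add: poly_altdef d_def)
  also have "\<dots> = (\<Sum>j<d. of_rat (r j) * \<alpha> ^ j) + of_rat (r d) * \<alpha> ^ d"
    by (simp add: r lessThan_Suc_atMost[symmetric])
  finally have "\<alpha> ^ d = - (\<Sum>j<d. of_rat (r j) * \<alpha> ^ j) / of_rat (r d)"
    using rd by (simp add: field_simps)
  also have "\<dots> = (\<Sum>j<d. of_rat (- r j / r d) * \<alpha> ^ j)"
    by (simp add: sum_divide_distrib of_rat_divide of_rat_minus sum_negf)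
  finally have ad: "\<alpha> ^ d = (\<Sum>j<d. of_rat (- r j / r d) * \<alpha> ^ j)" .
  have "\<exists>q. \<alpha> ^ i = (\<Sum>j<d. of_rat (q j) * \<alpha> ^ j)" for i
  proof (induction i)
    case 0
    have "(\<Sum>j<d. of_rat (if j = 0 then 1 else 0) * \<alpha> ^ j) = (1::real)"
      using d0 by (simp add: if_distrib[of of_rat] if_distrib[of "\<lambda>y. y * _"] sum.delta cong: if_cong)
    then show ?case by (metis power_0)
  next
    case (Suc i)
    then obtain q where q: "\<alpha> ^ i = (\<Sum>j<d. of_rat (q j) * \<alpha> ^ j)" by blast
    obtain e where e: "d = Suc e" using d0 by (cases d) auto
    have "\<alpha> ^ Suc i = (\<Sum>j<d. of_rat (q j) * \<alpha> ^ Suc j)"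
      by (simp add: q sum_distrib_left mult_ac)
    also have "\<dots> = (\<Sum>j<e. of_rat (q j) * \<alpha> ^ Suc j) + of_rat (q e) * \<alpha> ^ d" by (simp add: e)
    also have "(\<Sum>j<e. of_rat (q j) * \<alpha> ^ Suc j) = (\<Sum>j<d. of_rat (if j = 0 then 0 else q (j - 1)) * \<alpha> ^ j)"
      unfolding e sum.lessThan_Suc_shift by simp
    also have "of_rat (q e) * \<alpha> ^ d = (\<Sum>j<d. of_rat (q e * (- r j / r d)) * \<alpha> ^ j)"
      by (subst ad) (simp only: sum_distrib_left of_rat_mult mult.assoc)
    also have "(\<Sum>j<d. of_rat (if j = 0 then 0 else q (j - 1)) * \<alpha> ^ j) + (\<Sum>j<d. of_rat (q e * (- r j / r d)) * \<alpha> ^ j)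
        = (\<Sum>j<d. of_rat ((if j = 0 then 0 else q (j - 1)) + q e * (- r j / r d)) * \<alpha> ^ j)"
      by (simp only: of_rat_add distrib_right sum.distrib)
    finally show ?case by (intro exI[of _ "\<lambda>j. (if j = 0 then 0 else q (j - 1)) + q e * (- r j / r d)"])
  qed
  then show ?thesis by metis
qed

text \<open>m = 0 treats delta / e as the algebraic number, m = 1 treats delta itself. By the
  binomial theorem the products e^(-a) y_n(1)^b lie in the span of the alpha^i beta^j e^(-k) with k
  <= 2 E, of dimension only linear in E.\<close>

theorem polyexp_value_not_linear:
  assumes n: "n \<ge> 1" and "algebraic \<alpha>" "algebraic \<beta>" and m: "m \<le> 1"
  shows "fps_value (polyexp n) 1 \<noteq> of_rat y * (\<alpha> + \<beta> * exp (- 1) ^ m)"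
proof
  assume rel: "fps_value (polyexp n) 1 = of_rat y * (\<alpha> + \<beta> * exp (- 1) ^ m)"
  obtain d1 q1 where q1: "\<And>i. \<alpha> ^ i = (\<Sum>j<d1. of_rat (q1 i j) * \<alpha> ^ j)" using algebraic_powers[OF assms(2)] by blast
  obtain d2 q2 where q2: "\<And>i. \<beta> ^ i = (\<Sum>j<d2. of_rat (q2 i j) * \<beta> ^ j)" using algebraic_powers[OF assms(3)] by blast
  \<comment> \<open>Then d1 d2 (2 E + 1) = E (2 E + 1) / 2, which is below (E + 1)^2.\<close>
  define E where "E = 2 * (d1 * d2)"
  define x where "x = exp (- 1 :: real)"
  define B where "B = (\<lambda>(i, j, k). \<alpha> ^ i * \<beta> ^ j * x ^ k) ` ({..<d1} \<times> {..<d2} \<times> {..2 * E})"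
  have finB: "finite B" by (simp add: B_def)
  have "card B \<le> d1 * (d2 * Suc (2 * E))"
    unfolding B_def by (rule order_trans[OF card_image_le]) (auto simp: card_cartesian_product)
  moreover have "2 * (d1 * (d2 * Suc (2 * E))) = E * Suc (2 * E)" by (simp add: E_def algebra_simps)
  moreover have "E * Suc (2 * E) < 2 * (Suc E * Suc E)" by simp
  ultimately have card: "card B < Suc E * Suc E" by linarith
  have B_mem: "\<alpha> ^ s * \<beta> ^ t * x ^ k \<in> real_rat_span B" if "k \<le> 2 * E" for s t k
  proof -
    have "\<alpha> ^ s * \<beta> ^ t * x ^ k = (\<Sum>i<d1. \<Sum>j<d2. of_rat (q1 s i) * (of_rat (q2 t j) * (\<alpha> ^ i * \<beta> ^ j * x ^ k)))"
      by (subst q1[of s], subst q2[of t], unfold sum_product, unfold sum_distrib_right) (simp only: mult_ac)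
    also have "\<dots> \<in> real_rat_span B"
    proof (intro real_rat_span_sum real_rat_span_scale real_rat_span_base finB)
      fix i j assume "i \<in> {..<d1}" "j \<in> {..<d2}"
      then show "\<alpha> ^ i * \<beta> ^ j * x ^ k \<in> B" unfolding B_def using that by (intro image_eqI[of _ _ "(i, j, k)"]) auto
    qed
    finally show ?thesis .
  qed
  define I where "I = {..E} \<times> {..E}"
  define r where "r p = x ^ fst p * fps_value (polyexp n) 1 ^ snd p" for p
  have "\<exists>u. (\<exists>p\<in>I. u p \<noteq> 0) \<and> (\<Sum>p\<in>I. of_rat (u p) * r p) = 0"
  proof (rule rational_dependence[OF finB])
    show "finite I" by (simp add: I_def)
    show "card B < card I" using card by (simp add: I_def card_cartesian_product)
    fix p assume p: "p \<in> I"
    have "r p = (\<Sum>t\<le>snd p. of_rat (y ^ snd p * of_nat (snd p choose t)) *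
        (\<alpha> ^ t * \<beta> ^ (snd p - t) * x ^ (fst p + m * (snd p - t))))"
      unfolding r_def rel x_def[symmetric] power_mult_distrib[of "of_rat y"] binomial_ring sum_distrib_left
      by (intro sum.cong refl)
         (simp only: power_mult_distrib power_add power_mult mult_ac of_rat_of_nat_eq of_rat_mult of_rat_power)
    also have "\<dots> \<in> real_rat_span B"
    proof (intro real_rat_span_sum real_rat_span_scale B_mem)
      fix t assume "t \<in> {..snd p}"
      have "m * (snd p - t) \<le> 1 * snd p" using m by (intro mult_mono) auto
      then show "fst p + m * (snd p - t) \<le> 2 * E" using p by (auto simp: I_def)
    qed
    finally show "r p \<in> real_rat_span B" .
  qed
  then obtain u p0 where u: "p0 \<in> I" "u p0 \<noteq> 0" "(\<Sum>p\<in>I. of_rat (u p) * r p) = 0" by blast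
  obtain fs where fs: "triangular fs" "weighted_monomials (2 * E) n (2 * E * n) \<subseteq> rat_span fs"
    using monomials_in_triangular by blast
  define h where "h = (\<Sum>(a, b)\<in>I. fps_const (u (a, b)) * (expm ^ a * polyexp n ^ b))"
  have cv: "abs_conv (fps_const (u (a, b)) * (expm ^ a * polyexp n ^ b)) 1" "abs_conv (expm ^ a * polyexp n ^ b) 1" for a b
    by (intro abs_conv_mult abs_conv_const abs_conv_E_function E_function_power E_function_expm E_function_polyexp)+
  have "h \<in> rat_span fs"
    unfolding h_def
  proof (rule rat_span_sum, clarify)
    fix a b assume ab: "(a, b) \<in> I"
    have "expm ^ a * polyexp n ^ b = monomial a (replicate b n)" by (simp add: monomial_def)
    also have "\<dots> \<in> weighted_monomials (2 * E) n (2 * E * n)"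
      using ab n by (intro weighted_monomialsI) (auto simp: I_def sum_list_replicate)
    finally show "fps_const (u (a, b)) * (expm ^ a * polyexp n ^ b) \<in> rat_span fs"
      using fs(2) by (intro rat_span_scale) auto
  qed
  then obtain l where l: "h = (\<Sum>i<length fs. fps_const (l i) * fs ! i)" unfolding rat_span_def by blast
  have "(\<Sum>i<length fs. of_rat (l i) * fps_value (fs ! i) 1) = fps_value h 1"
    unfolding l using triangular_basic(3)[OF fs(1)]
    by (subst fps_value_sum) (auto simp: abs_conv_mult abs_conv_const abs_conv_E_function fps_value_mult fps_value_const)
  also have "\<dots> = (\<Sum>p\<in>I. of_rat (u p) * r p)"
    unfolding h_def
  proof (subst fps_value_sum)
    show "(\<Sum>p\<in>I. fps_value (case p of (a, b) \<Rightarrow> fps_const (u (a, b)) * (expm ^ a * polyexp n ^ b)) 1) = (\<Sum>p\<in>I. of_rat (u p) * r p)"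
    proof (intro sum.cong refl, clarify)
      fix a b
      show "fps_value (fps_const (u (a, b)) * (expm ^ a * polyexp n ^ b)) 1 = of_rat (u (a, b)) * r (a, b)"
        by (subst fps_value_mult[OF abs_conv_const cv(2)], subst fps_value_mult)
           (auto simp: fps_value_const fps_value_power E_function_expm E_function_polyexp fps_value_expm abs_conv_E_function E_function_power r_def x_def)
    qed
  qed (auto simp: cv)
  finally have "\<forall>i<length fs. l i = 0" using u(3) by (intro triangular_values_independent[OF fs(1)]) simp
  then have "h = 0" unfolding l by simp
  then show False
    using expm_polyexp_independent[OF n, of I p0 u] u unfolding h_def by (simp add: I_def)
qed

section \<open>Gumbel moments\<close>

text \<open>Up to the factor on the right, the integrand is the Erlang density of rate k +
  1.\<close>

lemma has_integral_power_exp: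
  "has_bochner_integral lborel (\<lambda>x::real. indicator {0..} x * (x ^ n * exp (- real (Suc k) * x)))
     (fact n / real (Suc k) ^ Suc n)"
proof -
  let ?l = "real (Suc k)"
  have "has_bochner_integral lborel (erlang_density n ?l) 1"
    using nn_integral_erlang_ith_moment[of ?l n 0]
    by (intro has_bochner_integral_nn_integral) auto
  then have "has_bochner_integral lborel (\<lambda>x. fact n / ?l ^ Suc n * erlang_density n ?l x) (fact n / ?l ^ Suc n * 1)"
    by (intro has_bochner_integral_mult_right) auto
  moreover have "fact n / ?l ^ Suc n * erlang_density n ?l x = indicator {0..} x * (x ^ n * exp (- ?l * x))" for x
    by (auto simp: erlang_density_def indicator_def simp del: of_nat_Suc power_Suc)
  ultimately show ?thesis by (simp del: of_nat_Suc power_Suc)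
qed

text \<open>Shift j = k + 1 with (k + 1)! (k + 1)^n = k! (k + 1)^(n+1), to match the integrated
  terms of the expanded density.\<close>

lemma fps_value_polyexp_sums: "(\<lambda>k. (- 1) ^ k / fact k * (1 / real (Suc k) ^ Suc n)) sums fps_value (polyexp n) 1"
proof -
  have "(\<lambda>k. - ((- 1) ^ Suc k / (fact (Suc k) * real (Suc k) ^ n))) sums - (- fps_value (polyexp n) 1)"
    using polyexp_neg_sums[of "- 1" n] by (intro sums_minus) simp
  moreover have "- ((- 1) ^ Suc k / (fact (Suc k) * real (Suc k) ^ n)) = (- 1) ^ k / fact k * (1 / real (Suc k) ^ Suc n)" for k
    by (simp add: mult_ac)
  ultimately show ?thesis by (simp only: minus_minus)
qed

definition gumbel_integrand :: "nat \<Rightarrow> real \<Rightarrow> real" where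
  "gumbel_integrand n x = x ^ n * exp (- x - exp (- x))"

text \<open>Termwise integration of the series of exp(-e^(-x)); the integrals of the absolute
  values, n! / (k! (k + 1)^(n+1)), are summable.\<close>

lemma gumbel_nonneg_part:
  shows "integrable lborel (\<lambda>x. indicator {0..} x * gumbel_integrand n x)"
    and "(LINT x|lborel. indicator {0..} x * gumbel_integrand n x) = fact n * fps_value (polyexp n) 1"
proof -
  define h where "h k x = indicator {0..} x * (x ^ n * exp (- real (Suc k) * x))" for k and x :: real
  define f where "f k x = (- 1) ^ k / fact k * h k x" for k x
  have h: "has_bochner_integral lborel (h k) (fact n / real (Suc k) ^ Suc n)" for k
    unfolding h_def by (rule has_integral_power_exp)
  have h0: "h k x \<ge> 0" for k x by (auto simp: h_def indicator_def)
  have intf: "integrable lborel (f k)" for k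
    unfolding f_def using h by (intro integrable_mult_right) (auto simp: has_bochner_integral_iff)
  have normf: "norm (f k x) = 1 / fact k * h k x" for k x
    using h0 by (simp add: f_def abs_mult power_abs)
  have fsums: "(\<lambda>k. f k x) sums (indicator {0..} x * gumbel_integrand n x)" for x
  proof -
    have "(\<lambda>k. (- exp (- x)) ^ k /\<^sub>R fact k) sums exp (- exp (- x))" by (rule exp_converges)
    then have "(\<lambda>k. indicator {0..} x * (x ^ n * exp (- x)) * ((- exp (- x)) ^ k /\<^sub>R fact k)) sums
        (indicator {0..} x * (x ^ n * exp (- x)) * exp (- exp (- x)))" by (rule sums_mult)
    moreover have "indicator {0..} x * (x ^ n * exp (- x)) * ((- exp (- x)) ^ k /\<^sub>R fact k) = f k x" for k
    proof -
      have "exp (- real (Suc k) * x) = exp (- x) * exp (- x) ^ k"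
        by (simp add: exp_of_nat_mult[symmetric] exp_add[symmetric] algebra_simps)
      then show ?thesis by (simp add: f_def h_def power_minus[of "exp (- x)"] divide_inverse mult_ac)
    qed
    moreover have "indicator {0..} x * (x ^ n * exp (- x)) * exp (- exp (- x)) = indicator {0..} x * gumbel_integrand n x"
      by (simp add: gumbel_integrand_def exp_diff exp_minus divide_inverse)
    ultimately show ?thesis by simp
  qed
  have ae: "AE x in lborel. summable (\<lambda>k. norm (f k x))"
  proof (rule AE_I2)
    fix x :: real
    have "summable (\<lambda>k. \<bar>x\<bar> ^ n * exp \<bar>x\<bar> * (exp \<bar>x\<bar> ^ k / fact k))"
      by (intro summable_mult exp_tail_le(1)) simp
    then show "summable (\<lambda>k. norm (f k x))"
    proof (rule summable_comparison_test')
      fix k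
      have "h k x \<le> \<bar>x\<bar> ^ n * (exp \<bar>x\<bar> * exp \<bar>x\<bar> ^ k)"
      proof (cases "x \<ge> 0")
        case True
        have "0 \<le> real (Suc k) * x" using True by simp
        then have "- real (Suc k) * x \<le> real (Suc k) * x" unfolding mult_minus_left by linarith
        then have "exp (- real (Suc k) * x) \<le> exp (real (Suc k) * x)" by (simp only: exp_le_cancel_iff)
        also have "\<dots> = exp x * exp x ^ k" by (simp add: exp_of_nat_mult[symmetric] exp_add[symmetric] algebra_simps)
        finally show ?thesis using True by (auto simp: h_def intro!: mult_left_mono)
      qed (simp add: h_def)
      then have "1 / fact k * h k x \<le> 1 / fact k * (\<bar>x\<bar> ^ n * (exp \<bar>x\<bar> * exp \<bar>x\<bar> ^ k))"
        by (intro mult_left_mono) auto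
      moreover have "norm (norm (f k x)) = 1 / fact k * h k x" using normf[of k x] h0[of k x] by simp
      ultimately show "norm (norm (f k x)) \<le> \<bar>x\<bar> ^ n * exp \<bar>x\<bar> * (exp \<bar>x\<bar> ^ k / fact k)"
        by (simp add: mult_ac)
    qed
  qed
  have "(LINT x|lborel. norm (f k x)) = 1 / fact k * (fact n / real (Suc k) ^ Suc n)" for k
    unfolding normf using h[of k] by (subst integral_mult_right_zero) (simp add: has_bochner_integral_iff)
  moreover have "summable (\<lambda>k. 1 / fact k * (fact n / real (Suc k) ^ Suc n))"
  proof (rule summable_comparison_test')
    show "summable (\<lambda>k. fact n * (1 ^ k / fact k :: real))" by (intro summable_mult exp_tail_le(1)) simp
    fix k
    have "fact n / real (Suc k) ^ Suc n \<le> fact n / 1"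
      by (intro divide_left_mono one_le_power) auto
    then have "1 / fact k * (fact n / real (Suc k) ^ Suc n) \<le> 1 / fact k * fact n"
      by (intro mult_left_mono) auto
    then show "norm (1 / fact k * (fact n / real (Suc k) ^ Suc n)) \<le> fact n * (1 ^ k / fact k)"
      by (simp add: mult_ac)
  qed
  ultimately have sumf: "summable (\<lambda>k. LINT x|lborel. norm (f k x))" by simp
  have eq: "(\<Sum>k. f k x) = indicator {0..} x * gumbel_integrand n x" for x
    using fsums by (simp add: sums_iff)
  show "integrable lborel (\<lambda>x. indicator {0..} x * gumbel_integrand n x)"
    using integrable_suminf[OF intf ae sumf] unfolding eq .
  have "(\<lambda>k. integral\<^sup>L lborel (f k)) sums (LINT x|lborel. indicator {0..} x * gumbel_integrand n x)"
    using sums_integral[OF intf ae sumf] unfolding eq .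
  moreover have "integral\<^sup>L lborel (f k) = fact n * ((- 1) ^ k / fact k * (1 / real (Suc k) ^ Suc n))" for k
    unfolding f_def using h[of k] by (subst integral_mult_right_zero) (simp add: has_bochner_integral_iff)
  moreover have "(\<lambda>k. fact n * ((- 1) ^ k / fact k * (1 / real (Suc k) ^ Suc n))) sums (fact n * fps_value (polyexp n) 1)"
    by (intro sums_mult fps_value_polyexp_sums)
  ultimately show "(LINT x|lborel. indicator {0..} x * gumbel_integrand n x) = fact n * fps_value (polyexp n) 1"
    by (simp only:) (rule sums_unique2)
qed

lemma gumbel_nonpos_part: "integrable lborel (\<lambda>x. indicator {..0} x * gumbel_integrand n x)"
proof -
  have "integrable lborel (\<lambda>x::real. indicator {0..} x * exp (- x))"
    using has_integral_power_exp[of 0 0] by (simp add: has_bochner_integral_iff)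
  then have "integrable lborel (\<lambda>x::real. indicator {0..} (- x) * exp x)"
    using lborel_integrable_real_affine[of "\<lambda>x. indicator {0..} x * exp (- x)" "- 1" 0] by simp
  then have "integrable lborel (\<lambda>x::real. 6 * fact n * (indicator {0..} (- x) * exp x))"
    by (intro integrable_mult_right) auto
  then show ?thesis
  proof (rule Bochner_Integration.integrable_bound)
    show "(\<lambda>x. indicator {..0} x * gumbel_integrand n x) \<in> borel_measurable lborel"
      unfolding gumbel_integrand_def by measurable
    \<comment> \<open>With t = -x, use t^n <= n! e^t and e^(3t) <= 6 exp(e^t). The cube pays for t^n
      and for the factor e^(-x), and leaves e^(-t) as integrable majorant.\<close>
    have bound: "norm (gumbel_integrand n x) \<le> 6 * fact n * exp x" if x: "x \<le> 0" for x
    proof -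
      define t where "t = - x"
      have t: "t \<ge> 0" using x by (simp add: t_def)
      have 1: "t ^ n \<le> fact n * exp t"
        using t by (rule power_le_fact_exp)
      have "exp t ^ 3 \<le> fact 3 * exp (exp t)" by (rule power_le_fact_exp) simp
      then have "exp t ^ 3 * exp (- exp t) \<le> fact 3 * exp (exp t) * exp (- exp t)" by (intro mult_right_mono) auto
      also have "\<dots> = 6" by (simp add: exp_minus fact_numeral)
      finally have 2: "exp t ^ 3 * exp (- exp t) \<le> 6" .
      have "norm (gumbel_integrand n x) = t ^ n * (exp t * exp (- exp t))"
        using t by (simp add: gumbel_integrand_def t_def abs_mult power_abs exp_diff exp_minus divide_inverse)
      also have "\<dots> \<le> (fact n * exp t) * (exp t * exp (- exp t))" using 1 by (intro mult_right_mono) auto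
      also have "\<dots> = fact n * exp x * (exp t ^ 3 * exp (- exp t))"
        by (simp add: t_def power3_eq_cube exp_minus)
      also have "\<dots> \<le> fact n * exp x * 6" using 2 by (intro mult_left_mono) auto
      finally show ?thesis by simp
    qed
    show "AE x in lborel. norm (indicator {..0} x * gumbel_integrand n x) \<le> norm (6 * fact n * (indicator {0..} (- x) * exp x))"
      using bound by (intro AE_I2) (auto simp: indicator_def)
  qed
qed

lemma gumbel_moment_plus_delta:
  assumes "n \<ge> 1"
  shows "gumbel_moment n + gumbel_delta n / exp 1 = fact n * fps_value (polyexp n) 1"
proof -
  \<comment> \<open>Both indicators contain 0; the double count does no harm, since the integrand is
    0 there for n >= 1.\<close>
  have "gumbel_moment n = (LINT x|lborel. indicator {..0} x * gumbel_integrand n x + indicator {0..} x * gumbel_integrand n x)"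
    unfolding gumbel_moment_def
    using assms by (intro Bochner_Integration.integral_cong refl) (auto simp: gumbel_integrand_def indicator_def)
  also have "\<dots> = (LINT x|lborel. indicator {..0} x * gumbel_integrand n x) + fact n * fps_value (polyexp n) 1"
    using gumbel_nonpos_part gumbel_nonneg_part by (subst Bochner_Integration.integral_add) auto
  also have "(LINT x|lborel. indicator {..0} x * gumbel_integrand n x) = - gumbel_delta n / exp 1"
    by (simp add: gumbel_delta_def set_lebesgue_integral_def gumbel_integrand_def)
  finally show ?thesis by simp
qed

theorem theorem2:
  fixes n :: nat
  assumes "n \<ge> 1"
  shows "(\<not> algebraic (gumbel_moment n) \<or> \<not> algebraic (gumbel_delta n / exp 1)) \<and>
         (\<not> algebraic (gumbel_moment n) \<or> \<not> algebraic (gumbel_delta n))"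
proof -
  have fps_value: "fps_value (polyexp n) 1 = of_rat (1 / fact n) * (gumbel_moment n + gumbel_delta n / exp 1)"
    unfolding gumbel_moment_plus_delta[OF assms] by (simp add: of_rat_divide of_rat_fact)
  have "fps_value (polyexp n) 1 = of_rat (1 / fact n) * (gumbel_moment n + gumbel_delta n / exp 1 * exp (- 1) ^ 0)"
    "fps_value (polyexp n) 1 = of_rat (1 / fact n) * (gumbel_moment n + gumbel_delta n * exp (- 1) ^ 1)"
    unfolding fps_value by (simp_all add: exp_minus divide_inverse)
  then show ?thesis using polyexp_value_not_linear[OF assms] by (metis le_numeral_extra(4) zero_le_one)
qed

end
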